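(* Let $\mathcal{E}$ be a finite biordered set, and let $\mathbf{u}=(i_1,a_1,\lambda_1)\dots(i_m,a_m,\lambda_m)$ and $\mathbf{v}=(j_1,b_1,\mu_1)\dots(j_m,b_m,\mu_m)$ be two elements of $\mathsf{IG}(\mathcal{E})$ of $\mathscr{D}$-fingerprint $(D_1,\dots,D_m)$. Then $\mathbf{u}=\mathbf{v}$ holds in $\mathsf{IG}(\mathcal{E})$ if and only if $i_1=j_1$, $\lambda_m=\mu_m$ and $$b_ma_m^{-1} \in (\{a_1^{-1}b_1\},\mathbf{u},\mathbf{v})\theta.$$
   Context: Biordered sets and $\mathsf{IG}(\mathcal{E})$. For a semigroup $S$ with set of idempotents $E(S)$, $\mathcal{E}_S$ is the partial algebra on $E(S)$ retaining the product $ef$ exactly when $\{ef,fe\}\cap\{e,f\}\neq\varnothing$ (then both $ef,fe$ are idempotents, and $\{e,f\}$ is called a basic pair). A biordered set is a partial algebra $\mathcal{E}=(E,\cdot)$ isomorphic to some $\mathcal{E}_S$. The free idempotent generated semigroup is $\mathsf{IG}(\mathcal{E})=\langle \overline{E}\mid \overline{e}\,\overline{f}=\overline{e\cdot f}\text{ whenever }\{e,f\}\text{ is a basic pair in }\mathcal{E}\rangle$, $\overline E=\{\overline e:e\in E\}$. For a word $w=e_1\dots e_n\in E^+$ put $\overline{w}=\overline{e_1}\dots\overline{e_n}\in\mathsf{IG}(\mathcal{E})$. Triples. For finite $\mathcal{E}$, every regular $\mathscr{D}$-class $D$ of $\mathsf{IG}(\mathcal{E})$ is a $\mathscr{J}$-class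 with completely $0$-simple principal factor; for each $D$ fix an identification of this principal factor with a Rees matrix semigroup $\mathcal{M}^0[G;I,\Lambda;P]$, where $G$ is (isomorphic to) the maximal subgroup of $D$, $I,\Lambda$ are finite sets indexing the $\mathscr{R}$- and $\mathscr{L}$-classes of $D$, and $P=(p_{\lambda i})$ is a $\Lambda\times I$ matrix over $G\cup\{0\}$ with a non-zero entry in every row and column; the multiplication is $(i,g,\lambda)(j,h,\mu)=(i,gp_{\lambda j}h,\mu)$ if $p_{\lambda j}\neq 0$, and $0$ otherwise. Elements of $D$ are thus written as triples $(i,g,\lambda)$, $i\in I$, $g\in G$, $\lambda\in\Lambda$. For $D_k$ the data are denoted $G_k,I_k,\Lambda_k$. Juxtaposed triples in the expressions for $\mathbf{u},\mathbf{v}$ are multiplied in $\mathsf{IG}(\mathcal{E})$. Fingerprints. An r-factorisation of $w\in E^+$ is a factorisation $w=w_1\dots w_m$ into nonempty words with every $\overline{w_i}$ regular in $\mathsf{IG}(\mathcal{E})$; it is minimal if $\overline{w_i\dots w_j}$ is non-regular whenever $i<j$. The sequence $(D_{\overline{w_1}},\dots,D_{\overline{w_m}})$ of $\mathscr{D}$-classes for a minimal r-factorisation depends only on the element $\overline{w}$, and is its $\mathscr{D}$-fingerprint. Writing $\mathbf{u}=(i_1,a_1,\lambda_1)\dots(i_m,a_m,\lambda_m)$ for an element of $\mathscr{D}$-fingerprint $(D_1,\dots,D_m)$ means that there is a word $p_1\dots p_m$ representing $\mathbf{u}$, written as a minimal r-factorisation, with $\overline{p_k}=(i_k,a_k,\lambda_k)\in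 D_k$ for all $k$; similarly for $\mathbf{v}$. Contact automaton. $G^\partial$ is the dual group of $G$, with $g\ast h=hg$. For $e\in E$, $i\in I_k$: if $\overline{e}(i,g,\lambda)\in D_k$ for some (equivalently all) $g,\lambda$, there are unique $\sigma_e^{(k)}i\in I_k$ and $\alpha_k(e,i)\in G_k$ with $\overline{e}(i,g,\lambda)=(\sigma_e^{(k)}i,\alpha_k(e,i)g,\lambda)$ for all $g,\lambda$; otherwise $\sigma_e^{(k)}i$ is undefined. Dually, if $(i,g,\lambda)\overline{e}\in D_k$ then $(i,g,\lambda)\overline{e}=(i,g\beta_k(\lambda,e),\lambda\tau_e^{(k)})$; otherwise $\lambda\tau^{(k)}_e$ is undefined. For regular $\mathscr{D}$-classes $D_1,D_2$ the contact automaton $\mathcal{A}(D_1,D_2)$ has vertex set $\Lambda_1\times I_2$ and an edge labelled by $e$ from $(\lambda,i)$ to $(\mu,j)$ iff either (a) $\lambda=\mu\tau_e^{(1)}$ and $\sigma_e^{(2)}i=j$, or (b) $\lambda\tau_e^{(1)}=\mu$ and $i=\sigma_e^{(2)}j$. The group label of the edge, in $G_1\times G_2^\partial$, is $(\beta_1(\mu,e)^{-1},\alpha_2(e,i))$ in case (a) and $(\beta_1(\lambda,e),\alpha_2(e,j)^{-1})$ in case (b); edges may be traversed in both directions, with inverse labels. The label of a walk is the product in $G_1\times G_2^\partial$ of its edge labels in order (the empty walk has label $(1,1)$). The vertex group $W_{(\lambda,i)}\leq G_1\times G_2^\partial$ is the group of labels of all closed walks based at $(\lambda,i)$. The same construction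 applies to $\mathcal{A}(D_k,D_{k+1})$, and $W_{(\lambda_k,i_{k+1})}$ is the vertex group of $(\lambda_k,i_{k+1})$ in $\mathcal{A}(D_k,D_{k+1})$. The map $\theta$. For $A\subseteq G_1$, define a sequence $A_k\subseteq G_k$, $1\le k\le m$, starting from $A_1=A$, as follows: $B_{1,2}=(A\times G_2)\cap W_{(\lambda_1,i_2)}g_{1,2}$; for $1<k<m$, $B_{k,k+1}=(a_k^{-1}A_k^{-1}b_k\times G_{k+1})\cap W_{(\lambda_k,i_{k+1})}g_{k,k+1}$; and $A_{k+1}=B_{k,k+1}\pi_2$ (second projection) for $1\le k<m$. Here $g_{k,k+1}$ is the label of any fixed walk from $(\lambda_k,i_{k+1})$ to $(\mu_k,j_{k+1})$ in $\mathcal{A}(D_k,D_{k+1})$; if there is no such walk, $B_{k,k+1}=\varnothing$. Then $(A,\mathbf{u},\mathbf{v})\theta=A_m\subseteq G_m$.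
   Formalization: The formal theorem assumes m ≥ 2; for m = 1 the displayed criterion reads b₁a₁⁻¹ = a₁⁻¹b₁ (with equal indices), which does not imply a₁ = b₁ (take a₁ = 1, b₁ ≠ 1), so the literal statement fails there. *)

theory Defs
  imports "HOL-Algebra.Coset"
begin

section \<open>Semigroups, Green's relations, principal factors\<close>

text \<open>HOL-Algebra has no carrier-based structure weaker than a monoid, hence this record.\<close>

record 'a sgrp = "'a partial_object" +
  sg_mult :: "'a \<Rightarrow> 'a \<Rightarrow> 'a" (infixl \<open>\<star>\<index>\<close> 70)

definition is_semigroup :: "'a sgrp \<Rightarrow> bool" where
  "is_semigroup S \<longleftrightarrow>
     (\<forall>x\<in>carrier S. \<forall>y\<in>carrier S. x \<star>\<^bsub>S\<^esub> y \<in> carrier S) \<and>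
     (\<forall>x\<in>carrier S. \<forall>y\<in>carrier S. \<forall>z\<in>carrier S.
        (x \<star>\<^bsub>S\<^esub> y) \<star>\<^bsub>S\<^esub> z = x \<star>\<^bsub>S\<^esub> (y \<star>\<^bsub>S\<^esub> z))"

definition sgrp_iso :: "'a sgrp \<Rightarrow> 'b sgrp \<Rightarrow> ('a \<Rightarrow> 'b) \<Rightarrow> bool" where
  "sgrp_iso S T \<phi> \<longleftrightarrow>
     bij_betw \<phi> (carrier S) (carrier T) \<and>
     (\<forall>x\<in>carrier S. \<forall>y\<in>carrier S. \<phi> (x \<star>\<^bsub>S\<^esub> y) = \<phi> x \<star>\<^bsub>T\<^esub> \<phi> y)"

definition idempotents :: "'a sgrp \<Rightarrow> 'a set" where
  "idempotents S = {e \<in> carrier S. e \<star>\<^bsub>S\<^esub> e = e}"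

definition regular_element :: "'a sgrp \<Rightarrow> 'a \<Rightarrow> bool" where
  "regular_element S a \<longleftrightarrow> a \<in> carrier S \<and> (\<exists>x\<in>carrier S. a \<star>\<^bsub>S\<^esub> x \<star>\<^bsub>S\<^esub> a = a)"

definition left_principal_ideal :: "'a sgrp \<Rightarrow> 'a \<Rightarrow> 'a set" where
  "left_principal_ideal S a = insert a {s \<star>\<^bsub>S\<^esub> a | s. s \<in> carrier S}"

definition right_principal_ideal :: "'a sgrp \<Rightarrow> 'a \<Rightarrow> 'a set" where
  "right_principal_ideal S a = insert a {a \<star>\<^bsub>S\<^esub> s | s. s \<in> carrier S}"

definition green_L :: "'a sgrp \<Rightarrow> ('a \<times> 'a) set" where
  "green_L S = {(a, b). a \<in> carrier S \<and> b \<in> carrier S \<and>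
                        left_principal_ideal S a = left_principal_ideal S b}"

definition green_R :: "'a sgrp \<Rightarrow> ('a \<times> 'a) set" where
  "green_R S = {(a, b). a \<in> carrier S \<and> b \<in> carrier S \<and>
                        right_principal_ideal S a = right_principal_ideal S b}"

definition green_D :: "'a sgrp \<Rightarrow> ('a \<times> 'a) set" where
  "green_D S = green_L S O green_R S"

definition D_class :: "'a sgrp \<Rightarrow> 'a \<Rightarrow> 'a set" where
  "D_class S a = green_D S `` {a}"

definition regular_D_class :: "'a sgrp \<Rightarrow> 'a set \<Rightarrow> bool" where
  "regular_D_class S D \<longleftrightarrow> (\<exists>a. regular_element S a \<and> D = D_class S a)"

text \<open>
  The principal factor of a \<open>\<J>\<close>-class \<open>J\<close>, that is, \<open>J \<union> {0}\<close> with all products that leave \<open>J\<close>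
  set to \<open>0\<close>; the zero is \<^const>\<open>None\<close>, and it is adjoined for every \<open>J\<close>, including the
  minimal ideal. Below it is formed for regular \<open>\<D>\<close>-classes, which are \<open>\<J>\<close>-classes in the
  free idempotent generated semigroup over a finite biordered set.
\<close>

definition principal_factor :: "'a sgrp \<Rightarrow> 'a set \<Rightarrow> 'a option sgrp" where
  "principal_factor S J =
     \<lparr> carrier = insert None (Some ` J),
       sg_mult = (\<lambda>x y. case (x, y) of
                  (Some a, Some b) \<Rightarrow> if a \<star>\<^bsub>S\<^esub> b \<in> J then Some (a \<star>\<^bsub>S\<^esub> b) else None
                | _ \<Rightarrow> None) \<rparr>"


section \<open>Rees matrix semigroups and coordinates for a \<open>\<D>\<close>-class\<close>

text \<open>
  \<^const>\<open>None\<close> is the zero, both of \<open>G \<union> {0}\<close> in the matrix and of the semigroup. Since \<open>\<lambda>\<close> is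
  reserved, elements of \<open>\<Lambda>\<close> are called \<open>l\<close> and \<open>\<mu>\<close>.
\<close>

definition rees_matrix_semigroup ::
  "'g monoid \<Rightarrow> 'i set \<Rightarrow> 'l set \<Rightarrow> ('l \<Rightarrow> 'i \<Rightarrow> 'g option) \<Rightarrow> ('i \<times> 'g \<times> 'l) option sgrp" where
  "rees_matrix_semigroup G I \<Lambda> P =
     \<lparr> carrier = insert None (Some ` (I \<times> carrier G \<times> \<Lambda>)),
       sg_mult = (\<lambda>x y. case (x, y) of
                  (Some (i, g, l), Some (j, h, \<mu>)) \<Rightarrow>
                    (case P l j of
                       Some p \<Rightarrow> Some (i, g \<otimes>\<^bsub>G\<^esub> p \<otimes>\<^bsub>G\<^esub> h, \<mu>)
                     | None \<Rightarrow> None)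
                | _ \<Rightarrow> None) \<rparr>"

definition rees_data ::
  "'g monoid \<Rightarrow> 'i set \<Rightarrow> 'l set \<Rightarrow> ('l \<Rightarrow> 'i \<Rightarrow> 'g option) \<Rightarrow> bool" where
  "rees_data G I \<Lambda> P \<longleftrightarrow>
     group G \<and> finite I \<and> finite \<Lambda> \<and>
     (\<forall>l\<in>\<Lambda>. \<forall>i\<in>I. P l i \<in> insert None (Some ` carrier G)) \<and>
     (\<forall>l\<in>\<Lambda>. \<exists>i\<in>I. P l i \<noteq> None) \<and>
     (\<forall>i\<in>I. \<exists>l\<in>\<Lambda>. P l i \<noteq> None)"

record ('i, 'g, 'l, 'a) rees_coords =
  grp :: "'g monoid"
  rows :: "'i set"
  cols :: "'l set"
  sandwich :: "'l \<Rightarrow> 'i \<Rightarrow> 'g option"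
  triple :: "'i \<times> 'g \<times> 'l \<Rightarrow> 'a"

text \<open>
  An identification of the principal factor of \<open>D\<close> with a Rees matrix semigroup. An isomorphism
  preserves the zero, so it is determined by the map \<^const>\<open>triple\<close> on the non-zero elements.
\<close>

definition identifies ::
  "'a sgrp \<Rightarrow> 'a set \<Rightarrow> ('i, 'g, 'l, 'a) rees_coords \<Rightarrow> bool" where
  "identifies S D R \<longleftrightarrow>
     rees_data (grp R) (rows R) (cols R) (sandwich R) \<and>
     sgrp_iso (rees_matrix_semigroup (grp R) (rows R) (cols R) (sandwich R))
              (principal_factor S D) (map_option (triple R))"


section \<open>Biordered sets and free idempotent generated semigroups\<close>

record 'e palgebra = "'e partial_object" +
  pmult :: "'e \<Rightarrow> 'e \<Rightarrow> 'e option"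

definition is_palgebra :: "'e palgebra \<Rightarrow> bool" where
  "is_palgebra E \<longleftrightarrow>
     (\<forall>e\<in>carrier E. \<forall>f\<in>carrier E. \<forall>g. pmult E e f = Some g \<longrightarrow> g \<in> carrier E)"

definition idempotent_palgebra :: "'a sgrp \<Rightarrow> 'a palgebra" where
  "idempotent_palgebra S =
     \<lparr> carrier = idempotents S,
       pmult = (\<lambda>e f. if e \<in> idempotents S \<and> f \<in> idempotents S \<and>
                         {e \<star>\<^bsub>S\<^esub> f, f \<star>\<^bsub>S\<^esub> e} \<inter> {e, f} \<noteq> {}
                      then Some (e \<star>\<^bsub>S\<^esub> f) else None) \<rparr>"

definition palgebra_iso :: "'e palgebra \<Rightarrow> 'f palgebra \<Rightarrow> ('e \<Rightarrow> 'f) \<Rightarrow> bool" where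
  "palgebra_iso E F \<phi> \<longleftrightarrow>
     bij_betw \<phi> (carrier E) (carrier F) \<and>
     (\<forall>e\<in>carrier E. \<forall>f\<in>carrier E. map_option \<phi> (pmult E e f) = pmult F (\<phi> e) (\<phi> f))"

text \<open>
  HOL cannot quantify over the type of the elements of the semigroup \<open>S\<close>; it is a parameter.
  As a premise of a theorem that is schematic in \<open>'s\<close>, this says that there is such a semigroup
  over some type.
\<close>

definition biordered_set :: "'s itself \<Rightarrow> 'e palgebra \<Rightarrow> bool" where
  "biordered_set _ E \<longleftrightarrow>
     is_palgebra E \<and>
     (\<exists>(S :: 's sgrp) \<phi>. is_semigroup S \<and> palgebra_iso E (idempotent_palgebra S) \<phi>)"

definition words :: "'e palgebra \<Rightarrow> 'e list set" where
  "words E = {w. w \<in> lists (carrier E) \<and> w \<noteq> []}"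

text \<open>
  The congruence on \<open>E\<^sup>+\<close> generated by the defining relations. In a biordered set the product
  \<open>e \<cdot> f\<close> is defined exactly when \<open>{e, f}\<close> is a basic pair.
\<close>

inductive ig_eq :: "'e palgebra \<Rightarrow> 'e list \<Rightarrow> 'e list \<Rightarrow> bool" for E where
  rel: "e \<in> carrier E \<Longrightarrow> f \<in> carrier E \<Longrightarrow> pmult E e f = Some g \<Longrightarrow>
        x \<in> lists (carrier E) \<Longrightarrow> y \<in> lists (carrier E) \<Longrightarrow>
        ig_eq E (x @ [e, f] @ y) (x @ [g] @ y)"
| refl: "w \<in> words E \<Longrightarrow> ig_eq E w w"
| sym: "ig_eq E w z \<Longrightarrow> ig_eq E z w"
| trans: "ig_eq E w z \<Longrightarrow> ig_eq E z t \<Longrightarrow> ig_eq E w t"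

definition bar :: "'e palgebra \<Rightarrow> 'e list \<Rightarrow> 'e list set" where
  "bar E w = {z. ig_eq E w z}"

definition IG :: "'e palgebra \<Rightarrow> 'e list set sgrp" where
  "IG E = \<lparr> carrier = words E // {(w, z). ig_eq E w z},
            sg_mult = (\<lambda>U V. \<Union>w\<in>U. \<Union>z\<in>V. bar E (w @ z)) \<rparr>"


section \<open>Minimal r-factorisations and fingerprints\<close>

text \<open>The factors of a word are \<open>p 1, \<dots>, p m\<close>; other values of \<open>p\<close> are irrelevant.\<close>

definition r_factorisation ::
  "'e palgebra \<Rightarrow> 'e list \<Rightarrow> nat \<Rightarrow> (nat \<Rightarrow> 'e list) \<Rightarrow> bool" where
  "r_factorisation E w m p \<longleftrightarrow>
     w \<in> words E \<and> w = concat (map p [1..<Suc m]) \<and>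
     (\<forall>k\<in>{1..m}. p k \<in> words E \<and> regular_element (IG E) (bar E (p k)))"

definition minimal_r_factorisation ::
  "'e palgebra \<Rightarrow> 'e list \<Rightarrow> nat \<Rightarrow> (nat \<Rightarrow> 'e list) \<Rightarrow> bool" where
  "minimal_r_factorisation E w m p \<longleftrightarrow>
     r_factorisation E w m p \<and>
     (\<forall>i j. 1 \<le> i \<and> i < j \<and> j \<le> m \<longrightarrow>
        \<not> regular_element (IG E) (bar E (concat (map p [i..<Suc j]))))"

definition has_fingerprint ::
  "'e palgebra \<Rightarrow> nat \<Rightarrow> (nat \<Rightarrow> 'e list set set) \<Rightarrow> 'e list set \<Rightarrow> bool" where
  "has_fingerprint E m D x \<longleftrightarrow>
     (\<exists>w p. minimal_r_factorisation E w m p \<and> x = bar E w \<and>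
            (\<forall>k\<in>{1..m}. D_class (IG E) (bar E (p k)) = D k))"


text \<open>\<open>C\<close> is the choice of an identification for every regular \<open>\<D>\<close>-class.\<close>

context
  fixes E :: "'e palgebra"
    and C :: "'e list set set \<Rightarrow> ('i, 'g, 'l, 'e list set) rees_coords"
begin

text \<open>\<open>x = (i\<^sub>1, a\<^sub>1, l\<^sub>1) \<dots> (i\<^sub>m, a\<^sub>m, l\<^sub>m)\<close>, with the \<open>k\<close>th triple taken in \<open>D k\<close>\<close>

definition written_as ::
  "nat \<Rightarrow> (nat \<Rightarrow> 'e list set set) \<Rightarrow> (nat \<Rightarrow> 'i) \<Rightarrow> (nat \<Rightarrow> 'g) \<Rightarrow> (nat \<Rightarrow> 'l) \<Rightarrow> 'e list set \<Rightarrow> bool"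
  where
  "written_as m D i a l x \<longleftrightarrow>
     (\<exists>w p. minimal_r_factorisation E w m p \<and> x = bar E w \<and>
        (\<forall>k\<in>{1..m}.
           i k \<in> rows (C (D k)) \<and> a k \<in> carrier (grp (C (D k))) \<and> l k \<in> cols (C (D k)) \<and>
           bar E (p k) = triple (C (D k)) (i k, a k, l k) \<and> bar E (p k) \<in> D k))"


section \<open>Contact automata\<close>

text \<open>The pair \<open>(\<sigma>\<^sub>e i, \<alpha>(e, i))\<close>, or \<^const>\<open>None\<close> if \<open>\<sigma>\<^sub>e i\<close> is undefined; dually for \<open>\<tau>\<close>, \<open>\<beta>\<close>.\<close>

definition left_action :: "'e list set set \<Rightarrow> 'e \<Rightarrow> 'i \<Rightarrow> ('i \<times> 'g) option" where
  "left_action D e i =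
     (if \<exists>g\<in>carrier (grp (C D)). \<exists>l\<in>cols (C D).
           bar E [e] \<star>\<^bsub>IG E\<^esub> triple (C D) (i, g, l) \<in> D
      then Some (THE (j, \<alpha>). j \<in> rows (C D) \<and> \<alpha> \<in> carrier (grp (C D)) \<and>
             (\<forall>g\<in>carrier (grp (C D)). \<forall>l\<in>cols (C D).
                bar E [e] \<star>\<^bsub>IG E\<^esub> triple (C D) (i, g, l) =
                triple (C D) (j, \<alpha> \<otimes>\<^bsub>grp (C D)\<^esub> g, l)))
      else None)"

definition right_action :: "'e list set set \<Rightarrow> 'l \<Rightarrow> 'e \<Rightarrow> ('l \<times> 'g) option" where
  "right_action D l e =
     (if \<exists>i\<in>rows (C D). \<exists>g\<in>carrier (grp (C D)).
           triple (C D) (i, g, l) \<star>\<^bsub>IG E\<^esub> bar E [e] \<in> D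
      then Some (THE (\<mu>, \<beta>). \<mu> \<in> cols (C D) \<and> \<beta> \<in> carrier (grp (C D)) \<and>
             (\<forall>i\<in>rows (C D). \<forall>g\<in>carrier (grp (C D)).
                triple (C D) (i, g, l) \<star>\<^bsub>IG E\<^esub> bar E [e] =
                triple (C D) (i, g \<otimes>\<^bsub>grp (C D)\<^esub> \<beta>, \<mu>)))
      else None)"

definition sigma :: "'e list set set \<Rightarrow> 'e \<Rightarrow> 'i \<Rightarrow> 'i option" where
  "sigma D e i = map_option fst (left_action D e i)"

definition alpha :: "'e list set set \<Rightarrow> 'e \<Rightarrow> 'i \<Rightarrow> 'g" where
  "alpha D e i = snd (the (left_action D e i))"

definition tau :: "'e list set set \<Rightarrow> 'l \<Rightarrow> 'e \<Rightarrow> 'l option" where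
  "tau D l e = map_option fst (right_action D l e)"

definition beta :: "'e list set set \<Rightarrow> 'l \<Rightarrow> 'e \<Rightarrow> 'g" where
  "beta D l e = snd (the (right_action D l e))"

definition dual_group :: "'h monoid \<Rightarrow> 'h monoid" where
  "dual_group G = G\<lparr>mult := \<lambda>g h. h \<otimes>\<^bsub>G\<^esub> g\<rparr>"

definition label_group :: "'e list set set \<Rightarrow> 'e list set set \<Rightarrow> ('g \<times> 'g) monoid" where
  "label_group D\<^sub>1 D\<^sub>2 = grp (C D\<^sub>1) \<times>\<times> dual_group (grp (C D\<^sub>2))"

definition contact_vertices :: "'e list set set \<Rightarrow> 'e list set set \<Rightarrow> ('l \<times> 'i) set" where
  "contact_vertices D\<^sub>1 D\<^sub>2 = cols (C D\<^sub>1) \<times> rows (C D\<^sub>2)"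

text \<open>
  An edge from \<open>(l, i)\<close> to \<open>(\<mu>, j)\<close> labelled by \<open>e\<close>, with group label \<open>x\<close>. If both cases apply
  then \<open>l = \<mu>\<close> and \<open>i = j\<close>, and the group labels coincide (both are trivial).
\<close>

inductive contact_edge ::
  "'e list set set \<Rightarrow> 'e list set set \<Rightarrow> ('l \<times> 'i) \<Rightarrow> 'e \<Rightarrow> ('g \<times> 'g) \<Rightarrow> ('l \<times> 'i) \<Rightarrow> bool"
  for D\<^sub>1 D\<^sub>2 where
  edge_a: "(l, i) \<in> contact_vertices D\<^sub>1 D\<^sub>2 \<Longrightarrow> (\<mu>, j) \<in> contact_vertices D\<^sub>1 D\<^sub>2 \<Longrightarrow> e \<in> carrier E \<Longrightarrow>
    tau D\<^sub>1 \<mu> e = Some l \<Longrightarrow> sigma D\<^sub>2 e i = Some j \<Longrightarrow>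
    contact_edge D\<^sub>1 D\<^sub>2 (l, i) e (inv\<^bsub>grp (C D\<^sub>1)\<^esub> (beta D\<^sub>1 \<mu> e), alpha D\<^sub>2 e i) (\<mu>, j)"
| edge_b: "(l, i) \<in> contact_vertices D\<^sub>1 D\<^sub>2 \<Longrightarrow> (\<mu>, j) \<in> contact_vertices D\<^sub>1 D\<^sub>2 \<Longrightarrow> e \<in> carrier E \<Longrightarrow>
    tau D\<^sub>1 l e = Some \<mu> \<Longrightarrow> sigma D\<^sub>2 e j = Some i \<Longrightarrow>
    contact_edge D\<^sub>1 D\<^sub>2 (l, i) e (beta D\<^sub>1 l e, inv\<^bsub>grp (C D\<^sub>2)\<^esub> (alpha D\<^sub>2 e j)) (\<mu>, j)"

inductive contact_walk ::
  "'e list set set \<Rightarrow> 'e list set set \<Rightarrow> ('l \<times> 'i) \<Rightarrow> ('g \<times> 'g) \<Rightarrow> ('l \<times> 'i) \<Rightarrow> bool"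
  for D\<^sub>1 D\<^sub>2 where
  empty: "s \<in> contact_vertices D\<^sub>1 D\<^sub>2 \<Longrightarrow> contact_walk D\<^sub>1 D\<^sub>2 s \<one>\<^bsub>label_group D\<^sub>1 D\<^sub>2\<^esub> s"
| forward: "contact_walk D\<^sub>1 D\<^sub>2 s x t \<Longrightarrow> contact_edge D\<^sub>1 D\<^sub>2 t e y r \<Longrightarrow>
    contact_walk D\<^sub>1 D\<^sub>2 s (x \<otimes>\<^bsub>label_group D\<^sub>1 D\<^sub>2\<^esub> y) r"
| backward: "contact_walk D\<^sub>1 D\<^sub>2 s x t \<Longrightarrow> contact_edge D\<^sub>1 D\<^sub>2 r e y t \<Longrightarrow>
    contact_walk D\<^sub>1 D\<^sub>2 s (x \<otimes>\<^bsub>label_group D\<^sub>1 D\<^sub>2\<^esub> inv\<^bsub>label_group D\<^sub>1 D\<^sub>2\<^esub> y) r"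

definition vertex_group ::
  "'e list set set \<Rightarrow> 'e list set set \<Rightarrow> ('l \<times> 'i) \<Rightarrow> ('g \<times> 'g) set" where
  "vertex_group D\<^sub>1 D\<^sub>2 s = {x. contact_walk D\<^sub>1 D\<^sub>2 s x s}"


section \<open>The map \<open>\<theta>\<close>\<close>

text \<open>
  \<open>g k\<close> is the label \<open>g\<^sub>k\<^sub>,\<^sub>k\<^sub>+\<^sub>1\<close> of a fixed walk from \<open>(l\<^sub>k, i\<^sub>k\<^sub>+\<^sub>1)\<close> to \<open>(\<mu>\<^sub>k, j\<^sub>k\<^sub>+\<^sub>1)\<close>, when there is a walk.
\<close>

definition walk_labels ::
  "nat \<Rightarrow> (nat \<Rightarrow> 'e list set set) \<Rightarrow> (nat \<Rightarrow> 'i) \<Rightarrow> (nat \<Rightarrow> 'l) \<Rightarrow> (nat \<Rightarrow> 'i) \<Rightarrow> (nat \<Rightarrow> 'l) \<Rightarrow>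
   (nat \<Rightarrow> 'g \<times> 'g) \<Rightarrow> bool" where
  "walk_labels m D i l j \<mu> g \<longleftrightarrow>
     (\<forall>k. 1 \<le> k \<and> k < m \<longrightarrow>
        (\<exists>x. contact_walk (D k) (D (Suc k)) (l k, i (Suc k)) x (\<mu> k, j (Suc k))) \<longrightarrow>
        contact_walk (D k) (D (Suc k)) (l k, i (Suc k)) (g k) (\<mu> k, j (Suc k)))"

text \<open>The set \<open>B\<^sub>k\<^sub>,\<^sub>k\<^sub>+\<^sub>1\<close> as a function of \<open>A\<^sub>k\<close>\<close>

definition B_set ::
  "(nat \<Rightarrow> 'e list set set) \<Rightarrow> (nat \<Rightarrow> 'i) \<Rightarrow> (nat \<Rightarrow> 'g) \<Rightarrow> (nat \<Rightarrow> 'l) \<Rightarrow>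
   (nat \<Rightarrow> 'i) \<Rightarrow> (nat \<Rightarrow> 'g) \<Rightarrow> (nat \<Rightarrow> 'l) \<Rightarrow> (nat \<Rightarrow> 'g \<times> 'g) \<Rightarrow>
   nat \<Rightarrow> 'g set \<Rightarrow> ('g \<times> 'g) set" where
  "B_set D i a l j b \<mu> g k A\<^sub>k =
     (if \<exists>x. contact_walk (D k) (D (Suc k)) (l k, i (Suc k)) x (\<mu> k, j (Suc k))
      then ((if k = 1 then A\<^sub>k
             else {inv\<^bsub>grp (C (D k))\<^esub> (a k) \<otimes>\<^bsub>grp (C (D k))\<^esub> inv\<^bsub>grp (C (D k))\<^esub> x
                     \<otimes>\<^bsub>grp (C (D k))\<^esub> b k | x. x \<in> A\<^sub>k})
            \<times> carrier (grp (C (D (Suc k)))))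
           \<inter> (vertex_group (D k) (D (Suc k)) (l k, i (Suc k))
                #>\<^bsub>label_group (D k) (D (Suc k))\<^esub> g k)
      else {})"

text \<open>The sequence \<open>A\<^sub>k\<close>; indexing starts at \<open>1\<close>, and the value at \<open>0\<close> is a dummy.\<close>

fun A_seq ::
  "(nat \<Rightarrow> 'e list set set) \<Rightarrow> (nat \<Rightarrow> 'i) \<Rightarrow> (nat \<Rightarrow> 'g) \<Rightarrow> (nat \<Rightarrow> 'l) \<Rightarrow>
   (nat \<Rightarrow> 'i) \<Rightarrow> (nat \<Rightarrow> 'g) \<Rightarrow> (nat \<Rightarrow> 'l) \<Rightarrow> (nat \<Rightarrow> 'g \<times> 'g) \<Rightarrow>
   'g set \<Rightarrow> nat \<Rightarrow> 'g set" where
  "A_seq D i a l j b \<mu> g A 0 = {}"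
| "A_seq D i a l j b \<mu> g A (Suc 0) = A"
| "A_seq D i a l j b \<mu> g A (Suc (Suc k)) =
     snd ` B_set D i a l j b \<mu> g (Suc k) (A_seq D i a l j b \<mu> g A (Suc k))"

definition theta ::
  "nat \<Rightarrow> (nat \<Rightarrow> 'e list set set) \<Rightarrow> (nat \<Rightarrow> 'i) \<Rightarrow> (nat \<Rightarrow> 'g) \<Rightarrow> (nat \<Rightarrow> 'l) \<Rightarrow>
   (nat \<Rightarrow> 'i) \<Rightarrow> (nat \<Rightarrow> 'g) \<Rightarrow> (nat \<Rightarrow> 'l) \<Rightarrow> (nat \<Rightarrow> 'g \<times> 'g) \<Rightarrow>
   'g set \<Rightarrow> 'g set" where
  "theta m D i a l j b \<mu> g A = A_seq D i a l j b \<mu> g A m"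

end

end

theory Submission
  imports Defs
begin

text \<open>
  A letter \<open>s\<close> is a seed of a word \<open>usv\<close> if \<open>us \<L> s \<R> sv\<close> in \<open>IG(E)\<close>. Having a seed is invariant under
  the defining relations, and if \<open>xy\<close> and \<open>yz\<close> have seeds then either so does \<open>xyz\<close>, or
  \<open>x \<R> xy\<close> and \<open>yz \<L> z\<close>. Hence a relation applied across a boundary of a minimal factorisation into
  seeded words merely moves a letter from one factor to its neighbour, without changing the
  \<open>\<R>\<close>-class of the left one and the \<open>\<L>\<close>-class of the right one; the same holds for two minimal
  factorisations of one word. This invariance also shows that the words with a seed are exactly
  those that represent regular elements.

  In coordinates, moving a letter from the \<open>k\<close>th factor to the next one is an edge of the \<open>k\<close>th
  contact automaton: it multiplies the group entry of the \<open>k\<close>th triple on the right, and that of the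
  next triple on the left, by the two components of the label. So two products are equal iff there
  are walks with labels \<open>(x\<^sub>k, y\<^sub>k)\<close> such that \<open>b\<^sub>k = y\<^sub>k\<^sub>-\<^sub>1 a\<^sub>k x\<^sub>k\<close>, with \<open>y\<^sub>0 = x\<^sub>m = 1\<close>; solving for
  \<open>x\<^sub>1, y\<^sub>1, x\<^sub>2, \<dots>\<close> from the left yields \<open>\<theta>\<close>.
\<close>

section \<open>Words with a seed\<close>

text \<open>Minimality is defined through regularity, which cannot be read off a word, whereas a
  seed can. So all work on words and factorisations is done with seeds, and the two notions are
  matched afterwards. A seeded word is regular by an explicit inverse. The converse needs stability
  (\<open>xs \<D> x\<close> implies \<open>xs \<R> x\<close>), which a possibly infinite semigroup
  need not have; here it is read off the Rees coordinates. These exist for regular \<D>-classes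
  only, hence the order: coordinates for the \<D>-classes of seeded words, then stability there,
  then a counting argument on the square of an idempotent. The second component of a label lives in
  the dual group because successive edges multiply the right-hand triple from the left, so the label
  met later stands in front.\<close>

lemma ig_eq_append:
  "ig_eq E w z \<Longrightarrow> x \<in> lists (carrier E) \<Longrightarrow> y \<in> lists (carrier E) \<Longrightarrow> ig_eq E (x @ w @ y) (x @ z @ y)"
proof (induction rule: ig_eq.induct)
  case (rel e f g x' y')
  then show ?case
    using ig_eq.rel[of e E f g "x @ x'" "y' @ y"] by simp
next
  case (refl w)
  then show ?case by (intro ig_eq.refl) (auto simp: words_def)
qed (auto intro: ig_eq.sym ig_eq.trans)

text \<open>These are the facts about idempotents on which the word calculus rests.
  \<open>pmult_basic\<close> is the basic-pair condition read inside the partial algebra. Grouping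
  its alternatives by letter gives \<open>ef \<R> e\<close> or \<open>ef \<L> f\<close>, see
  \<open>basic_Rrel\<close> and \<open>basic_Lrel\<close>.\<close>

locale basic_pair_algebra =
  fixes E :: "'e palgebra"
  assumes pmult_closed: "e \<in> carrier E \<Longrightarrow> f \<in> carrier E \<Longrightarrow> pmult E e f = Some g \<Longrightarrow> g \<in> carrier E"
    and pmult_idem: "e \<in> carrier E \<Longrightarrow> pmult E e e = Some e"
    and pmult_basic: "e \<in> carrier E \<Longrightarrow> f \<in> carrier E \<Longrightarrow> pmult E e f = Some g \<Longrightarrow>
      g = e \<or> g = f \<or> pmult E f e = Some e \<or> pmult E f e = Some f"
begin

abbreviation wds :: "'e list set" where "wds \<equiv> lists (carrier E)"

text \<open>Unlike \<^const>\<open>ig_eq\<close>, this is reflexive at the empty word, so that Green's relations can be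
  written with multipliers in \<open>E\<^sup>*\<close>.\<close>

definition eqv :: "'e list \<Rightarrow> 'e list \<Rightarrow> bool" (infix \<open>\<approx>\<close> 50) where
  "w \<approx> z \<longleftrightarrow> w = z \<or> ig_eq E w z"

definition Rrel :: "'e list \<Rightarrow> 'e list \<Rightarrow> bool" where
  "Rrel x y \<longleftrightarrow> (\<exists>s\<in>wds. \<exists>t\<in>wds. x @ s \<approx> y \<and> y @ t \<approx> x)"

definition Lrel :: "'e list \<Rightarrow> 'e list \<Rightarrow> bool" where
  "Lrel x y \<longleftrightarrow> (\<exists>s\<in>wds. \<exists>t\<in>wds. s @ x \<approx> y \<and> t @ y \<approx> x)"

lemma ig_eq_words: "ig_eq E w z \<Longrightarrow> w \<in> words E \<and> z \<in> words E"
  by (induction rule: ig_eq.induct) (auto simp: words_def dest: pmult_closed)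

lemma eqv_refl [simp]: "w \<approx> w"
  by (simp add: eqv_def)

lemma eqv_sym: "w \<approx> z \<Longrightarrow> z \<approx> w"
  by (auto simp: eqv_def intro: ig_eq.sym)

lemma eqv_trans [trans]: "w \<approx> z \<Longrightarrow> z \<approx> t \<Longrightarrow> w \<approx> t"
  by (auto simp: eqv_def intro: ig_eq.trans)

lemma eqv_wds: "w \<approx> z \<Longrightarrow> w \<in> wds \<longleftrightarrow> z \<in> wds"
  by (auto simp: eqv_def words_def dest!: ig_eq_words)

lemma eqv_append: "w \<approx> z \<Longrightarrow> x \<in> wds \<Longrightarrow> y \<in> wds \<Longrightarrow> x @ w @ y \<approx> x @ z @ y"
  by (auto simp: eqv_def intro: ig_eq_append)

lemma eqv_left: "w \<approx> z \<Longrightarrow> x \<in> wds \<Longrightarrow> x @ w \<approx> x @ z"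
  using eqv_append[of w z x "[]"] by simp

lemma eqv_right: "w \<approx> z \<Longrightarrow> y \<in> wds \<Longrightarrow> w @ y \<approx> z @ y"
  using eqv_append[of w z "[]" y] by simp

lemma eqv_basic: "e \<in> carrier E \<Longrightarrow> f \<in> carrier E \<Longrightarrow> pmult E e f = Some g \<Longrightarrow> [e, f] \<approx> [g]"
  using ig_eq.rel[of e E f g "[]" "[]"] by (simp add: eqv_def)

section \<open>Green's relations on words\<close>

lemma Rrel_refl [simp]: "Rrel x x"
  unfolding Rrel_def by (rule bexI[of _ "[]"], rule bexI[of _ "[]"]) auto

lemma Lrel_refl [simp]: "Lrel x x"
  unfolding Lrel_def by (rule bexI[of _ "[]"], rule bexI[of _ "[]"]) auto

lemma Rrel_sym: "Rrel x y \<Longrightarrow> Rrel y x"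
  unfolding Rrel_def by blast

lemma Lrel_sym: "Lrel x y \<Longrightarrow> Lrel y x"
  unfolding Lrel_def by blast

lemma Rrel_trans [trans]:
  assumes "Rrel x y" "Rrel y z" shows "Rrel x z"
proof -
  obtain s t where st: "s \<in> wds" "t \<in> wds" "x @ s \<approx> y" "y @ t \<approx> x"
    using assms(1) unfolding Rrel_def by blast
  obtain s' t' where st': "s' \<in> wds" "t' \<in> wds" "y @ s' \<approx> z" "z @ t' \<approx> y"
    using assms(2) unfolding Rrel_def by blast
  have "x @ (s @ s') \<approx> z"
    using eqv_trans[OF eqv_right[OF st(3) st'(1)] st'(3)] by simp
  moreover have "z @ (t' @ t) \<approx> x"
    using eqv_trans[OF eqv_right[OF st'(4) st(2)] st(4)] by simp
  ultimately show ?thesis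
    unfolding Rrel_def using st st' by (metis append_in_lists_conv)
qed

lemma Lrel_trans [trans]:
  assumes "Lrel x y" "Lrel y z" shows "Lrel x z"
proof -
  obtain s t where st: "s \<in> wds" "t \<in> wds" "s @ x \<approx> y" "t @ y \<approx> x"
    using assms(1) unfolding Lrel_def by blast
  obtain s' t' where st': "s' \<in> wds" "t' \<in> wds" "s' @ y \<approx> z" "t' @ z \<approx> y"
    using assms(2) unfolding Lrel_def by blast
  have "(s' @ s) @ x \<approx> z"
    using eqv_trans[OF eqv_left[OF st(3) st'(1)] st'(3)] by simp
  moreover have "(t @ t') @ z \<approx> x"
    using eqv_trans[OF eqv_left[OF st'(4) st(2)] st(4)] by simp
  ultimately show ?thesis
    unfolding Lrel_def using st st' by (metis append_in_lists_conv)
qed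

lemma eqv_imp_Rrel: "x \<approx> y \<Longrightarrow> Rrel x y"
  unfolding Rrel_def using eqv_sym by (intro bexI[of _ "[]"]) auto

lemma eqv_imp_Lrel: "x \<approx> y \<Longrightarrow> Lrel x y"
  unfolding Lrel_def using eqv_sym by (intro bexI[of _ "[]"]) auto

lemma Rrel_left: "Rrel x y \<Longrightarrow> a \<in> wds \<Longrightarrow> Rrel (a @ x) (a @ y)"
  unfolding Rrel_def using eqv_left by (metis append.assoc)

lemma Lrel_right: "Lrel x y \<Longrightarrow> a \<in> wds \<Longrightarrow> Lrel (x @ a) (y @ a)"
  unfolding Lrel_def using eqv_right by (metis append.assoc)

text \<open>\<open>xy\<close> lies between \<open>x\<close> and \<open>xyz\<close> in the order of
  principal right ideals, so it shares their \<R>-class.\<close>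

lemma Rrel_prefix:
  "Rrel (x @ y @ z) x \<Longrightarrow> y \<in> wds \<Longrightarrow> z \<in> wds \<Longrightarrow> Rrel (x @ y) x"
  unfolding Rrel_def by (metis append.assoc append_in_lists_conv eqv_refl)

lemma Lrel_suffix:
  "Lrel (x @ y @ z) z \<Longrightarrow> x \<in> wds \<Longrightarrow> y \<in> wds \<Longrightarrow> Lrel (y @ z) z"
  unfolding Lrel_def by (metis append.assoc append_in_lists_conv eqv_refl)

text \<open>A word with a seed represents a regular element, and conversely: see \<open>regular_iff_seeded\<close>.\<close>

definition seeded :: "'e list \<Rightarrow> bool" where
  "seeded w \<longleftrightarrow> (\<exists>u s v. w = u @ [s] @ v \<and> w \<in> wds \<and> Lrel (u @ [s]) [s] \<and> Rrel ([s] @ v) [s])"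

lemma seededI:
  "u @ [s] @ v \<in> wds \<Longrightarrow> Lrel (u @ [s]) [s] \<Longrightarrow> Rrel ([s] @ v) [s] \<Longrightarrow> seeded (u @ [s] @ v)"
  unfolding seeded_def by blast

lemma seeded_wds: "seeded w \<Longrightarrow> w \<in> wds \<and> w \<noteq> []"
  unfolding seeded_def by auto

lemma seeded_words: "seeded w \<Longrightarrow> w \<in> words E"
  using seeded_wds by (auto simp: words_def)

lemma seeded_letter: "e \<in> carrier E \<Longrightarrow> seeded [e]"
  using seededI[of "[]" e "[]"] by simp

text \<open>Left multiplication by \<open>u\<close> is undone on all right multiples of
  \<open>s\<close> by the \<open>t\<close> with \<open>tus \<approx> s\<close>, so an \<R>-relation
  between such multiples survives the removal of \<open>u\<close>.\<close>

lemma Rrel_cancel: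
  assumes "Lrel (u @ s) s" "Rrel (u @ s @ x) (u @ s @ y)" "x \<in> wds" "y \<in> wds"
  shows "Rrel (s @ x) (s @ y)"
proof -
  obtain t where t: "t \<in> wds" "t @ u @ s \<approx> s"
    using assms(1) unfolding Lrel_def by auto
  have "Rrel (s @ x) (t @ u @ s @ x)"
    using eqv_imp_Rrel[OF eqv_sym[OF eqv_right[OF t(2) assms(3)]]] by simp
  also have "Rrel \<dots> (t @ u @ s @ y)"
    using Rrel_left[OF assms(2) t(1)] by simp
  also have "Rrel \<dots> (s @ y)"
    using eqv_imp_Rrel[OF eqv_right[OF t(2) assms(4)]] by simp
  finally show ?thesis .
qed

lemma Lrel_cancel:
  assumes "Rrel (s @ v) s" "Lrel (x @ s @ v) (y @ s @ v)" "x \<in> wds" "y \<in> wds"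
  shows "Lrel (x @ s) (y @ s)"
proof -
  obtain t where t: "t \<in> wds" "s @ v @ t \<approx> s"
    using assms(1) unfolding Rrel_def by auto
  have "Lrel (x @ s) (x @ s @ v @ t)"
    using eqv_imp_Lrel[OF eqv_sym[OF eqv_left[OF t(2) assms(3)]]] by simp
  also have "Lrel \<dots> (y @ s @ v @ t)"
    using Lrel_right[OF assms(2) t(1)] by simp
  also have "Lrel \<dots> (y @ s)"
    using eqv_imp_Lrel[OF eqv_left[OF t(2) assms(4)]] by simp
  finally show ?thesis .
qed

text \<open>The seed of \<open>x\<close> serves again: on its left nothing changes, and on its right
  the prefix \<open>u\<close> is cancelled from \<open>xz \<R> x\<close> by
  \<open>Rrel_cancel\<close>.\<close>

lemma seeded_extend_right:
  assumes "seeded x" "Rrel (x @ z) x" "z \<in> wds"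
  shows "seeded (x @ z)"
proof -
  obtain u s v where s: "x = u @ [s] @ v" "x \<in> wds" "Lrel (u @ [s]) [s]" "Rrel ([s] @ v) [s]"
    using assms(1) unfolding seeded_def by blast
  have "Rrel ([s] @ (v @ z)) ([s] @ v)"
    by (rule Rrel_cancel[OF s(3)]) (use assms s in auto)
  then have "Rrel ([s] @ (v @ z)) [s]"
    using s(4) Rrel_trans by blast
  then show ?thesis
    using seededI[of u s "v @ z"] s assms(3) by simp
qed

lemma seeded_extend_left:
  assumes "seeded x" "Lrel (z @ x) x" "z \<in> wds"
  shows "seeded (z @ x)"
proof -
  obtain u s v where s: "x = u @ [s] @ v" "x \<in> wds" "Lrel (u @ [s]) [s]" "Rrel ([s] @ v) [s]"
    using assms(1) unfolding seeded_def by blast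
  have "Lrel ((z @ u) @ [s]) (u @ [s])"
    by (rule Lrel_cancel[OF s(4)]) (use assms s in auto)
  then have "Lrel ((z @ u) @ [s]) [s]"
    using s(3) Lrel_trans by blast
  then show ?thesis
    using seededI[of "z @ u" s v] s assms(3) by simp
qed

section \<open>Seeds under the defining relations\<close>

lemma split_three:
  assumes "u @ [s] @ v = x @ y @ z"
  obtains (left) x' where "x = u @ [s] @ x'" "v = x' @ y @ z"
  | (mid) y1 y2 where "y = y1 @ [s] @ y2" "u = x @ y1" "v = y2 @ z"
  | (right) z' where "z = z' @ [s] @ v" "u = x @ y @ z'"
  using assms by (auto simp: append_eq_append_conv2 append_eq_Cons_conv Cons_eq_append_conv)

text \<open>If \<open>fe = e\<close> then \<open>ge = efe = ee = e\<close>, while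
  \<open>g = ef\<close> is a right multiple of \<open>e\<close>.\<close>

lemma basic_Rrel:
  assumes "e \<in> carrier E" "f \<in> carrier E" "pmult E e f = Some g" "g = e \<or> pmult E f e = Some e"
  shows "Rrel [g] [e]"
  using assms(4)
proof
  assume fe: "pmult E f e = Some e"
  have g: "g \<in> carrier E" using pmult_closed assms by blast
  have 1: "[e] @ [f] \<approx> [g]" using eqv_basic assms by simp
  have "[g] @ [e] \<approx> [e, f] @ [e]" by (intro eqv_right eqv_sym[OF 1[simplified]]) (use assms in auto)
  also have "[e, f] @ [e] \<approx> [e] @ [e]"
    using eqv_left[OF eqv_basic[OF assms(2,1) fe], of "[e]"] assms by simp
  also have "[e] @ [e] \<approx> [e]" using eqv_basic[OF assms(1,1) pmult_idem] assms by simp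
  finally show ?thesis
    unfolding Rrel_def using 1 assms by (intro bexI[of _ "[e]"] bexI[of _ "[f]"]) auto
qed simp

lemma basic_Lrel:
  assumes "e \<in> carrier E" "f \<in> carrier E" "pmult E e f = Some g" "g = f \<or> pmult E f e = Some f"
  shows "Lrel [g] [f]"
  using assms(4)
proof
  assume fe: "pmult E f e = Some f"
  have 1: "[e] @ [f] \<approx> [g]" using eqv_basic assms by simp
  have "[f] @ [g] \<approx> [f] @ [e, f]" by (intro eqv_left eqv_sym[OF 1[simplified]]) (use assms in auto)
  also have "[f] @ [e, f] \<approx> [f] @ [f]"
    using eqv_right[OF eqv_basic[OF assms(2,1) fe], of "[f]"] assms by simp
  also have "[f] @ [f] \<approx> [f]" using eqv_basic[OF assms(2,2) pmult_idem] assms by simp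
  finally show ?thesis
    unfolding Lrel_def using 1 assms by (intro bexI[of _ "[f]"] bexI[of _ "[e]"]) auto
qed simp

text \<open>A seed outside the pair survives, since one side of it changes only by
  \<open>\<approx>\<close>. A seed in the pair disappears with the relation, and \<open>g\<close>
  takes over.\<close>

lemma seeded_contract:
  assumes "seeded (x @ [e, f] @ y)" "pmult E e f = Some g"
  shows "seeded (x @ [g] @ y)"
proof -
  have W: "x \<in> wds" "y \<in> wds" "e \<in> carrier E" "f \<in> carrier E"
    using seeded_wds[OF assms(1)] by auto
  have g: "g \<in> carrier E" using pmult_closed assms W by blast
  have ef: "[e, f] \<approx> [g]" using eqv_basic W assms by blast
  obtain u s v where s: "u @ [s] @ v = x @ [e, f] @ y" "Lrel (u @ [s]) [s]" "Rrel ([s] @ v) [s]"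
    using assms(1) unfolding seeded_def by metis
  have sW: "u \<in> wds" "s \<in> carrier E" "v \<in> wds"
    using W arg_cong[OF s(1), of "\<lambda>w. w \<in> wds"] by auto
  from s(1) show ?thesis
  proof (cases rule: split_three)
    case (left x')
    have "Rrel ([s] @ x' @ [g] @ y) ([s] @ x' @ [e, f] @ y)"
      using eqv_imp_Rrel[OF eqv_append[OF eqv_sym[OF ef], of "[s] @ x'" y]] W left by simp
    then have "Rrel ([s] @ x' @ [g] @ y) [s]"
      using s(3) left Rrel_trans by auto
    then show ?thesis using seededI[of u s "x' @ [g] @ y"] s(2) left W g sW by simp
  next
    case (right z')
    have "Lrel (x @ [g] @ z' @ [s]) (x @ [e, f] @ z' @ [s])"
      using eqv_imp_Lrel[OF eqv_append[OF eqv_sym[OF ef], of x "z' @ [s]"]] W right by simp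
    then have "Lrel (x @ [g] @ z' @ [s]) [s]"
      using s(2) right Lrel_trans by auto
    then show ?thesis using seededI[of "x @ [g] @ z'" s v] s(3) right W g sW by simp
  next
    case (mid y1 y2)
    then consider "y1 = []" "s = e" "y2 = [f]" | "y1 = [e]" "s = f" "y2 = []"
      by (cases y1; cases "tl y1"; auto)
    then show ?thesis
    proof cases
      \<comment> \<open>The seed is \<open>e\<close>. As a prefix of \<open>efy\<close>, the word
        \<open>ef\<close> is \<R>-related to \<open>e\<close>, hence so is \<open>g\<close>; the
        left condition for \<open>g\<close> is that for \<open>e\<close>, multiplied by
        \<open>f\<close> on the right.\<close>
      case 1
      have "Lrel (x @ [e]) [e]" "Rrel ([e] @ [f] @ y) [e]"
        using s(2,3) mid(2,3) 1 by auto
      have "Rrel ([e] @ [f]) [e]"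
        using Rrel_prefix[of "[e]" "[f]" y] \<open>Rrel ([e] @ [f] @ y) [e]\<close> W by simp
      then have ge: "Rrel [g] [e]" using eqv_imp_Rrel[OF eqv_sym[OF ef]] Rrel_trans by simp
      have "Lrel (x @ [g]) (x @ [e, f])"
        using eqv_imp_Lrel[OF eqv_left[OF eqv_sym[OF ef]]] W by blast
      also have "Lrel \<dots> [e, f]" using Lrel_right[OF \<open>Lrel (x @ [e]) [e]\<close>, of "[f]"] W by simp
      also have "Lrel \<dots> [g]" using eqv_imp_Lrel[OF ef] .
      finally have 2: "Lrel (x @ [g]) [g]" .
      have "Rrel ([g] @ y) ([e, f] @ y)"
        using eqv_imp_Rrel[OF eqv_right[OF eqv_sym[OF ef]]] W by blast
      also have "Rrel \<dots> [e]" using \<open>Rrel ([e] @ [f] @ y) [e]\<close> by simp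
      also have "Rrel \<dots> [g]" using Rrel_sym ge by blast
      finally show ?thesis using seededI[OF _ 2] W g by simp
    next
      case 2
      have 3: "Lrel (x @ [e] @ [f]) [f]" "Rrel ([f] @ y) [f]"
        using s(2,3) mid(2,3) 2 by auto
      have "Lrel ([e] @ [f]) [f]"
        using Lrel_suffix[of x "[e]" "[f]"] 3 W by simp
      then have ge: "Lrel [g] [f]" using eqv_imp_Lrel[OF eqv_sym[OF ef]] Lrel_trans by simp
      have "Rrel ([g] @ y) ([e, f] @ y)"
        using eqv_imp_Rrel[OF eqv_right[OF eqv_sym[OF ef]]] W by blast
      also have "Rrel \<dots> [e, f]" using Rrel_left[OF \<open>Rrel ([f] @ y) [f]\<close>, of "[e]"] W by simp
      also have "Rrel \<dots> [g]" using eqv_imp_Rrel[OF ef] .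
      finally have 4: "Rrel ([g] @ y) [g]" .
      have "Lrel (x @ [g]) (x @ [e, f])"
        using eqv_imp_Lrel[OF eqv_left[OF eqv_sym[OF ef]]] W by blast
      also have "Lrel \<dots> [f]" using 3 by simp
      also have "Lrel \<dots> [g]" using Lrel_sym ge by blast
      finally show ?thesis using seededI[OF _ _ 4] W g by simp
    qed
  qed
qed

text \<open>Only the case that \<open>g\<close> itself is the seed needs an idea: if
  \<open>g \<R> e\<close> the new seed is \<open>e\<close>, if \<open>g \<L> f\<close> it is
  \<open>f\<close>, and \<open>pmult_basic\<close> guarantees one of the two.\<close>

lemma seeded_expand:
  assumes "seeded (x @ [g] @ y)" "e \<in> carrier E" "f \<in> carrier E" "pmult E e f = Some g"
  shows "seeded (x @ [e, f] @ y)"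
proof -
  have W: "x \<in> wds" "y \<in> wds" "e \<in> carrier E" "f \<in> carrier E" "g \<in> carrier E"
    using seeded_wds[OF assms(1)] assms by auto
  have ef: "[e, f] \<approx> [g]" using eqv_basic W assms by blast
  obtain u s v where s: "u @ [s] @ v = x @ [g] @ y" "Lrel (u @ [s]) [s]" "Rrel ([s] @ v) [s]"
    using assms(1) unfolding seeded_def by metis
  have sW: "u \<in> wds" "s \<in> carrier E" "v \<in> wds"
    using W arg_cong[OF s(1), of "\<lambda>w. w \<in> wds"] by auto
  from s(1) show ?thesis
  proof (cases rule: split_three)
    case (left x')
    have "Rrel ([s] @ x' @ [e, f] @ y) ([s] @ x' @ [g] @ y)"
      using eqv_imp_Rrel[OF eqv_append[OF ef, of "[s] @ x'" y]] W left by simp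
    then have "Rrel ([s] @ x' @ [e, f] @ y) [s]"
      using s(3) left Rrel_trans by auto
    then show ?thesis using seededI[of u s "x' @ [e, f] @ y"] s(2) left W sW by simp
  next
    case (right z')
    have "Lrel (x @ [e, f] @ z' @ [s]) (x @ [g] @ z' @ [s])"
      using eqv_imp_Lrel[OF eqv_append[OF ef, of x "z' @ [s]"]] W right by simp
    then have "Lrel (x @ [e, f] @ z' @ [s]) [s]"
      using s(2) right Lrel_trans by auto
    then show ?thesis using seededI[of "x @ [e, f] @ z'" s v] s(3) right W sW by simp
  next
    case (mid y1 y2)
    then have "y1 = []" "s = g" "y2 = []"
      by (cases y1; auto)+
    then have g: "Lrel (x @ [g]) [g]" "Rrel ([g] @ y) [g]"
      using s(2,3) mid(2,3) by auto
    have g': "Lrel (x @ [e, f]) [g]" "Rrel ([e, f] @ y) [g]"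
      using eqv_imp_Lrel[OF eqv_left[OF ef]] eqv_imp_Rrel[OF eqv_right[OF ef]] g W
        Lrel_trans Rrel_trans by blast+
    consider "g = e \<or> pmult E f e = Some e" | "g = f \<or> pmult E f e = Some f"
      using pmult_basic assms by blast
    then show ?thesis
    proof cases
      case 1
      have R: "Rrel [g] [e]" using basic_Rrel[OF assms(2-4) 1] .
      \<comment> \<open>With \<open>gt \<approx> e\<close>, right multiplication by \<open>t\<close>
        carries \<open>xg \<L> g\<close> to \<open>xe \<L> e\<close>.\<close>
      obtain t where t: "t \<in> wds" "[g] @ t \<approx> [e]" using R unfolding Rrel_def by blast
      have "Lrel (x @ [e]) ((x @ [g]) @ t)"
        using eqv_imp_Lrel[OF eqv_left[OF eqv_sym[OF t(2)]]] W by simp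
      also have "Lrel \<dots> ([g] @ t)" using Lrel_right[OF g(1) t(1)] .
      also have "Lrel \<dots> [e]" using eqv_imp_Lrel[OF t(2)] .
      finally have "Lrel (x @ [e]) [e]" .
      moreover have "Rrel ([e] @ [f] @ y) [e]" using g'(2) R Rrel_trans by simp
      ultimately show ?thesis using seededI[of x e "[f] @ y"] W by simp
    next
      case 2
      have R: "Lrel [g] [f]" using basic_Lrel[OF assms(2-4) 2] .
      obtain t where t: "t \<in> wds" "t @ [g] \<approx> [f]" using R unfolding Lrel_def by blast
      have "Rrel ([f] @ y) (t @ [g] @ y)"
        using eqv_imp_Rrel[OF eqv_right[OF eqv_sym[OF t(2)]]] W by simp
      also have "Rrel \<dots> (t @ [g])" using Rrel_left[OF g(2) t(1)] .
      also have "Rrel \<dots> [f]" using eqv_imp_Rrel[OF t(2)] .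
      finally have "Rrel ([f] @ y) [f]" .
      moreover have "Lrel ((x @ [e]) @ [f]) [f]" using g'(1) R Lrel_trans by simp
      ultimately show ?thesis using seededI[of "x @ [e]" f y] W by simp
    qed
  qed
qed

lemma seeded_ig_eq: "ig_eq E w z \<Longrightarrow> seeded w = seeded z"
  by (induction rule: ig_eq.induct) (metis seeded_contract seeded_expand, auto)

lemma seeded_eqv: "w \<approx> z \<Longrightarrow> seeded w = seeded z"
  by (auto simp: eqv_def seeded_ig_eq)

text \<open>\<open>y\<close> equals an extension of \<open>x\<close> inside its \<R>-class, and such
  extensions keep the seed. With \<open>seeded_Lrel\<close>, having a seed depends only on the
  \<D>-class.\<close>

lemma seeded_Rrel:
  assumes "Rrel x y" shows "seeded x = seeded y"
proof -
  have "seeded y" if xy: "Rrel x y" "seeded x" for x y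
  proof -
    obtain s t where st: "s \<in> wds" "t \<in> wds" "x @ s \<approx> y" "y @ t \<approx> x"
      using xy(1) unfolding Rrel_def by blast
    have "Rrel (x @ s) x" using eqv_imp_Rrel[OF st(3)] xy(1) Rrel_sym Rrel_trans by blast
    then show ?thesis using seeded_extend_right[OF xy(2) _ st(1)] seeded_eqv[OF st(3)] by simp
  qed
  then show ?thesis using assms Rrel_sym by blast
qed

lemma seeded_Lrel:
  assumes "Lrel x y" shows "seeded x = seeded y"
proof -
  have "seeded y" if xy: "Lrel x y" "seeded x" for x y
  proof -
    obtain s t where st: "s \<in> wds" "t \<in> wds" "s @ x \<approx> y" "t @ y \<approx> x"
      using xy(1) unfolding Lrel_def by blast
    have "Lrel (s @ x) x" using eqv_imp_Lrel[OF st(3)] xy(1) Lrel_sym Lrel_trans by blast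
    then show ?thesis using seeded_extend_left[OF xy(2) _ st(1)] seeded_eqv[OF st(3)] by simp
  qed
  then show ?thesis using assms Lrel_sym by blast
qed

section \<open>Where the seed of a product lies\<close>

lemma seeded_append_cases:
  assumes "seeded (x @ y)"
  obtains (left) "seeded x" "Rrel (x @ y) x" | (right) "seeded y" "Lrel (x @ y) y"
proof -
  obtain u s v where s: "x @ y = u @ [s] @ v" "Lrel (u @ [s]) [s]" "Rrel ([s] @ v) [s]"
    using assms unfolding seeded_def by metis
  have W: "x \<in> wds" "y \<in> wds" "s \<in> carrier E" "u \<in> wds" "v \<in> wds"
    using seeded_wds[OF assms] arg_cong[OF s(1), of "\<lambda>w. w \<in> wds"] by simp_all
  consider x' where "x = u @ [s] @ x'" "v = x' @ y" | y' where "y = y' @ [s] @ v" "u = x @ y'"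
    using s(1) by (auto simp: append_eq_append_conv2 append_eq_Cons_conv)
  then show ?thesis
  proof cases
    case 1
    have R: "Rrel ([s] @ x' @ y) [s]" using s(3) 1 by simp
    then have R': "Rrel ([s] @ x') [s]" using Rrel_prefix[of "[s]" x' y] W 1 by simp
    have "Rrel (u @ ([s] @ x' @ y)) (u @ ([s] @ x'))"
      by (rule Rrel_left[OF Rrel_trans[OF R Rrel_sym[OF R']] W(4)])
    then show ?thesis using left 1 seededI[of u s x'] s(2) R' W by simp
  next
    case 2
    have R: "Lrel (x @ y' @ [s]) [s]" using s(2) 2 by simp
    then have R': "Lrel (y' @ [s]) [s]" using Lrel_suffix[of x y' "[s]"] W 2 by simp
    have "Lrel ((x @ y' @ [s]) @ v) ((y' @ [s]) @ v)"
      by (rule Lrel_right[OF Lrel_trans[OF R Lrel_sym[OF R']] W(5)])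
    then show ?thesis using right 2 seededI[of y' s v] s(3) R' W by simp
  qed
qed

text \<open>A seed in \<open>x\<close> gives \<open>xy \<R> x\<close> by passing to a prefix. A seed
  in \<open>y\<close> gives \<open>xy \<L> y\<close>, since \<open>yz \<R> y\<close> allows
  \<open>z\<close> to be cancelled. Only a seed in \<open>z\<close> leaves \<open>xy\<close>
  undecided, and then \<open>yz\<close> is seeded.\<close>

lemma seeded_append3_cases:
  assumes "seeded (x @ y @ z)"
  obtains (left) "seeded (x @ y)" | (right) "seeded (y @ z)" "seeded z"
proof -
  have W: "x \<in> wds" "y \<in> wds" "z \<in> wds"
    using seeded_wds[OF assms] by simp_all
  from assms show ?thesis
  proof (cases rule: seeded_append_cases)
    case left
    then show ?thesis
      using that(1) W Rrel_prefix seeded_extend_right by blast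
  next
    case right
    from right(1) show ?thesis
    proof (cases rule: seeded_append_cases)
      case left
      then have "Lrel (x @ y) ([] @ y)"
        using Lrel_cancel[OF left(2), of x "[]"] right(2) W by simp
      then show ?thesis using that(1) seeded_extend_left left(1) W by simp
    next
      case right': right
      then show ?thesis using that(2) right(1) by blast
    qed
  qed
qed

text \<open>A seed of \<open>xy\<close> that lies in \<open>y\<close> gives
  \<open>xy \<L> y\<close>, hence \<open>xyz \<L> yz\<close>, and \<open>xyz\<close> would be
  seeded; dually for \<open>yz\<close>. So the seeds lie outside the overlap \<open>y\<close>, which
  is what allows \<open>y\<close> to change sides.\<close>

lemma seeded_overlap:
  assumes "seeded (x @ y)" "seeded (y @ z)" "\<not> seeded (x @ y @ z)"
  shows "seeded x" "Rrel (x @ y) x" "seeded z" "Lrel (y @ z) z"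
proof -
  have W: "x \<in> wds" "y \<in> wds" "z \<in> wds"
    using seeded_wds[OF assms(1)] seeded_wds[OF assms(2)] by simp_all
  have "seeded x \<and> Rrel (x @ y) x"
    using assms(1)
  proof (cases rule: seeded_append_cases)
    case right
    then have "Lrel (x @ y @ z) (y @ z)" using Lrel_right W by fastforce
    then show ?thesis using assms seeded_Lrel by blast
  qed simp
  moreover have "seeded z \<and> Lrel (y @ z) z"
    using assms(2)
  proof (cases rule: seeded_append_cases)
    case left
    then have "Rrel (x @ y @ z) (x @ y)" using Rrel_left W by fastforce
    then show ?thesis using assms seeded_Rrel by blast
  qed simp
  ultimately show "seeded x" "Rrel (x @ y) x" "seeded z" "Lrel (y @ z) z"
    by simp_all
qed

section \<open>Minimal factorisations into seeded words\<close>

text \<open>By \<open>seeded_append3_cases\<close> it suffices for minimality that no two adjacent factors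
  can be merged.\<close>

definition minfact :: "'e list list \<Rightarrow> bool" where
  "minfact P \<longleftrightarrow> (\<forall>p\<in>set P. seeded p) \<and> successively (\<lambda>p q. \<not> seeded (p @ q)) P"

text \<open>\<open>push\<close> and \<open>pull\<close> are inverse to each other; their conditions
  keep the \<R>-class of the left factor and the \<L>-class of the right one. \<open>equal\<close>
  may change the word of a factor, so the concatenation is kept only up to
  \<open>\<approx>\<close>.\<close>

inductive transfer :: "'e list list \<Rightarrow> 'e list list \<Rightarrow> bool" where
  equal: "p \<approx> q \<Longrightarrow> transfer (A @ [p] @ B) (A @ [q] @ B)"
| push: "e \<in> carrier E \<Longrightarrow> Rrel (p @ [e]) p \<Longrightarrow> Lrel ([e] @ q) q \<Longrightarrow>
    transfer (A @ [p @ [e], q] @ B) (A @ [p, [e] @ q] @ B)"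
| pull: "e \<in> carrier E \<Longrightarrow> Rrel (p @ [e]) p \<Longrightarrow> Lrel ([e] @ q) q \<Longrightarrow>
    transfer (A @ [p, [e] @ q] @ B) (A @ [p @ [e], q] @ B)"

abbreviation "conn \<equiv> transfer\<^sup>*\<^sup>*"

lemma transfer_sym: "transfer P Q \<Longrightarrow> transfer Q P"
  by (induction rule: transfer.induct) (auto intro: transfer.intros eqv_sym simp del: append.simps)

lemma conn_sym: "conn P Q \<Longrightarrow> conn Q P"
  by (induction rule: rtranclp_induct) (auto intro: transfer_sym converse_rtranclp_into_rtranclp)

lemma conn_length: "conn P Q \<Longrightarrow> length P = length Q"
  by (induction rule: rtranclp_induct) (auto elim!: transfer.cases)

lemma transfer_Cons: "transfer P Q \<Longrightarrow> transfer (p # P) (p # Q)"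
proof (induction rule: transfer.induct)
  case (equal r q A B)
  then show ?case using transfer.equal[of r q "p # A" B] by simp
next
  case (push e r q A B)
  then show ?case using transfer.push[of e r q "p # A" B] by simp
next
  case (pull e r q A B)
  then show ?case using transfer.pull[of e r q "p # A" B] by simp
qed

lemma conn_Cons: "conn P Q \<Longrightarrow> conn (p # P) (p # Q)"
  by (induction rule: rtranclp_induct) (auto intro: transfer_Cons rtranclp.rtrancl_into_rtrancl)

text \<open>The letters of \<open>y\<close> move one at a time, the last one first. The conditions
  for the single moves follow from those for \<open>y\<close>, because \<R> passes to prefixes and
  \<L> to suffixes.\<close>

lemma conn_move:
  "y \<in> wds \<Longrightarrow> Rrel (p @ y) p \<Longrightarrow> Lrel (y @ q) q \<Longrightarrow>
    conn (A @ [p @ y, q] @ B) (A @ [p, y @ q] @ B)"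
proof (induction y arbitrary: p)
  case (Cons e y)
  have e: "e \<in> carrier E" "y \<in> wds" using Cons.prems by auto
  have 1: "Rrel (p @ [e]) p" using Rrel_prefix[of p "[e]" y] Cons.prems e by simp
  have 3: "Rrel ((p @ [e]) @ y) (p @ [e])" using Rrel_trans[OF Cons.prems(2) Rrel_sym[OF 1]] by simp
  have 2: "Lrel (y @ q) q" using Lrel_suffix[of "[e]" y q] Cons.prems e by simp
  have "conn (A @ [(p @ [e]) @ y, q] @ B) (A @ [p @ [e], y @ q] @ B)"
    by (rule Cons.IH[OF e(2) 3 2])
  moreover have "Lrel ([e] @ y @ q) (y @ q)" using Lrel_trans[OF Cons.prems(3) Lrel_sym[OF 2]] by simp
  then have "transfer (A @ [p @ [e], y @ q] @ B) (A @ [p, [e] @ y @ q] @ B)"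
    by (rule transfer.push[OF e(1) 1])
  ultimately show ?case by (simp add: rtranclp.rtrancl_into_rtrancl)
qed simp

lemma minfact_wds: "minfact P \<Longrightarrow> p \<in> set P \<Longrightarrow> p \<in> wds \<and> p \<noteq> []"
  unfolding minfact_def using seeded_wds by blast

text \<open>In a letter move the product of the two factors involved is the same word. The product
  with an outer neighbour stays in its \<R>- or \<L>-class, because \<R> is a left congruence and
  \<L> a right one, so it does not become seeded.\<close>

lemma minfact_transfer:
  assumes "transfer P Q" "minfact P" shows "minfact Q"
  using assms
proof (induction rule: transfer.induct)
  case (equal p q A B)
  have s: "seeded q" using equal seeded_eqv unfolding minfact_def by auto
  have W: "\<And>r. r \<in> set (A @ B) \<Longrightarrow> r \<in> wds" using minfact_wds[OF equal(2)] by simp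
  have 1: "seeded (r @ q) = seeded (r @ p)" "seeded (q @ r) = seeded (p @ r)" if "r \<in> set (A @ B)" for r
    using W[OF that] seeded_eqv eqv_left eqv_right equal(1) by blast+
  show ?case using equal(2) s 1
    unfolding minfact_def by (auto simp: successively_append_iff successively_Cons)
next
  case (push e p q A B)
  have s: "seeded p" "seeded ([e] @ q)"
    using push seeded_Rrel seeded_Lrel unfolding minfact_def by auto
  have W: "\<And>r. r \<in> set (A @ B) \<Longrightarrow> r \<in> wds" using minfact_wds[OF push(4)] by simp
  have 1: "seeded (r @ p) = seeded (r @ p @ [e])" "seeded (([e] @ q) @ r) = seeded (q @ r)"
    if "r \<in> set (A @ B)" for r
    using W[OF that] push(2,3) seeded_Rrel[OF Rrel_left] seeded_Lrel[OF Lrel_right] by blast+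
  show ?case using push(4) s 1
    unfolding minfact_def by (auto simp: successively_append_iff successively_Cons)
next
  case (pull e p q A B)
  have s: "seeded (p @ [e])" "seeded q"
    using pull seeded_Rrel seeded_Lrel unfolding minfact_def by auto
  have W: "\<And>r. r \<in> set (A @ B) \<Longrightarrow> r \<in> wds" using minfact_wds[OF pull(4)] by simp
  have 1: "seeded (r @ p) = seeded (r @ p @ [e])" "seeded (([e] @ q) @ r) = seeded (q @ r)"
    if "r \<in> set (A @ B)" for r
    using W[OF that] pull(2,3) seeded_Rrel[OF Rrel_left] seeded_Lrel[OF Lrel_right] by blast+
  show ?case using pull(4) s 1
    unfolding minfact_def by (auto simp: successively_append_iff successively_Cons)
qed

lemma minfact_conn: "conn P Q \<Longrightarrow> minfact P \<Longrightarrow> minfact Q"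
  by (induction rule: rtranclp_induct) (auto intro: minfact_transfer)

lemma minfact_Cons: "minfact (p # P) \<Longrightarrow> minfact P"
  unfolding minfact_def by (auto simp: successively_Cons)

lemma minfact_Cons2: "minfact (p # q # P) \<Longrightarrow> seeded p \<and> seeded q \<and> \<not> seeded (p @ q)"
  unfolding minfact_def by simp

text \<open>If \<open>pqz\<close> were seeded while \<open>pq\<close> is not, then \<open>qz\<close>
  and \<open>z\<close> would be seeded. When \<open>z\<close> swallows the next factor
  \<open>r\<close>, the induction hypothesis refutes \<open>qz\<close>; when \<open>z\<close> ends
  inside \<open>r\<close>, the overlap of \<open>pqz\<close> and \<open>r\<close> makes
  \<open>pqr\<close> seeded, against local minimality.\<close>

lemma minfact_no_overrun:
  "minfact (p # q # P) \<Longrightarrow> concat P = z @ t \<Longrightarrow> \<not> seeded (p @ q @ z)"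
proof (induction P arbitrary: p q z t)
  case Nil
  then show ?case using minfact_Cons2 by simp
next
  case (Cons r P)
  note pq = minfact_Cons2[OF Cons.prems(1)] and qr = minfact_Cons2[OF minfact_Cons[OF Cons.prems(1)]]
  show ?case
  proof
    assume "seeded (p @ q @ z)"
    then have z: "seeded (q @ z)" "seeded z"
      using pq by (auto elim: seeded_append3_cases)
    consider z' where "z = r @ z'" "concat P = z' @ t" | z' where "r = z @ z'" "t = z' @ concat P"
      using Cons.prems(2) by (auto simp: append_eq_append_conv2)
    then show False
    proof cases
      case 1
      then show ?thesis
        using Cons.IH[OF minfact_Cons[OF Cons.prems(1)] 1(2)] z by simp
    next
      case 2
      have "seeded ((p @ q) @ z @ z')"
        using seeded_overlap(1)[of "p @ q" z z'] \<open>seeded (p @ q @ z)\<close> pq qr 2 by auto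
      then have "seeded (p @ q @ r)" using 2 by simp
      then show ?thesis using pq qr by (auto elim: seeded_append3_cases)
    qed
  qed
qed

text \<open>By \<open>minfact_no_overrun\<close> the longer first factor \<open>py\<close> ends
  strictly inside the second factor \<open>yz\<close>. As \<open>pyz\<close> is not seeded,
  \<open>seeded_overlap\<close> permits moving \<open>y\<close> to the left.\<close>

lemma minfact_first_longer:
  assumes P: "minfact (p # P)" and q: "seeded (p @ y)" "y \<noteq> []" and t: "concat P = y @ t"
  obtains z P' where "P = (y @ z) # P'" "t = z @ concat P'" "z \<noteq> []"
    "conn (p # P) ((p @ y) # z # P')"
proof -
  obtain r P' where P': "P = r # P'"
    using t q by (cases P) auto
  have pr: "seeded p" "seeded r" "\<not> seeded (p @ r)"
    using minfact_Cons2 P P' by auto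
  have "\<exists>z. r = y @ z \<and> z \<noteq> [] \<and> t = z @ concat P'"
  proof (rule ccontr)
    assume "\<nexists>z. r = y @ z \<and> z \<noteq> [] \<and> t = z @ concat P'"
    then obtain y' where y': "y = r @ y'" "concat P' = y' @ t"
      using t P' by (auto simp: append_eq_append_conv2)
    then show False
      using minfact_no_overrun[of p r P' y' t] P P' q(1) by simp
  qed
  then obtain z where z: "r = y @ z" "z \<noteq> []" "t = z @ concat P'" by blast
  have y: "y \<in> wds" using seeded_wds[OF q(1)] by simp
  have "conn ([] @ [p @ y, z] @ P') ([] @ [p, y @ z] @ P')"
    by (rule conn_move[OF y]) (use seeded_overlap[of p y z] pr q z in simp_all)
  from conn_sym[OF this] show ?thesis using that z P' by simp
qed

text \<open>The first factors are prefixes of one word. If they differ, the shorter one is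
  lengthened by \<open>minfact_first_longer\<close> until they agree, and the rests are compared by
  induction on the number of factors.\<close>

lemma minfact_conn_unique:
  "minfact P \<Longrightarrow> minfact Q \<Longrightarrow> concat P = concat Q \<Longrightarrow> conn P Q"
proof (induction "length P" arbitrary: P Q)
  case 0
  then have "P = []" "concat Q = []" "[] \<notin> set Q" using minfact_wds[of Q "[]"] by auto
  then have "Q = []" by (cases Q) auto
  then show ?case using \<open>P = []\<close> by simp
next
  case (Suc n)
  obtain p P' where P: "P = p # P'" "n = length P'"
    using Suc.hyps(2) by (cases P) auto
  obtain q Q' where Q: "Q = q # Q'"
  proof (cases Q)
    case Nil
    then have "concat (p # P') = []" using Suc.prems(3) P(1) by simp
    then show ?thesis using minfact_wds[OF Suc.prems(1), of p] P(1) by simp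
  qed
  have s: "seeded p" "seeded q"
    using Suc.prems(1,2) unfolding P(1) Q minfact_def by simp_all
  have s': "minfact P'" "minfact Q'"
    using Suc.prems(1,2) minfact_Cons unfolding P(1) Q by blast+
  have PQ: "p @ concat P' = q @ concat Q'" using Suc.prems P Q by simp
  consider "p = q" "concat P' = concat Q'"
    | y where "y \<noteq> []" "q = p @ y" "concat P' = y @ concat Q'"
    | y where "y \<noteq> []" "p = q @ y" "concat Q' = y @ concat P'"
  proof -
    from PQ obtain us where "p = q @ us \<and> us @ concat P' = concat Q' \<or> p @ us = q \<and> concat P' = us @ concat Q'"
      by (auto simp: append_eq_append_conv2)
    then show thesis using that(1) that(2)[of us] that(3)[of us] by (cases "us = []") auto
  qed
  then show ?case
  proof cases
    case 1
    then show ?thesis using Suc.hyps(1)[OF P(2) s'] P Q conn_Cons by blast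
  next
    case 2
    obtain z R where z: "P' = (y @ z) # R" "concat Q' = z @ concat R"
        "conn (p # P') ((p @ y) # z # R)"
      using minfact_first_longer[of p P' y "concat Q'"] Suc.prems(1) s(2) 2 unfolding P(1) by blast
    have "minfact ((p @ y) # z # R)" using minfact_conn z Suc.prems P by blast
    then have "conn (z # R) Q'"
      using Suc.hyps(1)[of "z # R" Q'] P(2) z(1,2) s'(2) minfact_Cons[of "p @ y" "z # R"] by simp
    then show ?thesis using conn_Cons[of "z # R" Q' q] rtranclp_trans[OF z(3)] P(1) Q 2(2) by simp
  next
    case 3
    obtain z R where z: "Q' = (y @ z) # R" "concat P' = z @ concat R"
        "conn (q # Q') ((q @ y) # z # R)"
      using minfact_first_longer[of q Q' y "concat P'"] Suc.prems(2) s(1) 3 unfolding Q by blast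
    have "minfact ((q @ y) # z # R)" using minfact_conn z Suc.prems Q by blast
    then have "conn P' (z # R)"
      using Suc.hyps(1)[of P' "z # R"] P(2) z(1,2) s'(1) minfact_Cons[of "q @ y" "z # R"] by simp
    then have "conn P ((q @ y) # z # R)" using conn_Cons[of P' "z # R" p] P(1) 3(2) by simp
    then show ?thesis using rtranclp_trans[OF _ conn_sym[OF z(3)]] Q by simp
  qed
qed

section \<open>Minimal factorisations under the defining relations\<close>

lemma concat_split_letter:
  "concat P = x @ [g] @ y \<Longrightarrow>
    \<exists>A p q B. P = A @ [p @ [g] @ q] @ B \<and> x = concat A @ p \<and> y = q @ concat B"
proof (induction P arbitrary: x)
  case (Cons r P)
  then have "r @ concat P = x @ [g] @ y" by simp
  then consider q where "r = x @ [g] @ q" "y = q @ concat P"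
    | x' where "x = r @ x'" "concat P = x' @ [g] @ y"
    by (auto simp: append_eq_append_conv2 append_eq_Cons_conv)
  then show ?case
  proof cases
    case 1
    then have "r # P = [] @ [x @ [g] @ q] @ P \<and> x = concat [] @ x \<and> y = q @ concat P" by simp
    then show ?thesis by blast
  next
    case 2
    then obtain A p q B where "P = A @ [p @ [g] @ q] @ B" "x' = concat A @ p" "y = q @ concat B"
      using Cons.IH by blast
    then have "r # P = (r # A) @ [p @ [g] @ q] @ B \<and> x = concat (r # A) @ p \<and> y = q @ concat B"
      using 2 by simp
    then show ?thesis by blast
  qed
qed simp

lemma concat_split_two_letters:
  assumes "concat P = x @ [e, f] @ y" "[] \<notin> set P"
  obtains (within) A p q B where "P = A @ [p @ [e, f] @ q] @ B" "x = concat A @ p" "y = q @ concat B"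
  | (across) A p q B where "P = A @ [p @ [e], [f] @ q] @ B" "x = concat A @ p" "y = q @ concat B"
proof -
  obtain A p r B where P: "P = A @ [p @ [e] @ r] @ B" "x = concat A @ p" "[f] @ y = r @ concat B"
    using concat_split_letter[of P x e "[f] @ y"] assms(1) by auto
  show thesis
  proof (cases r)
    case Nil
    then obtain s B' where "B = s # B'" "s \<noteq> []" using P assms(2) by (cases B) auto
    then show ?thesis using across[of A p "tl s" B'] P Nil by (cases s) auto
  next
    case (Cons h q)
    then show ?thesis using within[of A p q B] P by auto
  qed
qed

text \<open>The relation may straddle the boundary between \<open>pe\<close> and \<open>fq\<close>.
  Then one letter is moved first, so that the relation takes place within a single factor.\<close>

lemma minfact_contract:
  assumes P: "minfact P" "concat P = x @ [e, f] @ y"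
    and ef: "e \<in> carrier E" "f \<in> carrier E" "pmult E e f = Some g"
  shows "\<exists>Q. minfact Q \<and> concat Q = x @ [g] @ y \<and> conn P Q"
proof -
  have efg: "[e, f] \<approx> [g]" using eqv_basic ef by blast
  have inside: "\<exists>Q. minfact Q \<and> concat Q = concat A @ p @ [g] @ q @ concat B \<and> conn P Q"
    if R: "minfact R" "conn P R" "R = A @ [p @ [e, f] @ q] @ B" for A p q B R
  proof -
    have "p \<in> wds" "q \<in> wds" using minfact_wds[OF R(1), of "p @ [e, f] @ q"] R by auto
    then have t: "transfer R (A @ [p @ [g] @ q] @ B)"
      unfolding R(3) using transfer.equal eqv_append[OF efg] by blast
    have "concat (A @ [p @ [g] @ q] @ B) = concat A @ p @ [g] @ q @ concat B" by simp
    then show ?thesis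
      using minfact_transfer[OF t R(1)] rtranclp.rtrancl_into_rtrancl[OF R(2) t] by blast
  qed
  have "[] \<notin> set P" using minfact_wds[OF P(1)] by blast
  with P(2) show ?thesis
  proof (cases rule: concat_split_two_letters)
    case (within A p q B)
    then show ?thesis using inside[OF P(1) _ within(1)] by simp
  next
    case (across A p q B)
    have s: "seeded (p @ [e])" "seeded ([f] @ q)" "\<not> seeded ((p @ [e]) @ [f] @ q)"
      using P(1) across unfolding minfact_def by (auto simp: successively_append_iff)
    have W: "p \<in> wds" "q \<in> wds" using seeded_wds[OF s(1)] seeded_wds[OF s(2)] by auto
    consider "g = e \<or> pmult E f e = Some e" | "g = f \<or> pmult E f e = Some f"
      using pmult_basic ef by blast
    then show ?thesis
    proof cases
      \<comment> \<open>Since \<open>ef \<R> e\<close>, the word \<open>pef\<close> is \<R>-related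
        to \<open>pe\<close> and so seeded. It overlaps \<open>fq\<close> in \<open>f\<close> and
        the two do not merge, so \<open>f\<close> may be pulled.\<close>
      case 1
      have "Rrel ([e] @ [f]) [e]"
        using basic_Rrel[OF ef 1] eqv_imp_Rrel[OF efg] Rrel_trans by fastforce
      then have "Rrel (p @ [e, f]) (p @ [e])" using Rrel_left W by fastforce
      then have "seeded (p @ [e, f])" using s(1) seeded_Rrel by blast
      then have "Rrel ((p @ [e]) @ [f]) (p @ [e])" "Lrel ([f] @ q) q"
        using seeded_overlap[of "p @ [e]" "[f]" q] s by auto
      then have "transfer P (A @ [(p @ [e]) @ [f], q] @ B)"
        unfolding across using transfer.pull ef by blast
      then show ?thesis
        using inside[OF minfact_transfer[OF _ P(1)] r_into_rtranclp, of _ A p "[]" "q # B"] across by simp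
    next
      case 2
      have "Lrel ([e] @ [f]) [f]"
        using basic_Lrel[OF ef 2] eqv_imp_Lrel[OF efg] Lrel_trans by fastforce
      then have "Lrel ([e, f] @ q) ([f] @ q)" using Lrel_right W by fastforce
      then have "seeded ([e, f] @ q)" using s(2) seeded_Lrel by blast
      then have "Rrel (p @ [e]) p" "Lrel ([e] @ [f] @ q) ([f] @ q)"
        using seeded_overlap[of p "[e]" "[f] @ q"] s by auto
      then have "transfer P (A @ [p, [e] @ [f] @ q] @ B)"
        unfolding across using transfer.push ef by blast
      then show ?thesis
        using inside[OF minfact_transfer[OF _ P(1)] r_into_rtranclp, of _ "A @ [p]" "[]" q B] across by simp
    qed
  qed
qed

lemma minfact_expand:
  assumes P: "minfact P" "concat P = x @ [g] @ y"
    and ef: "e \<in> carrier E" "f \<in> carrier E" "pmult E e f = Some g"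
  shows "\<exists>Q. minfact Q \<and> concat Q = x @ [e, f] @ y \<and> conn P Q"
proof -
  obtain A p q B where R: "P = A @ [p @ [g] @ q] @ B" "x = concat A @ p" "y = q @ concat B"
    using concat_split_letter[OF P(2)] by blast
  have "p \<in> wds" "q \<in> wds" using minfact_wds[OF P(1), of "p @ [g] @ q"] R by auto
  then have t: "transfer P (A @ [p @ [e, f] @ q] @ B)"
    unfolding R using transfer.equal eqv_append[OF eqv_sym[OF eqv_basic[OF ef]]] by blast
  have "concat (A @ [p @ [e, f] @ q] @ B) = x @ [e, f] @ y" using R by simp
  then show ?thesis using minfact_transfer[OF t P(1)] r_into_rtranclp[of transfer, OF t] by blast
qed

text \<open>Both directions are carried through the induction because of the rule
  \<open>sym\<close>. The factorisation of the target word is produced here;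
  \<open>minfact_ig_eq\<close> compares it with a given one.\<close>

lemma minfact_ig_eq_aux:
  "ig_eq E w z \<Longrightarrow>
    (\<forall>P. minfact P \<and> concat P = w \<longrightarrow> (\<exists>Q. minfact Q \<and> concat Q = z \<and> conn P Q)) \<and>
    (\<forall>P. minfact P \<and> concat P = z \<longrightarrow> (\<exists>Q. minfact Q \<and> concat Q = w \<and> conn P Q))"
proof (induction rule: ig_eq.induct)
  case (rel e f g x y)
  then show ?case
    using minfact_contract[of _ x e f y g] minfact_expand[of _ x g y e f] by blast
next
  case (refl w)
  then show ?case by blast
next
  case (sym w z)
  then show ?case by blast
next
  case (trans w z t)
  have step: "\<exists>Q. minfact Q \<and> concat Q = c \<and> conn P Q"
    if "\<forall>P. minfact P \<and> concat P = a \<longrightarrow> (\<exists>Q. minfact Q \<and> concat Q = b \<and> conn P Q)"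
      "\<forall>P. minfact P \<and> concat P = b \<longrightarrow> (\<exists>Q. minfact Q \<and> concat Q = c \<and> conn P Q)"
      "minfact P" "concat P = a" for a b c P
    using that rtranclp_trans[of transfer P] by blast
  show ?case
    using step[OF conjunct1[OF trans.IH(1)] conjunct1[OF trans.IH(2)]]
      step[OF conjunct2[OF trans.IH(2)] conjunct2[OF trans.IH(1)]] by simp
qed

lemma minfact_ig_eq:
  assumes "ig_eq E w z" "minfact P" "concat P = w" "minfact Q" "concat Q = z"
  shows "conn P Q"
proof -
  obtain R where "minfact R" "concat R = z" "conn P R"
    using minfact_ig_eq_aux[OF assms(1)] assms(2,3) by blast
  then show ?thesis
    using minfact_conn_unique[of R Q] assms(4,5) rtranclp_trans[of transfer P R Q] by simp
qed

end

section \<open>Green's relations and coordinates\<close>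

text \<open>The alternative \<open>a = b\<close> stands for an adjoined identity: as soon as one of
  the two multipliers is the identity, the elements coincide.\<close>

lemma green_R_iff:
  assumes "is_semigroup S"
  shows "(a, b) \<in> green_R S \<longleftrightarrow> a \<in> carrier S \<and> b \<in> carrier S \<and>
    (a = b \<or> (\<exists>s\<in>carrier S. \<exists>t\<in>carrier S. a \<star>\<^bsub>S\<^esub> s = b \<and> b \<star>\<^bsub>S\<^esub> t = a))"
proof
  assume "(a, b) \<in> green_R S"
  then have c: "a \<in> carrier S" "b \<in> carrier S"
    and eq: "right_principal_ideal S a = right_principal_ideal S b"
    by (auto simp: green_R_def)
  have mem: "x \<in> right_principal_ideal S y \<longleftrightarrow> x = y \<or> (\<exists>s\<in>carrier S. y \<star>\<^bsub>S\<^esub> s = x)" for x y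
    by (auto simp: right_principal_ideal_def)
  have "x \<in> right_principal_ideal S x" for x by (simp add: right_principal_ideal_def)
  then have "a \<in> right_principal_ideal S b" "b \<in> right_principal_ideal S a"
    using eq by blast+
  then have "a = b \<or> (\<exists>t\<in>carrier S. b \<star>\<^bsub>S\<^esub> t = a)" "b = a \<or> (\<exists>s\<in>carrier S. a \<star>\<^bsub>S\<^esub> s = b)"
    unfolding mem by blast+
  then show "a \<in> carrier S \<and> b \<in> carrier S \<and>
    (a = b \<or> (\<exists>s\<in>carrier S. \<exists>t\<in>carrier S. a \<star>\<^bsub>S\<^esub> s = b \<and> b \<star>\<^bsub>S\<^esub> t = a))"
    using c by metis
next
  assume r: "a \<in> carrier S \<and> b \<in> carrier S \<and>
    (a = b \<or> (\<exists>s\<in>carrier S. \<exists>t\<in>carrier S. a \<star>\<^bsub>S\<^esub> s = b \<and> b \<star>\<^bsub>S\<^esub> t = a))"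
  have sub: "right_principal_ideal S y \<subseteq> right_principal_ideal S x"
    if "x \<in> carrier S" "s \<in> carrier S" "x \<star>\<^bsub>S\<^esub> s = y" for x y s
  proof -
    have "y \<star>\<^bsub>S\<^esub> r = x \<star>\<^bsub>S\<^esub> (s \<star>\<^bsub>S\<^esub> r)" "s \<star>\<^bsub>S\<^esub> r \<in> carrier S" if "r \<in> carrier S" for r
      using that \<open>x \<in> carrier S\<close> \<open>s \<in> carrier S\<close> \<open>x \<star>\<^bsub>S\<^esub> s = y\<close> assms
      unfolding is_semigroup_def by auto
    then show ?thesis using that unfolding right_principal_ideal_def by blast
  qed
  from r have "right_principal_ideal S a = right_principal_ideal S b"
    using sub by blast
  then show "(a, b) \<in> green_R S" using r by (auto simp: green_R_def)
qed

lemma green_L_iff: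
  assumes "is_semigroup S"
  shows "(a, b) \<in> green_L S \<longleftrightarrow> a \<in> carrier S \<and> b \<in> carrier S \<and>
    (a = b \<or> (\<exists>s\<in>carrier S. \<exists>t\<in>carrier S. s \<star>\<^bsub>S\<^esub> a = b \<and> t \<star>\<^bsub>S\<^esub> b = a))"
proof
  assume "(a, b) \<in> green_L S"
  then have c: "a \<in> carrier S" "b \<in> carrier S"
    and eq: "left_principal_ideal S a = left_principal_ideal S b"
    by (auto simp: green_L_def)
  have mem: "x \<in> left_principal_ideal S y \<longleftrightarrow> x = y \<or> (\<exists>s\<in>carrier S. s \<star>\<^bsub>S\<^esub> y = x)" for x y
    by (auto simp: left_principal_ideal_def)
  have "x \<in> left_principal_ideal S x" for x by (simp add: left_principal_ideal_def)
  then have "a \<in> left_principal_ideal S b" "b \<in> left_principal_ideal S a"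
    using eq by blast+
  then have "a = b \<or> (\<exists>t\<in>carrier S. t \<star>\<^bsub>S\<^esub> b = a)" "b = a \<or> (\<exists>s\<in>carrier S. s \<star>\<^bsub>S\<^esub> a = b)"
    unfolding mem by blast+
  then show "a \<in> carrier S \<and> b \<in> carrier S \<and>
    (a = b \<or> (\<exists>s\<in>carrier S. \<exists>t\<in>carrier S. s \<star>\<^bsub>S\<^esub> a = b \<and> t \<star>\<^bsub>S\<^esub> b = a))"
    using c by metis
next
  assume r: "a \<in> carrier S \<and> b \<in> carrier S \<and>
    (a = b \<or> (\<exists>s\<in>carrier S. \<exists>t\<in>carrier S. s \<star>\<^bsub>S\<^esub> a = b \<and> t \<star>\<^bsub>S\<^esub> b = a))"
  have sub: "left_principal_ideal S y \<subseteq> left_principal_ideal S x"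
    if "x \<in> carrier S" "s \<in> carrier S" "s \<star>\<^bsub>S\<^esub> x = y" for x y s
  proof -
    have "r \<star>\<^bsub>S\<^esub> y = (r \<star>\<^bsub>S\<^esub> s) \<star>\<^bsub>S\<^esub> x" "r \<star>\<^bsub>S\<^esub> s \<in> carrier S" if "r \<in> carrier S" for r
      using that \<open>x \<in> carrier S\<close> \<open>s \<in> carrier S\<close> \<open>s \<star>\<^bsub>S\<^esub> x = y\<close> assms
      unfolding is_semigroup_def by auto
    then show ?thesis using that unfolding left_principal_ideal_def by blast
  qed
  from r have "left_principal_ideal S a = left_principal_ideal S b"
    using sub by blast
  then show "(a, b) \<in> green_L S" using r by (auto simp: green_L_def)
qed

text \<open>With \<open>b = xa\<close>, \<open>a = yb\<close>, \<open>c = bs\<close> and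
  \<open>b = ct\<close>, the element \<open>as = yc\<close> completes the square; this is the
  commutation of \<L> and \<R>.\<close>

lemma green_LR_swap:
  assumes S: "is_semigroup S" and ab: "(a, b) \<in> green_L S" and bc: "(b, c) \<in> green_R S"
  obtains d where "(a, d) \<in> green_R S" "(d, c) \<in> green_L S"
proof -
  have c: "a \<in> carrier S" "b \<in> carrier S" "c \<in> carrier S"
    using ab bc green_L_iff[OF S] green_R_iff[OF S] by blast+
  show thesis
  proof (cases "a = b \<or> b = c")
    case True
    then show ?thesis
      using that ab bc c green_L_iff[OF S] green_R_iff[OF S] by metis
  next
    case False
    then obtain x y s t where xy: "x \<in> carrier S" "y \<in> carrier S" "x \<star>\<^bsub>S\<^esub> a = b" "y \<star>\<^bsub>S\<^esub> b = a"
      and st: "s \<in> carrier S" "t \<in> carrier S" "b \<star>\<^bsub>S\<^esub> s = c" "c \<star>\<^bsub>S\<^esub> t = b"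
      using ab bc green_L_iff[OF S] green_R_iff[OF S] by metis
    have "y \<star>\<^bsub>S\<^esub> c = a \<star>\<^bsub>S\<^esub> s" "x \<star>\<^bsub>S\<^esub> (a \<star>\<^bsub>S\<^esub> s) = c" "a \<star>\<^bsub>S\<^esub> s \<star>\<^bsub>S\<^esub> t = a" "a \<star>\<^bsub>S\<^esub> s \<in> carrier S"
      using S c xy st unfolding is_semigroup_def by metis+
    then show ?thesis
      using that[of "a \<star>\<^bsub>S\<^esub> s"] c xy st green_L_iff[OF S] green_R_iff[OF S] by metis
  qed
qed

lemma green_L_trans: "(a, b) \<in> green_L S \<Longrightarrow> (b, c) \<in> green_L S \<Longrightarrow> (a, c) \<in> green_L S"
  by (auto simp: green_L_def)

lemma green_R_trans: "(a, b) \<in> green_R S \<Longrightarrow> (b, c) \<in> green_R S \<Longrightarrow> (a, c) \<in> green_R S"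
  by (auto simp: green_R_def)

lemma green_L_sym: "(a, b) \<in> green_L S \<Longrightarrow> (b, a) \<in> green_L S"
  by (auto simp: green_L_def)

lemma green_R_sym: "(a, b) \<in> green_R S \<Longrightarrow> (b, a) \<in> green_R S"
  by (auto simp: green_R_def)

lemma D_class_green_L:
  assumes "(a, b) \<in> green_L S" shows "D_class S a = D_class S b"
  using green_L_trans green_L_sym[OF assms] assms unfolding D_class_def green_D_def by fast

text \<open>\<D> is defined as \<L> followed by \<R>, so \<L>-related elements have the same class
  at once, whereas here the two relations must be exchanged first.\<close>

lemma D_class_green_R:
  assumes S: "is_semigroup S" and ab: "(a, b) \<in> green_R S" shows "D_class S a = D_class S b"
proof -
  have sub: "D_class S x \<subseteq> D_class S y" if yx: "(y, x) \<in> green_R S" for x y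
  proof
    fix z assume "z \<in> D_class S x"
    then obtain w where w: "(x, w) \<in> green_L S" "(w, z) \<in> green_R S"
      unfolding D_class_def green_D_def by blast
    obtain v where v: "(w, v) \<in> green_R S" "(v, y) \<in> green_L S"
      using green_LR_swap[OF S green_L_sym[OF w(1)] green_R_sym[OF yx]] by metis
    show "z \<in> D_class S y"
      using green_L_sym[OF v(2)] green_R_trans[OF green_R_sym[OF v(1)] w(2)]
      unfolding D_class_def green_D_def by blast
  qed
  show ?thesis by (rule equalityI[OF sub[OF green_R_sym[OF ab]] sub[OF ab]])
qed

lemma D_class_self: "a \<in> carrier S \<Longrightarrow> a \<in> D_class S a"
  unfolding D_class_def green_D_def green_L_def green_R_def by auto

lemma D_class_eq:
  assumes "is_semigroup S" "b \<in> D_class S a" shows "D_class S b = D_class S a"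
proof -
  obtain w where w: "(a, w) \<in> green_L S" "(w, b) \<in> green_R S"
    using assms(2) unfolding D_class_def green_D_def by blast
  then show ?thesis using D_class_green_L[OF w(1)] D_class_green_R[OF assms(1) w(2)] by simp
qed

lemma D_class_carrier: "D_class S a \<subseteq> carrier S"
  unfolding D_class_def green_D_def green_L_def green_R_def by auto

lemma (in group) inv_cancel_left:
  "x \<in> carrier G \<Longrightarrow> y \<in> carrier G \<Longrightarrow> x \<otimes> (inv x \<otimes> y) = y"
  "x \<in> carrier G \<Longrightarrow> y \<in> carrier G \<Longrightarrow> inv x \<otimes> (x \<otimes> y) = y"
  by (simp_all add: m_assoc[symmetric])

section \<open>One \<D>-class in coordinates: translations and stability\<close>

locale coordinates =
  fixes S :: "'a sgrp" and D :: "'a set" and R :: "('i, 'g, 'l, 'a) rees_coords"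
  assumes S: "is_semigroup S" and D: "D \<subseteq> carrier S" and identifies: "identifies S D R"
begin

lemma group_grp: "group (grp R)"
  using identifies by (simp add: identifies_def rees_data_def)

sublocale group "grp R" by (rule group_grp)

lemma iso: "sgrp_iso (rees_matrix_semigroup (grp R) (rows R) (cols R) (sandwich R))
              (principal_factor S D) (map_option (triple R))"
  using identifies by (simp add: identifies_def)

lemma triple_bij: "bij_betw (triple R) (rows R \<times> carrier (grp R) \<times> cols R) D"
proof -
  have "bij_betw (map_option (triple R)) (insert None (Some ` (rows R \<times> carrier (grp R) \<times> cols R)))
      (insert None (Some ` D))"
    using iso by (simp add: sgrp_iso_def rees_matrix_semigroup_def principal_factor_def)
  then have inj: "inj_on (map_option (triple R)) (insert None (Some ` (rows R \<times> carrier (grp R) \<times> cols R)))"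
    and im: "map_option (triple R) ` (insert None (Some ` (rows R \<times> carrier (grp R) \<times> cols R))) = insert None (Some ` D)"
    by (auto simp: bij_betw_def)
  have "inj_on (triple R) (rows R \<times> carrier (grp R) \<times> cols R)"
    using inj unfolding inj_on_def by fastforce
  moreover have "Some ` triple R ` (rows R \<times> carrier (grp R) \<times> cols R) = Some ` D"
    using im by (auto simp: image_image)
  ultimately show ?thesis
    by (simp add: bij_betw_def inj_image_eq_iff)
qed

lemma triple_in:
  "i \<in> rows R \<Longrightarrow> a \<in> carrier (grp R) \<Longrightarrow> l \<in> cols R \<Longrightarrow> triple R (i, a, l) \<in> D"
  using triple_bij by (auto simp: bij_betw_def)

lemma triple_surj:
  assumes "x \<in> D"
  obtains i a l where "i \<in> rows R" "a \<in> carrier (grp R)" "l \<in> cols R" "x = triple R (i, a, l)"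
  using assms triple_bij by (auto simp: bij_betw_def)

lemma triple_inject:
  assumes "triple R (i, a, l) = triple R (j, b, \<mu>)"
    "i \<in> rows R" "a \<in> carrier (grp R)" "l \<in> cols R" "j \<in> rows R" "b \<in> carrier (grp R)" "\<mu> \<in> cols R"
  shows "i = j \<and> a = b \<and> l = \<mu>"
  using triple_bij assms unfolding bij_betw_def inj_on_def by blast

text \<open>The isomorphism applied to a product of two non-zero elements: both sides are zero
  exactly when the product in \<open>S\<close> leaves \<open>D\<close>.\<close>

lemma triple_product:
  assumes "i \<in> rows R" "a \<in> carrier (grp R)" "l \<in> cols R" "j \<in> rows R" "b \<in> carrier (grp R)" "\<mu> \<in> cols R"
  shows "map_option (triple R) (case sandwich R l j of Some p \<Rightarrow> Some (i, a \<otimes>\<^bsub>grp R\<^esub> p \<otimes>\<^bsub>grp R\<^esub> b, \<mu>) | None \<Rightarrow> None)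
    = (if triple R (i, a, l) \<star>\<^bsub>S\<^esub> triple R (j, b, \<mu>) \<in> D
       then Some (triple R (i, a, l) \<star>\<^bsub>S\<^esub> triple R (j, b, \<mu>)) else None)"
proof -
  let ?M = "rees_matrix_semigroup (grp R) (rows R) (cols R) (sandwich R)"
  have "Some (i, a, l) \<in> carrier ?M" "Some (j, b, \<mu>) \<in> carrier ?M"
    using assms by (auto simp: rees_matrix_semigroup_def)
  then have "map_option (triple R) (Some (i, a, l) \<star>\<^bsub>?M\<^esub> Some (j, b, \<mu>)) =
      map_option (triple R) (Some (i, a, l)) \<star>\<^bsub>principal_factor S D\<^esub> map_option (triple R) (Some (j, b, \<mu>))"
    using iso unfolding sgrp_iso_def by blast
  then show ?thesis by (simp add: rees_matrix_semigroup_def principal_factor_def)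
qed

lemma sandwich_in: "l \<in> cols R \<Longrightarrow> i \<in> rows R \<Longrightarrow> sandwich R l i = Some p \<Longrightarrow> p \<in> carrier (grp R)"
  using identifies unfolding identifies_def rees_data_def by (metis imageE insertE option.inject option.simps(3))

lemma triple_mult:
  assumes "sandwich R l j = Some p"
    "i \<in> rows R" "a \<in> carrier (grp R)" "l \<in> cols R" "j \<in> rows R" "b \<in> carrier (grp R)" "\<mu> \<in> cols R"
  shows "triple R (i, a, l) \<star>\<^bsub>S\<^esub> triple R (j, b, \<mu>) = triple R (i, a \<otimes>\<^bsub>grp R\<^esub> p \<otimes>\<^bsub>grp R\<^esub> b, \<mu>)"
  using triple_product[OF assms(2-7)] assms(1) by (auto split: if_splits)

lemma triple_mult_in:
  assumes "triple R (i, a, l) \<star>\<^bsub>S\<^esub> triple R (j, b, \<mu>) \<in> D"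
    "i \<in> rows R" "a \<in> carrier (grp R)" "l \<in> cols R" "j \<in> rows R" "b \<in> carrier (grp R)" "\<mu> \<in> cols R"
  obtains c where "c \<in> carrier (grp R)" "triple R (i, a, l) \<star>\<^bsub>S\<^esub> triple R (j, b, \<mu>) = triple R (i, c, \<mu>)"
proof -
  obtain p where "sandwich R l j = Some p"
    using triple_product[OF assms(2-7)] assms(1) by (cases "sandwich R l j") auto
  then show ?thesis using that triple_mult assms(2-7) sandwich_in m_closed by metis
qed

lemma sandwich_col: "l \<in> cols R \<Longrightarrow> \<exists>i\<in>rows R. \<exists>p\<in>carrier (grp R). sandwich R l i = Some p"
  using identifies sandwich_in unfolding identifies_def rees_data_def by fastforce

lemma sandwich_row: "i \<in> rows R \<Longrightarrow> \<exists>l\<in>cols R. \<exists>p\<in>carrier (grp R). sandwich R l i = Some p"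
  using identifies sandwich_in unfolding identifies_def rees_data_def by fastforce

text \<open>The witness is \<open>(k, p^{-1}c, \<mu>)\<close> with \<open>p\<close> a non-zero
  matrix entry at \<open>(l, k)\<close>; one element serves all \<open>i\<close> and
  \<open>a\<close> at once.\<close>

lemma right_translate:
  assumes "l \<in> cols R" "c \<in> carrier (grp R)" "\<mu> \<in> cols R"
  obtains k q where "k \<in> rows R" "q \<in> carrier (grp R)"
    "\<And>i a. i \<in> rows R \<Longrightarrow> a \<in> carrier (grp R) \<Longrightarrow>
       triple R (i, a, l) \<star>\<^bsub>S\<^esub> triple R (k, q, \<mu>) = triple R (i, a \<otimes>\<^bsub>grp R\<^esub> c, \<mu>)"
proof -
  obtain k p where p: "k \<in> rows R" "p \<in> carrier (grp R)" "sandwich R l k = Some p"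
    using sandwich_col[OF assms(1)] by blast
  have "triple R (i, a, l) \<star>\<^bsub>S\<^esub> triple R (k, inv\<^bsub>grp R\<^esub> p \<otimes>\<^bsub>grp R\<^esub> c, \<mu>) = triple R (i, a \<otimes>\<^bsub>grp R\<^esub> c, \<mu>)"
    if "i \<in> rows R" "a \<in> carrier (grp R)" for i a
    using triple_mult[OF p(3) that assms(1) p(1) _ assms(3), of "inv\<^bsub>grp R\<^esub> p \<otimes>\<^bsub>grp R\<^esub> c"] that p assms
    by (simp add: m_assoc inv_cancel_left)
  then show ?thesis using that[of k "inv\<^bsub>grp R\<^esub> p \<otimes>\<^bsub>grp R\<^esub> c"] p assms by simp
qed

lemma left_translate:
  assumes "j \<in> rows R" "c \<in> carrier (grp R)" "i \<in> rows R"
  obtains k q where "k \<in> cols R" "q \<in> carrier (grp R)"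
    "\<And>a l. a \<in> carrier (grp R) \<Longrightarrow> l \<in> cols R \<Longrightarrow>
       triple R (i, q, k) \<star>\<^bsub>S\<^esub> triple R (j, a, l) = triple R (i, c \<otimes>\<^bsub>grp R\<^esub> a, l)"
proof -
  obtain k p where p: "k \<in> cols R" "p \<in> carrier (grp R)" "sandwich R k j = Some p"
    using sandwich_row[OF assms(1)] by blast
  have "triple R (i, c \<otimes>\<^bsub>grp R\<^esub> inv\<^bsub>grp R\<^esub> p, k) \<star>\<^bsub>S\<^esub> triple R (j, a, l) = triple R (i, c \<otimes>\<^bsub>grp R\<^esub> a, l)"
    if "a \<in> carrier (grp R)" "l \<in> cols R" for a l
    using triple_mult[OF p(3) assms(3) _ p(1) assms(1) that, of "c \<otimes>\<^bsub>grp R\<^esub> inv\<^bsub>grp R\<^esub> p"] that p assms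
    by (simp add: m_assoc inv_cancel_left)
  then show ?thesis using that[of k "c \<otimes>\<^bsub>grp R\<^esub> inv\<^bsub>grp R\<^esub> p"] p assms by simp
qed

lemma sg_assoc: "x \<in> carrier S \<Longrightarrow> y \<in> carrier S \<Longrightarrow> z \<in> carrier S \<Longrightarrow>
    x \<star>\<^bsub>S\<^esub> y \<star>\<^bsub>S\<^esub> z = x \<star>\<^bsub>S\<^esub> (y \<star>\<^bsub>S\<^esub> z)"
  using S by (simp add: is_semigroup_def)

lemma triple_carrier:
  "i \<in> rows R \<Longrightarrow> a \<in> carrier (grp R) \<Longrightarrow> l \<in> cols R \<Longrightarrow> triple R (i, a, l) \<in> carrier S"
  using triple_in D by blast

text \<open>Right multiplication by \<open>s\<close> commutes with left translations, and these
  reach every triple in column \<open>l\<close> from \<open>(i, a, l)\<close>. So a single product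
  in \<open>D\<close> determines the action on the whole column: \<open>c = a^{-1}b\<close> where
  \<open>(i, a, l)s = (i, b, \<mu>)\<close>.\<close>

lemma right_act:
  assumes s: "s \<in> carrier S" and "i \<in> rows R" "a \<in> carrier (grp R)" "l \<in> cols R"
    and in_D: "triple R (i, a, l) \<star>\<^bsub>S\<^esub> s \<in> D"
  obtains \<mu> c where "\<mu> \<in> cols R" "c \<in> carrier (grp R)"
    "\<And>j h. j \<in> rows R \<Longrightarrow> h \<in> carrier (grp R) \<Longrightarrow>
      triple R (j, h, l) \<star>\<^bsub>S\<^esub> s = triple R (j, h \<otimes>\<^bsub>grp R\<^esub> c, \<mu>)"
proof -
  obtain i' b \<mu> where b: "i' \<in> rows R" "b \<in> carrier (grp R)" "\<mu> \<in> cols R"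
      "triple R (i, a, l) \<star>\<^bsub>S\<^esub> s = triple R (i', b, \<mu>)"
    using triple_surj in_D by blast
  \<comment> \<open>A left identity for row \<open>i\<close>: it fixes \<open>(i, a, l)\<close>,
    hence also its multiple by \<open>s\<close>, so that this multiple lies in row \<open>i\<close>
    too.\<close>
  obtain k q where k: "k \<in> cols R" "q \<in> carrier (grp R)"
    and unit: "\<And>a l. a \<in> carrier (grp R) \<Longrightarrow> l \<in> cols R \<Longrightarrow>
       triple R (i, q, k) \<star>\<^bsub>S\<^esub> triple R (i, a, l) = triple R (i, \<one>\<^bsub>grp R\<^esub> \<otimes>\<^bsub>grp R\<^esub> a, l)"
    using left_translate[OF assms(2) one_closed assms(2)] by blast
  have "triple R (i, q, k) \<star>\<^bsub>S\<^esub> triple R (i', b, \<mu>) = triple R (i, q, k) \<star>\<^bsub>S\<^esub> triple R (i, a, l) \<star>\<^bsub>S\<^esub> s"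
    using b assms k triple_carrier sg_assoc by simp
  also have "\<dots> = triple R (i', b, \<mu>)" using unit b assms by simp
  finally have u: "triple R (i, q, k) \<star>\<^bsub>S\<^esub> triple R (i', b, \<mu>) = triple R (i', b, \<mu>)" .
  then obtain b' where "b' \<in> carrier (grp R)" "triple R (i', b, \<mu>) = triple R (i, b', \<mu>)"
    using triple_mult_in[of i q k i' b \<mu>] b k assms triple_in by metis
  then have i': "i' = i" using triple_inject b assms by blast
  have "triple R (j, h, l) \<star>\<^bsub>S\<^esub> s = triple R (j, h \<otimes>\<^bsub>grp R\<^esub> (inv\<^bsub>grp R\<^esub> a \<otimes>\<^bsub>grp R\<^esub> b), \<mu>)"
    if j: "j \<in> rows R" "h \<in> carrier (grp R)" for j h
  proof -
    obtain k q where k: "k \<in> cols R" "q \<in> carrier (grp R)"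
      and move: "\<And>a' l. a' \<in> carrier (grp R) \<Longrightarrow> l \<in> cols R \<Longrightarrow>
        triple R (j, q, k) \<star>\<^bsub>S\<^esub> triple R (i, a', l) =
        triple R (j, h \<otimes>\<^bsub>grp R\<^esub> inv\<^bsub>grp R\<^esub> a \<otimes>\<^bsub>grp R\<^esub> a', l)"
      using left_translate[of i "h \<otimes>\<^bsub>grp R\<^esub> inv\<^bsub>grp R\<^esub> a" j] assms j by auto
    have "triple R (j, h, l) = triple R (j, q, k) \<star>\<^bsub>S\<^esub> triple R (i, a, l)"
      using move[OF assms(3,4)] assms j by (simp add: m_assoc inv_cancel_left)
    then have "triple R (j, h, l) \<star>\<^bsub>S\<^esub> s = triple R (j, q, k) \<star>\<^bsub>S\<^esub> (triple R (i, a, l) \<star>\<^bsub>S\<^esub> s)"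
      using sg_assoc triple_carrier j k assms by simp
    then show ?thesis using move[OF b(2,3)] b i' assms j by (simp add: m_assoc inv_cancel_left)
  qed
  then show ?thesis using that[of \<mu> "inv\<^bsub>grp R\<^esub> a \<otimes>\<^bsub>grp R\<^esub> b"] b assms by simp
qed

lemma left_act:
  assumes s: "s \<in> carrier S" and "i \<in> rows R" "a \<in> carrier (grp R)" "l \<in> cols R"
    and in_D: "s \<star>\<^bsub>S\<^esub> triple R (i, a, l) \<in> D"
  obtains j c where "j \<in> rows R" "c \<in> carrier (grp R)"
    "\<And>h \<mu>. h \<in> carrier (grp R) \<Longrightarrow> \<mu> \<in> cols R \<Longrightarrow>
      s \<star>\<^bsub>S\<^esub> triple R (i, h, \<mu>) = triple R (j, c \<otimes>\<^bsub>grp R\<^esub> h, \<mu>)"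
proof -
  obtain j b l' where b: "j \<in> rows R" "b \<in> carrier (grp R)" "l' \<in> cols R"
      "s \<star>\<^bsub>S\<^esub> triple R (i, a, l) = triple R (j, b, l')"
    using triple_surj in_D by blast
  obtain k q where k: "k \<in> rows R" "q \<in> carrier (grp R)"
    and unit: "\<And>i a. i \<in> rows R \<Longrightarrow> a \<in> carrier (grp R) \<Longrightarrow>
       triple R (i, a, l) \<star>\<^bsub>S\<^esub> triple R (k, q, l) = triple R (i, a \<otimes>\<^bsub>grp R\<^esub> \<one>\<^bsub>grp R\<^esub>, l)"
    using right_translate[OF assms(4) one_closed assms(4)] by blast
  have "triple R (j, b, l') \<star>\<^bsub>S\<^esub> triple R (k, q, l) = s \<star>\<^bsub>S\<^esub> (triple R (i, a, l) \<star>\<^bsub>S\<^esub> triple R (k, q, l))"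
    using b(4)[symmetric] assms k triple_carrier sg_assoc by simp
  also have "\<dots> = triple R (j, b, l')" using unit b assms by simp
  finally have u: "triple R (j, b, l') \<star>\<^bsub>S\<^esub> triple R (k, q, l) = triple R (j, b, l')" .
  then obtain b' where "b' \<in> carrier (grp R)" "triple R (j, b, l') = triple R (j, b', l)"
    using triple_mult_in[of j b l' k q l] b k assms triple_in by metis
  then have l': "l' = l" using triple_inject b assms by blast
  have "s \<star>\<^bsub>S\<^esub> triple R (i, h, \<mu>) = triple R (j, b \<otimes>\<^bsub>grp R\<^esub> inv\<^bsub>grp R\<^esub> a \<otimes>\<^bsub>grp R\<^esub> h, \<mu>)"
    if h: "h \<in> carrier (grp R)" "\<mu> \<in> cols R" for h \<mu>
  proof -
    obtain k q where k: "k \<in> rows R" "q \<in> carrier (grp R)"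
      and move: "\<And>i a'. i \<in> rows R \<Longrightarrow> a' \<in> carrier (grp R) \<Longrightarrow>
        triple R (i, a', l) \<star>\<^bsub>S\<^esub> triple R (k, q, \<mu>) =
        triple R (i, a' \<otimes>\<^bsub>grp R\<^esub> (inv\<^bsub>grp R\<^esub> a \<otimes>\<^bsub>grp R\<^esub> h), \<mu>)"
      using right_translate[of l "inv\<^bsub>grp R\<^esub> a \<otimes>\<^bsub>grp R\<^esub> h" \<mu>] assms h by auto
    have "triple R (i, h, \<mu>) = triple R (i, a, l) \<star>\<^bsub>S\<^esub> triple R (k, q, \<mu>)"
      using move[OF assms(2,3)] assms h by (simp add: m_assoc inv_cancel_left)
    then have "s \<star>\<^bsub>S\<^esub> triple R (i, h, \<mu>) = (s \<star>\<^bsub>S\<^esub> triple R (i, a, l)) \<star>\<^bsub>S\<^esub> triple R (k, q, \<mu>)"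
      using sg_assoc triple_carrier h k assms by simp
    then show ?thesis using move[OF b(1,2)] b l' assms h by (simp add: m_assoc inv_cancel_left)
  qed
  then show ?thesis using that[of j "b \<otimes>\<^bsub>grp R\<^esub> inv\<^bsub>grp R\<^esub> a"] b assms by simp
qed

text \<open>On the column of \<open>x\<close>, multiplication by \<open>s\<close> is right
  multiplication of the group entry by some \<open>c\<close> together with a change of column; the
  translation by \<open>c^{-1}\<close> back to the old column undoes it. This is stability.\<close>

lemma right_stable:
  assumes "x \<in> D" "s \<in> carrier S" "x \<star>\<^bsub>S\<^esub> s \<in> D"
  obtains t where "t \<in> carrier S" "x \<star>\<^bsub>S\<^esub> s \<star>\<^bsub>S\<^esub> t = x"
proof -
  obtain i a l where x: "i \<in> rows R" "a \<in> carrier (grp R)" "l \<in> cols R" "x = triple R (i, a, l)"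
    using triple_surj assms(1) by blast
  obtain \<mu> c where c: "\<mu> \<in> cols R" "c \<in> carrier (grp R)" "x \<star>\<^bsub>S\<^esub> s = triple R (i, a \<otimes>\<^bsub>grp R\<^esub> c, \<mu>)"
    using right_act[OF assms(2) x(1-3)] assms(3) x by metis
  obtain k q where "k \<in> rows R" "q \<in> carrier (grp R)"
     "triple R (i, a \<otimes>\<^bsub>grp R\<^esub> c, \<mu>) \<star>\<^bsub>S\<^esub> triple R (k, q, l) = triple R (i, a \<otimes>\<^bsub>grp R\<^esub> c \<otimes>\<^bsub>grp R\<^esub> inv\<^bsub>grp R\<^esub> c, l)"
    using right_translate[OF c(1) inv_closed[OF c(2)] x(3)] x c m_closed by metis
  then show ?thesis
    using that[of "triple R (k, q, l)"] x c triple_carrier by (simp add: m_assoc inv_cancel_left)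
qed

lemma left_stable:
  assumes "x \<in> D" "s \<in> carrier S" "s \<star>\<^bsub>S\<^esub> x \<in> D"
  obtains t where "t \<in> carrier S" "t \<star>\<^bsub>S\<^esub> (s \<star>\<^bsub>S\<^esub> x) = x"
proof -
  obtain i a l where x: "i \<in> rows R" "a \<in> carrier (grp R)" "l \<in> cols R" "x = triple R (i, a, l)"
    using triple_surj assms(1) by blast
  obtain j c where c: "j \<in> rows R" "c \<in> carrier (grp R)" "s \<star>\<^bsub>S\<^esub> x = triple R (j, c \<otimes>\<^bsub>grp R\<^esub> a, l)"
    using left_act[OF assms(2) x(1-3)] assms(3) x by metis
  obtain k q where "k \<in> cols R" "q \<in> carrier (grp R)"
     "triple R (i, q, k) \<star>\<^bsub>S\<^esub> triple R (j, c \<otimes>\<^bsub>grp R\<^esub> a, l) = triple R (i, inv\<^bsub>grp R\<^esub> c \<otimes>\<^bsub>grp R\<^esub> (c \<otimes>\<^bsub>grp R\<^esub> a), l)"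
    using left_translate[OF c(1) inv_closed[OF c(2)] x(1)] x c m_closed by metis
  then show ?thesis
    using that[of "triple R (i, q, k)"] x c triple_carrier by (simp add: m_assoc inv_cancel_left)
qed

end

section \<open>Regular elements\<close>

context basic_pair_algebra
begin

section \<open>Words as representatives of elements of \<open>IG(E)\<close>\<close>

lemma bar_eq_iff:
  assumes "w \<in> words E" shows "bar E w = bar E z \<longleftrightarrow> ig_eq E w z"
proof
  assume "bar E w = bar E z"
  then have "w \<in> bar E z" using ig_eq.refl[OF assms] by (auto simp: bar_def)
  then show "ig_eq E w z" by (auto simp: bar_def intro: ig_eq.sym)
next
  assume "ig_eq E w z"
  then show "bar E w = bar E z" by (auto simp: bar_def intro: ig_eq.sym ig_eq.trans)
qed

lemma bar_eqv: "w \<approx> z \<Longrightarrow> bar E w = bar E z"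
  using bar_eq_iff ig_eq_words by (auto simp: eqv_def)

lemma IG_carrier: "carrier (IG E) = bar E ` words E"
  by (auto simp: IG_def quotient_def bar_def)

lemma bar_in: "w \<in> words E \<Longrightarrow> bar E w \<in> carrier (IG E)"
  by (simp add: IG_carrier)

lemma words_append: "x \<in> wds \<Longrightarrow> y \<in> words E \<Longrightarrow> x @ y \<in> words E"
    "x \<in> words E \<Longrightarrow> y \<in> wds \<Longrightarrow> x @ y \<in> words E"
  by (auto simp: words_def)

lemma words_wds: "x \<in> words E \<Longrightarrow> x \<in> wds"
  by (simp add: words_def)

lemma bar_mult:
  assumes "x \<in> words E" "y \<in> words E"
  shows "bar E x \<star>\<^bsub>IG E\<^esub> bar E y = bar E (x @ y)"
proof -
  have "bar E (w @ z) = bar E (x @ y)" if w: "w \<in> bar E x" and z: "z \<in> bar E y" for w z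
  proof (rule bar_eqv)
    have wx: "w \<approx> x" using w by (auto simp: eqv_def bar_def intro: ig_eq.sym)
    have zy: "z \<approx> y" using z by (auto simp: eqv_def bar_def intro: ig_eq.sym)
    have "w \<in> wds" using eqv_wds[OF wx] words_wds[OF assms(1)] by blast
    then have "w @ z \<approx> w @ y" by (rule eqv_left[OF zy])
    also have "w @ y \<approx> x @ y" by (rule eqv_right[OF wx words_wds[OF assms(2)]])
    finally show "w @ z \<approx> x @ y" .
  qed
  then have "(\<Union>w\<in>bar E x. \<Union>z\<in>bar E y. bar E (w @ z)) = (\<Union>w\<in>bar E x. \<Union>z\<in>bar E y. bar E (x @ y))"
    by (intro SUP_cong refl) simp_all
  moreover have "x \<in> bar E x" "y \<in> bar E y"
    using assms by (auto simp: bar_def intro: ig_eq.refl)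
  ultimately show ?thesis by (auto simp: IG_def)
qed

lemma IG_semigroup: "is_semigroup (IG E)"
  unfolding is_semigroup_def IG_carrier by (auto simp: bar_mult words_append words_wds)

lemma Rrel_green_R:
  assumes "x \<in> words E" "y \<in> words E" "Rrel x y"
  shows "(bar E x, bar E y) \<in> green_R (IG E)"
proof -
  obtain s t where st: "s \<in> wds" "t \<in> wds" "x @ s \<approx> y" "y @ t \<approx> x"
    using assms(3) unfolding Rrel_def by blast
  show ?thesis
  \<comment> \<open>The empty word represents no element of \<open>IG(E)\<close>; an empty
    multiplier means \<open>x \<approx> y\<close>.\<close>
  proof (cases "s = [] \<or> t = []")
    case True
    then have "bar E x = bar E y" using st bar_eqv by auto
    then show ?thesis using bar_in[OF assms(1)] by (simp add: green_R_def)
  next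
    case False
    then have "s \<in> words E" "t \<in> words E" using st by (auto simp: words_def)
    then have "bar E s \<in> carrier (IG E)" "bar E t \<in> carrier (IG E)"
      "bar E x \<star>\<^bsub>IG E\<^esub> bar E s = bar E y" "bar E y \<star>\<^bsub>IG E\<^esub> bar E t = bar E x"
      using assms st bar_mult bar_eqv bar_in by auto
    then show ?thesis using green_R_iff[OF IG_semigroup] bar_in assms by blast
  qed
qed

lemma Lrel_green_L:
  assumes "x \<in> words E" "y \<in> words E" "Lrel x y"
  shows "(bar E x, bar E y) \<in> green_L (IG E)"
proof -
  obtain s t where st: "s \<in> wds" "t \<in> wds" "s @ x \<approx> y" "t @ y \<approx> x"
    using assms(3) unfolding Lrel_def by blast
  show ?thesis
  proof (cases "s = [] \<or> t = []")
    case True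
    then have "bar E x = bar E y" using st bar_eqv by auto
    then show ?thesis using bar_in[OF assms(1)] by (simp add: green_L_def)
  next
    case False
    then have "s \<in> words E" "t \<in> words E" using st by (auto simp: words_def)
    then have "bar E s \<in> carrier (IG E)" "bar E t \<in> carrier (IG E)"
      "bar E s \<star>\<^bsub>IG E\<^esub> bar E x = bar E y" "bar E t \<star>\<^bsub>IG E\<^esub> bar E y = bar E x"
      using assms st bar_mult bar_eqv bar_in by auto
    then show ?thesis using green_L_iff[OF IG_semigroup] bar_in assms by blast
  qed
qed

abbreviation Dcl :: "'e list \<Rightarrow> 'e list set set" where
  "Dcl w \<equiv> D_class (IG E) (bar E w)"

lemma Dcl_Rrel: "x \<in> words E \<Longrightarrow> y \<in> words E \<Longrightarrow> Rrel x y \<Longrightarrow> Dcl x = Dcl y"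
  by (rule D_class_green_R[OF IG_semigroup Rrel_green_R])

lemma Dcl_Lrel: "x \<in> words E \<Longrightarrow> y \<in> words E \<Longrightarrow> Lrel x y \<Longrightarrow> Dcl x = Dcl y"
  by (rule D_class_green_L[OF Lrel_green_L])

text \<open>A factor is replaced by an equal, \<R>-related or \<L>-related one, so it stays in its
  \<D>-class: the fingerprint is invariant under moves.\<close>

lemma transfer_Dcl:
  assumes "transfer P Q" "minfact P"
  shows "map Dcl P = map Dcl Q"
proof -
  have s: "\<forall>p\<in>set P \<union> set Q. p \<in> words E"
    using assms(2) minfact_transfer[OF assms] seeded_words unfolding minfact_def by blast
  from assms(1) s show ?thesis
  proof cases
    case (equal p q A B)
    then show ?thesis using bar_eqv by simp
  next
    case (push e p q A B)
    then show ?thesis using Dcl_Rrel[OF _ _ push(4)] Dcl_Lrel[OF _ _ push(5)] s by simp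
  next
    case (pull e p q A B)
    then show ?thesis using Dcl_Rrel[OF _ _ pull(4)] Dcl_Lrel[OF _ _ pull(5)] s by simp
  qed
qed

lemma conn_Dcl: "conn P Q \<Longrightarrow> minfact P \<Longrightarrow> map Dcl P = map Dcl Q"
proof (induction rule: rtranclp_induct)
  case (step Q R)
  then show ?case using transfer_Dcl[OF step(2)] minfact_conn[OF step(1)] by simp
qed simp

text \<open>With \<open>tus \<approx> s\<close> and \<open>svr \<approx> s\<close> the inverse is
  \<open>rst\<close>: \<open>(usv)(rst)(usv) = u(svr)s(tus)v \<approx> usssv \<approx>
  usv\<close>.\<close>

lemma seeded_regular:
  assumes "seeded w" shows "regular_element (IG E) (bar E w)"
proof -
  obtain u s v where s: "w = u @ [s] @ v" "w \<in> wds" "Lrel (u @ [s]) [s]" "Rrel ([s] @ v) [s]"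
    using assms unfolding seeded_def by blast
  then have W: "u \<in> wds" "s \<in> carrier E" "v \<in> wds" by auto
  obtain t where t: "t \<in> wds" "t @ u @ [s] \<approx> [s]" using s(3) unfolding Lrel_def by auto
  obtain r where r: "r \<in> wds" "[s] @ v @ r \<approx> [s]" using s(4) unfolding Rrel_def by auto
  have ss: "[s] @ [s] \<approx> [s]" using eqv_basic[OF W(2) W(2) pmult_idem[OF W(2)]] by simp
  have z: "r @ [s] @ t \<in> words E" using r t W by (simp add: words_def)
  have w: "w \<in> words E" using seeded_words assms by blast
  have "w @ (r @ [s] @ t) @ w = u @ ([s] @ v @ r) @ ([s] @ t @ u @ [s] @ v)" using s by simp
  also have "\<dots> \<approx> u @ [s] @ ([s] @ t @ u @ [s] @ v)"
    using eqv_append[OF r(2)] W t by simp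
  also have "\<dots> = (u @ [s] @ [s]) @ (t @ u @ [s]) @ v" by simp
  also have "\<dots> \<approx> (u @ [s] @ [s]) @ [s] @ v"
    using eqv_append[OF t(2), of "u @ [s] @ [s]" v] W by simp
  also have "\<dots> = u @ ([s] @ [s]) @ ([s] @ v)" by simp
  also have "\<dots> \<approx> u @ [s] @ [s] @ v"
    using eqv_append[OF ss, of u "[s] @ v"] W by simp
  also have "\<dots> = u @ ([s] @ [s]) @ v" by simp
  also have "\<dots> \<approx> u @ [s] @ v"
    using eqv_append[OF ss, of u v] W by simp
  finally have "w @ (r @ [s] @ t) @ w \<approx> w" using s(1) by simp
  then have "bar E w \<star>\<^bsub>IG E\<^esub> bar E (r @ [s] @ t) \<star>\<^bsub>IG E\<^esub> bar E w = bar E w"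
    using bar_mult w z words_append(2)[OF w words_wds[OF z]] bar_eqv by simp
  then show ?thesis
    unfolding regular_element_def using bar_in w z by blast
qed

text \<open>The new first factor absorbs its right neighbour as long as the product is seeded; the
  remaining factors stay minimal.\<close>

lemma minfact_exists_Cons:
  "minfact P \<Longrightarrow> seeded p \<Longrightarrow> \<exists>Q. minfact Q \<and> concat Q = p @ concat P"
proof (induction P arbitrary: p)
  case Nil
  then show ?case by (intro exI[of _ "[p]"]) (simp add: minfact_def)
next
  case (Cons q P)
  show ?case
  proof (cases "seeded (p @ q)")
    case True
    then show ?thesis using Cons.IH[OF minfact_Cons[OF Cons.prems(1)] True] by simp
  next
    case False
    then show ?thesis using Cons.prems
      by (intro exI[of _ "p # q # P"]) (simp add: minfact_def)
  qed
qed

lemma minfact_exists: "w \<in> wds \<Longrightarrow> \<exists>P. minfact P \<and> concat P = w"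
proof (induction w)
  case Nil
  then show ?case by (intro exI[of _ "[]"]) (simp add: minfact_def)
next
  case (Cons e w)
  then obtain P where "minfact P" "concat P = w" by auto
  then show ?case using minfact_exists_Cons[of P "[e]"] seeded_letter Cons.prems by auto
qed

end

section \<open>From regular elements to seeds\<close>

locale coordinatized = basic_pair_algebra E
  for E :: "'e palgebra" +
  fixes C :: "'e list set set \<Rightarrow> ('i, 'g, 'l, 'e list set) rees_coords"
  assumes coords: "regular_D_class (IG E) D \<Longrightarrow> identifies (IG E) D (C D)"
begin

lemma coordinates:
  assumes "regular_D_class (IG E) D" shows "coordinates (IG E) D (C D)"
proof
  show "D \<subseteq> carrier (IG E)"
    using assms by (auto simp: regular_D_class_def dest: subsetD[OF D_class_carrier])
qed (rule IG_semigroup, rule coords[OF assms])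

lemma regular_Dcl: "seeded p \<Longrightarrow> regular_D_class (IG E) (Dcl p)"
  unfolding regular_D_class_def using seeded_regular by blast

text \<open>This is stability in the coordinates of \<open>Dcl p\<close>, which are available
  because a seeded word represents a regular element.\<close>

lemma Rrel_of_Dcl:
  assumes "seeded p" "t \<in> wds" "Dcl (p @ t) = Dcl p"
  shows "Rrel (p @ t) p"
proof (cases "t = []")
  case False
  interpret coordinates "IG E" "Dcl p" "C (Dcl p)"
    using coordinates regular_Dcl assms(1) by blast
  have w: "p \<in> words E" "t \<in> words E" "p @ t \<in> words E"
    using False assms seeded_words words_append by (auto simp: words_def)
  have "bar E p \<in> Dcl p" "bar E p \<star>\<^bsub>IG E\<^esub> bar E t \<in> Dcl p"
    using D_class_self[OF bar_in[OF w(1)]] D_class_self[OF bar_in[OF w(3)]] assms(3) bar_mult w by simp_all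
  then obtain y where "y \<in> carrier (IG E)" "bar E p \<star>\<^bsub>IG E\<^esub> bar E t \<star>\<^bsub>IG E\<^esub> y = bar E p"
    using right_stable bar_in w by blast
  then obtain z where z: "z \<in> words E" "bar E (p @ t @ z) = bar E p"
    using bar_mult w unfolding IG_carrier by fastforce
  then have "(p @ t) @ z \<approx> p"
    using bar_eq_iff[of "p @ t @ z" p] words_append w words_wds by (simp add: eqv_def)
  then show ?thesis
    unfolding Rrel_def using words_wds z assms(2) by (intro bexI[of _ z] bexI[of _ t]) auto
qed simp

lemma Lrel_of_Dcl:
  assumes "seeded p" "t \<in> wds" "Dcl (t @ p) = Dcl p"
  shows "Lrel (t @ p) p"
proof (cases "t = []")
  case False
  interpret coordinates "IG E" "Dcl p" "C (Dcl p)"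
    using coordinates regular_Dcl assms(1) by blast
  have w: "p \<in> words E" "t \<in> words E" "t @ p \<in> words E"
    using False assms seeded_words words_append by (auto simp: words_def)
  have "bar E p \<in> Dcl p" "bar E t \<star>\<^bsub>IG E\<^esub> bar E p \<in> Dcl p"
    using D_class_self[OF bar_in[OF w(1)]] D_class_self[OF bar_in[OF w(3)]] assms(3) bar_mult w by simp_all
  then obtain y where "y \<in> carrier (IG E)" "y \<star>\<^bsub>IG E\<^esub> (bar E t \<star>\<^bsub>IG E\<^esub> bar E p) = bar E p"
    using left_stable bar_in w by blast
  then obtain z where z: "z \<in> words E" "bar E (z @ t @ p) = bar E p"
    using bar_mult w unfolding IG_carrier by fastforce
  then have "z @ t @ p \<approx> p"
    using bar_eq_iff[of "z @ t @ p" p] words_append w words_wds by (simp add: eqv_def)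
  then show ?thesis
    unfolding Lrel_def using words_wds z assms(2) by (intro bexI[of _ z] bexI[of _ t]) auto
qed simp

text \<open>If \<open>p\<^sub>1 \<dots> p\<^sub>m\<close> is idempotent, a minimal factorisation of its square has \<open>m\<close> factors as well, so
  it merges \<open>p\<^sub>i \<dots> p\<^sub>m p\<^sub>1 \<dots> p\<^sub>i\<close> for some \<open>i\<close> and leaves the other factors alone. This product lies in
  the \<open>\<D>\<close>-class of \<open>p\<^sub>i\<close>, so by stability \<open>p\<^sub>i\<close> can be merged with a neighbour unless \<open>m = 1\<close>.\<close>

lemma idempotent_seeded:
  assumes w: "w \<in> words E" "w @ w \<approx> w"
  shows "seeded w"
proof -
  obtain P where P: "minfact P" "concat P = w"
    using minfact_exists words_wds w by blast
  define m where "m = length P"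
  have "w \<noteq> []" using w(1) by (simp add: words_def)
  then have "P \<noteq> []" using P(2) by (metis concat.simps(1))
  then have m: "m > 0" by (simp add: m_def)
  have ww: "ig_eq E w (w @ w)"
    using eqv_sym[OF w(2)] w(1) by (auto simp: eqv_def words_def)
  have sP: "\<And>k. k < m \<Longrightarrow> seeded (P ! k)" and nP: "\<And>k. Suc k < m \<Longrightarrow> \<not> seeded (P ! k @ P ! Suc k)"
    using P(1) unfolding minfact_def m_def by (auto simp: successively_conv_nth)
  \<comment> \<open>Pairs \<open>(a, j)\<close>, with factors counted from \<open>0\<close>, such
    that the last \<open>m - a\<close> factors of the first copy of \<open>P\<close> and the first
    \<open>j\<close> of the second merge into one seeded word.\<close>
  define T where "T = (\<lambda>(a, j). a < m \<and> 1 \<le> j \<and> j \<le> m \<and> seeded (concat (drop a P) @ concat (take j P)))"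
  \<comment> \<open>Otherwise \<open>P @ P\<close> would be a minimal factorisation of
    \<open>ww \<approx> w\<close>, but connected factorisations have equal length, and
    \<open>m > 0\<close>.\<close>
  have ex: "T (m - 1, 1)"
  proof (rule ccontr)
    assume "\<not> T (m - 1, 1)"
    moreover have "drop (m - 1) P = [last P]"
      using \<open>P \<noteq> []\<close> unfolding m_def by (induction P rule: rev_induct) auto
    moreover have "take 1 P = [hd P]"
      using \<open>P \<noteq> []\<close> by (cases P) auto
    ultimately have "\<not> seeded (last P @ hd P)" using m by (simp add: T_def)
    then have "minfact (P @ P)" using P(1) unfolding minfact_def by (auto simp: successively_append_iff)
    then have "conn P (P @ P)" using minfact_ig_eq[OF ww P] P(2) by simp
    then show False using conn_length m unfolding m_def by fastforce
  qed
  \<comment> \<open>A longest merged block, of at most \<open>2m\<close> factors. It merges with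
    neither neighbour, so that the factorisation \<open>?R\<close> below is minimal.\<close>
  obtain a j where aj: "T (a, j)" and max: "\<And>b k. T (b, k) \<Longrightarrow> (m - b) + k \<le> (m - a) + j"
    using ex_has_greatest_nat[of T "(m - 1, 1)" "\<lambda>(b, k). (m - b) + k" "m + m"] ex
    by (fastforce simp: T_def)
  define c where "c = concat (drop a P) @ concat (take j P)"
  have a: "a < m" "1 \<le> j" "j \<le> m" "seeded c" using aj by (auto simp: T_def c_def)
  have left: "\<not> seeded (last (take a P) @ c)" if "take a P \<noteq> []"
  proof
    assume s: "seeded (last (take a P) @ c)"
    have a0: "a > 0" using that by (cases a) auto
    have "last (take a P) = P ! (a - 1)" using that a0 a(1) unfolding m_def by (simp add: last_conv_nth min_def)
    moreover have "drop (a - 1) P = P ! (a - 1) # drop a P"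
      using Cons_nth_drop_Suc[of "a - 1" P] a0 a(1) unfolding m_def by simp
    ultimately have "T (a - 1, j)" using s a a0 by (auto simp: T_def c_def)
    then show False using max[of "a - 1" j] a0 a(1) by simp
  qed
  have right: "\<not> seeded (c @ hd (drop j P))" if "drop j P \<noteq> []"
  proof
    assume s: "seeded (c @ hd (drop j P))"
    have j: "j < m" using that unfolding m_def by simp
    have "take (Suc j) P = take j P @ [hd (drop j P)]"
      using j unfolding m_def by (simp add: take_Suc_conv_app_nth hd_drop_conv_nth)
    then have "T (a, Suc j)" using s a j by (auto simp: T_def c_def)
    then show False using max[of a "Suc j"] by simp
  qed
  let ?R = "take a P @ [c] @ drop j P"
  have "minfact ?R"
  proof -
    have "\<forall>p\<in>set ?R. seeded p"
      using P(1) a(4) unfolding minfact_def by (auto dest: in_set_takeD in_set_dropD)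
    moreover have "successively (\<lambda>p q. \<not> seeded (p @ q)) (take a P)" "successively (\<lambda>p q. \<not> seeded (p @ q)) (drop j P)"
      using P(1) append_take_drop_id[of a P] append_take_drop_id[of j P]
      unfolding minfact_def by (metis successively_append_iff)+
    ultimately show ?thesis
      using left right unfolding minfact_def by (auto simp: successively_append_iff successively_Cons)
  qed
  moreover have "concat ?R = w @ w"
    unfolding c_def P(2)[symmetric] by (metis append.assoc append_take_drop_id concat.simps concat_append append_Nil2)
  ultimately have R: "conn P ?R" using minfact_ig_eq[OF ww P] by blast
  \<comment> \<open>The lengths \<open>m\<close> and \<open>a + 1 + (m - j)\<close> agree, so
    \<open>j = a + 1\<close>, and \<open>c\<close> begins and ends with
    \<open>P ! a\<close>.\<close>
  have "length P = length ?R" using conn_length R by blast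
  then have j: "j = Suc a" using a unfolding m_def by simp
  have "map Dcl P ! a = map Dcl ?R ! a" using conn_Dcl[OF R P(1)] by simp
  then have Dc: "Dcl c = Dcl (P ! a)" using a unfolding m_def by (simp add: nth_append)
  have wds: "\<And>k. concat (drop k P) \<in> wds" "\<And>k. concat (take k P) \<in> wds" "\<And>k. k < m \<Longrightarrow> P ! k \<in> wds"
    using minfact_wds[OF P(1)] unfolding m_def by (auto dest!: in_set_takeD in_set_dropD)+
  have d: "concat (drop a P) = P ! a @ concat (drop (Suc a) P)"
    using a(1) unfolding m_def by (simp add: Cons_nth_drop_Suc[symmetric])
  have t: "concat (take j P) = concat (take a P) @ P ! a"
    using a(1) unfolding m_def j by (simp add: take_Suc_conv_app_nth)
  have "m = 1"
  proof (rule ccontr)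
    assume "m \<noteq> 1"
    then consider "Suc a < m" | b where "a = Suc b" using a(1) by (cases a) auto
    then show False
    proof cases
      case 1
      have e: "concat (drop (Suc a) P) = P ! Suc a @ concat (drop (Suc (Suc a)) P)"
        using 1 unfolding m_def by (simp add: Cons_nth_drop_Suc[symmetric])
      have "Rrel (P ! a @ P ! Suc a @ concat (drop (Suc (Suc a)) P) @ concat (take j P)) (P ! a)"
        using Rrel_of_Dcl[OF sP[OF a(1)], of "concat (drop (Suc a) P) @ concat (take j P)"] Dc d wds(1,2) wds(3)[OF 1]
        unfolding c_def e by simp
      then have "Rrel (P ! a @ P ! Suc a) (P ! a)"
        by (rule Rrel_prefix) (use wds 1 in auto)
      then show False using seeded_Rrel sP[OF a(1)] nP[OF 1] by blast
    next
      case 2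
      have e: "concat (take a P) = concat (take b P) @ P ! b"
        using a(1) unfolding m_def 2 by (simp add: take_Suc_conv_app_nth)
      have "Lrel ((concat (drop a P) @ concat (take b P)) @ P ! b @ P ! a) (P ! a)"
        using Lrel_of_Dcl[OF sP[OF a(1)], of "concat (drop a P) @ concat (take a P)"] Dc t wds(1,2) wds(3)[of b] a(1) 2
        unfolding c_def e by simp
      then have "Lrel (P ! b @ P ! a) (P ! a)"
        by (rule Lrel_suffix) (use wds a 2 in auto)
      then show False using seeded_Lrel sP[OF a(1)] nP[of b] a(1) 2 by blast
    qed
  qed
  then have "P = [P ! 0]" unfolding m_def by (cases P) auto
  then have "w = P ! 0" using P(2) by (metis concat.simps append_Nil2)
  then show ?thesis using sP[of 0] m by simp
qed

text \<open>If \<open>wzw \<approx> w\<close> then \<open>wz\<close> is idempotent, hence seeded,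
  and \<open>wz \<R> w\<close>.\<close>

lemma regular_iff_seeded:
  assumes "w \<in> words E"
  shows "regular_element (IG E) (bar E w) \<longleftrightarrow> seeded w"
proof
  assume "regular_element (IG E) (bar E w)"
  then obtain z where z: "z \<in> words E" "bar E w \<star>\<^bsub>IG E\<^esub> bar E z \<star>\<^bsub>IG E\<^esub> bar E w = bar E w"
    unfolding regular_element_def IG_carrier by blast
  then have z: "z \<in> words E" "bar E (w @ z @ w) = bar E w"
    using bar_mult assms words_append(2)[OF assms words_wds[OF z(1)]] by simp_all
  then have wzw: "w @ z @ w \<approx> w"
    using bar_eq_iff[of "w @ z @ w" w] assms words_append words_wds by (simp add: eqv_def)
  have "(w @ z) @ (w @ z) \<approx> w @ z"
    using eqv_right[OF wzw words_wds[OF z(1)]] by simp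
  then have "seeded (w @ z)"
    using idempotent_seeded assms z words_append words_wds by blast
  moreover have "Rrel (w @ z) w"
    unfolding Rrel_def using wzw words_wds z assms by (intro bexI[of _ w] bexI[of _ z]) auto
  ultimately show "seeded w" using seeded_Rrel by blast
qed (rule seeded_regular)

end

section \<open>Contact automata\<close>

lemma group_dual:
  assumes "group G" shows "group (dual_group G)"
proof -
  interpret group G by (rule assms)
  show ?thesis
  proof (rule groupI)
    fix x assume "x \<in> carrier (dual_group G)"
    then show "\<exists>y\<in>carrier (dual_group G). y \<otimes>\<^bsub>dual_group G\<^esub> x = \<one>\<^bsub>dual_group G\<^esub>"
      by (intro bexI[of _ "inv\<^bsub>G\<^esub> x"]) (auto simp: dual_group_def)
  qed (auto simp: dual_group_def m_assoc)
qed

context coordinatized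
begin

lemma group_C: "regular_D_class (IG E) D \<Longrightarrow> group (grp (C D))"
  using coordinates.group_grp[OF coordinates] .

text \<open>This resolves the definite description in \<open>right_action\<close>: a witness comes
  from \<open>right_act\<close>, and evaluation at the group identity shows that it is the only
  one.\<close>

lemma tau_defined:
  assumes D: "regular_D_class (IG E) D" and e: "e \<in> carrier E"
    and t: "i \<in> rows (C D)" "a \<in> carrier (grp (C D))" "l \<in> cols (C D)"
    and in_D: "triple (C D) (i, a, l) \<star>\<^bsub>IG E\<^esub> bar E [e] \<in> D"
  shows "\<exists>\<mu>. tau E C D l e = Some \<mu> \<and> \<mu> \<in> cols (C D) \<and> beta E C D l e \<in> carrier (grp (C D)) \<and>
    (\<forall>j\<in>rows (C D). \<forall>h\<in>carrier (grp (C D)). triple (C D) (j, h, l) \<star>\<^bsub>IG E\<^esub> bar E [e] =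
       triple (C D) (j, h \<otimes>\<^bsub>grp (C D)\<^esub> beta E C D l e, \<mu>))"
proof -
  interpret coordinates "IG E" D "C D" by (rule coordinates[OF D])
  have e': "bar E [e] \<in> carrier (IG E)" using e by (intro bar_in) (simp add: words_def)
  let ?P = "\<lambda>\<mu> \<beta>. \<mu> \<in> cols (C D) \<and> \<beta> \<in> carrier (grp (C D)) \<and>
             (\<forall>i\<in>rows (C D). \<forall>g\<in>carrier (grp (C D)).
                triple (C D) (i, g, l) \<star>\<^bsub>IG E\<^esub> bar E [e] =
                triple (C D) (i, g \<otimes>\<^bsub>grp (C D)\<^esub> \<beta>, \<mu>))"
  obtain \<mu> c where c: "?P \<mu> c"
    using right_act[OF e' t in_D] by metis
  have "(THE (\<mu>, \<beta>). ?P \<mu> \<beta>) = (\<mu>, c)"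
  proof (rule the_equality)
    fix x assume "case x of (\<mu>, \<beta>) \<Rightarrow> ?P \<mu> \<beta>"
    then obtain \<mu>' c' where x: "x = (\<mu>', c')" "?P \<mu>' c'" by (cases x) auto
    have "triple (C D) (i, \<one>\<^bsub>grp (C D)\<^esub> \<otimes>\<^bsub>grp (C D)\<^esub> c', \<mu>') = triple (C D) (i, \<one>\<^bsub>grp (C D)\<^esub> \<otimes>\<^bsub>grp (C D)\<^esub> c, \<mu>)"
      using c x(2) t(1) one_closed by metis
    then show "x = (\<mu>, c)"
      using triple_inject[of i c' \<mu>' i c \<mu>] c x t by simp
  qed (use c in simp)
  then have "right_action E C D l e = Some (\<mu>, c)"
    unfolding right_action_def using t in_D by auto
  then show ?thesis using c by (auto simp: tau_def beta_def)
qed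

lemma tau_props:
  assumes D: "regular_D_class (IG E) D" and e: "e \<in> carrier E" and l: "l \<in> cols (C D)"
    and tau: "tau E C D l e = Some \<mu>"
  shows "\<mu> \<in> cols (C D)" "beta E C D l e \<in> carrier (grp (C D))"
    "j \<in> rows (C D) \<Longrightarrow> h \<in> carrier (grp (C D)) \<Longrightarrow>
      triple (C D) (j, h, l) \<star>\<^bsub>IG E\<^esub> bar E [e] =
      triple (C D) (j, h \<otimes>\<^bsub>grp (C D)\<^esub> beta E C D l e, \<mu>)"
proof -
  have "\<exists>i\<in>rows (C D). \<exists>g\<in>carrier (grp (C D)). triple (C D) (i, g, l) \<star>\<^bsub>IG E\<^esub> bar E [e] \<in> D"
    using tau unfolding tau_def right_action_def by (auto split: if_splits)
  then obtain \<mu>' where "tau E C D l e = Some \<mu>' \<and> \<mu>' \<in> cols (C D) \<and> beta E C D l e \<in> carrier (grp (C D)) \<and>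
    (\<forall>j\<in>rows (C D). \<forall>h\<in>carrier (grp (C D)). triple (C D) (j, h, l) \<star>\<^bsub>IG E\<^esub> bar E [e] =
       triple (C D) (j, h \<otimes>\<^bsub>grp (C D)\<^esub> beta E C D l e, \<mu>'))"
    using tau_defined[OF D e _ _ l] by blast
  then show "\<mu> \<in> cols (C D)" "beta E C D l e \<in> carrier (grp (C D))"
    "j \<in> rows (C D) \<Longrightarrow> h \<in> carrier (grp (C D)) \<Longrightarrow>
      triple (C D) (j, h, l) \<star>\<^bsub>IG E\<^esub> bar E [e] =
      triple (C D) (j, h \<otimes>\<^bsub>grp (C D)\<^esub> beta E C D l e, \<mu>)"
    using tau by simp_all
qed

lemma sigma_defined:
  assumes D: "regular_D_class (IG E) D" and e: "e \<in> carrier E"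
    and t: "i \<in> rows (C D)" "a \<in> carrier (grp (C D))" "l \<in> cols (C D)"
    and in_D: "bar E [e] \<star>\<^bsub>IG E\<^esub> triple (C D) (i, a, l) \<in> D"
  shows "\<exists>j. sigma E C D e i = Some j \<and> j \<in> rows (C D) \<and> alpha E C D e i \<in> carrier (grp (C D)) \<and>
    (\<forall>h\<in>carrier (grp (C D)). \<forall>\<mu>\<in>cols (C D). bar E [e] \<star>\<^bsub>IG E\<^esub> triple (C D) (i, h, \<mu>) =
       triple (C D) (j, alpha E C D e i \<otimes>\<^bsub>grp (C D)\<^esub> h, \<mu>))"
proof -
  interpret coordinates "IG E" D "C D" by (rule coordinates[OF D])
  have e': "bar E [e] \<in> carrier (IG E)" using e by (intro bar_in) (simp add: words_def)
  let ?P = "\<lambda>j \<alpha>. j \<in> rows (C D) \<and> \<alpha> \<in> carrier (grp (C D)) \<and>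
             (\<forall>g\<in>carrier (grp (C D)). \<forall>l\<in>cols (C D).
                bar E [e] \<star>\<^bsub>IG E\<^esub> triple (C D) (i, g, l) =
                triple (C D) (j, \<alpha> \<otimes>\<^bsub>grp (C D)\<^esub> g, l))"
  obtain j c where c: "?P j c"
    using left_act[OF e' t in_D] by metis
  have "(THE (j, \<alpha>). ?P j \<alpha>) = (j, c)"
  proof (rule the_equality)
    fix x assume "case x of (j, \<alpha>) \<Rightarrow> ?P j \<alpha>"
    then obtain j' c' where x: "x = (j', c')" "?P j' c'" by (cases x) auto
    have "triple (C D) (j', c' \<otimes>\<^bsub>grp (C D)\<^esub> \<one>\<^bsub>grp (C D)\<^esub>, l) = triple (C D) (j, c \<otimes>\<^bsub>grp (C D)\<^esub> \<one>\<^bsub>grp (C D)\<^esub>, l)"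
      using c x(2) t(3) one_closed by metis
    then show "x = (j, c)"
      using triple_inject[of j' c' l j c l] c x t by simp
  qed (use c in simp)
  then have "left_action E C D e i = Some (j, c)"
    unfolding left_action_def using t in_D by auto
  then show ?thesis using c by (auto simp: sigma_def alpha_def)
qed

lemma sigma_props:
  assumes D: "regular_D_class (IG E) D" and e: "e \<in> carrier E" and i: "i \<in> rows (C D)"
    and sigma: "sigma E C D e i = Some j"
  shows "j \<in> rows (C D)" "alpha E C D e i \<in> carrier (grp (C D))"
    "h \<in> carrier (grp (C D)) \<Longrightarrow> \<mu> \<in> cols (C D) \<Longrightarrow>
      bar E [e] \<star>\<^bsub>IG E\<^esub> triple (C D) (i, h, \<mu>) =
      triple (C D) (j, alpha E C D e i \<otimes>\<^bsub>grp (C D)\<^esub> h, \<mu>)"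
proof -
  have "\<exists>g\<in>carrier (grp (C D)). \<exists>l\<in>cols (C D). bar E [e] \<star>\<^bsub>IG E\<^esub> triple (C D) (i, g, l) \<in> D"
    using sigma unfolding sigma_def left_action_def by (auto split: if_splits)
  then obtain j' where "sigma E C D e i = Some j' \<and> j' \<in> rows (C D) \<and> alpha E C D e i \<in> carrier (grp (C D)) \<and>
    (\<forall>h\<in>carrier (grp (C D)). \<forall>\<mu>\<in>cols (C D). bar E [e] \<star>\<^bsub>IG E\<^esub> triple (C D) (i, h, \<mu>) =
       triple (C D) (j', alpha E C D e i \<otimes>\<^bsub>grp (C D)\<^esub> h, \<mu>))"
    using sigma_defined[OF D e i] by blast
  then show "j \<in> rows (C D)" "alpha E C D e i \<in> carrier (grp (C D))"
    "h \<in> carrier (grp (C D)) \<Longrightarrow> \<mu> \<in> cols (C D) \<Longrightarrow>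
      bar E [e] \<star>\<^bsub>IG E\<^esub> triple (C D) (i, h, \<mu>) =
      triple (C D) (j, alpha E C D e i \<otimes>\<^bsub>grp (C D)\<^esub> h, \<mu>)"
    using sigma by simp_all
qed

end

locale contact = coordinatized E C
  for E :: "'e palgebra" and C :: "'e list set set \<Rightarrow> ('i, 'g, 'l, 'e list set) rees_coords" +
  fixes D\<^sub>1 D\<^sub>2 :: "'e list set set"
  assumes D1: "regular_D_class (IG E) D\<^sub>1" and D2: "regular_D_class (IG E) D\<^sub>2"
begin

abbreviation "G1 \<equiv> grp (C D\<^sub>1)"
abbreviation "G2 \<equiv> grp (C D\<^sub>2)"
abbreviation "W \<equiv> label_group C D\<^sub>1 D\<^sub>2"
abbreviation "edge \<equiv> contact_edge E C D\<^sub>1 D\<^sub>2"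
abbreviation "walk \<equiv> contact_walk E C D\<^sub>1 D\<^sub>2"
abbreviation "V \<equiv> contact_vertices C D\<^sub>1 D\<^sub>2"

sublocale c1: coordinates "IG E" D\<^sub>1 "C D\<^sub>1" by (rule coordinates[OF D1])
sublocale c2: coordinates "IG E" D\<^sub>2 "C D\<^sub>2" by (rule coordinates[OF D2])

sublocale W: group W
  unfolding label_group_def by (rule DirProd_group[OF c1.is_group group_dual[OF c2.is_group]])

lemma label_carrier: "carrier W = carrier G1 \<times> carrier G2"
  by (simp add: label_group_def dual_group_def)

lemma label_mult: "x \<otimes>\<^bsub>W\<^esub> y = (fst x \<otimes>\<^bsub>G1\<^esub> fst y, snd y \<otimes>\<^bsub>G2\<^esub> snd x)"
  by (cases x; cases y) (simp add: label_group_def dual_group_def)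

lemma label_one: "\<one>\<^bsub>W\<^esub> = (\<one>\<^bsub>G1\<^esub>, \<one>\<^bsub>G2\<^esub>)"
  by (simp add: label_group_def dual_group_def)

lemma label_inv:
  assumes "x \<in> carrier G1" "y \<in> carrier G2" shows "inv\<^bsub>W\<^esub> (x, y) = (inv\<^bsub>G1\<^esub> x, inv\<^bsub>G2\<^esub> y)"
  by (rule W.inv_equality) (use assms in \<open>simp_all add: label_mult label_one label_carrier\<close>)

lemma edge_closed: "edge s e x t \<Longrightarrow> s \<in> V \<and> t \<in> V \<and> x \<in> carrier W"
proof (induction rule: contact_edge.induct)
  case (edge_a l i \<mu> j e)
  then show ?case
    using tau_props(2)[OF D1] sigma_props(2)[OF D2] by (auto simp: label_carrier contact_vertices_def)
next
  case (edge_b l i \<mu> j e)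
  then show ?case
    using tau_props(2)[OF D1] sigma_props(2)[OF D2] by (auto simp: label_carrier contact_vertices_def)
qed

text \<open>Reversal exchanges \<open>edge_a\<close> and \<open>edge_b\<close>, whose labels are
  inverse to each other. So a backward step of a walk can be treated as an edge in the other
  direction.\<close>

lemma edge_reverse: "edge s e x t \<Longrightarrow> edge t e (inv\<^bsub>W\<^esub> x) s"
proof (induction rule: contact_edge.induct)
  case (edge_a l i \<mu> j e)
  have "beta E C D\<^sub>1 \<mu> e \<in> carrier G1" "alpha E C D\<^sub>2 e i \<in> carrier G2"
    using edge_a tau_props(2)[OF D1] sigma_props(2)[OF D2] by (auto simp: contact_vertices_def)
  then show ?case
    using contact_edge.edge_b[of \<mu> j C D\<^sub>1 D\<^sub>2 l i e E] edge_a by (simp add: label_inv)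
next
  case (edge_b l i \<mu> j e)
  have "beta E C D\<^sub>1 l e \<in> carrier G1" "alpha E C D\<^sub>2 e j \<in> carrier G2"
    using edge_b tau_props(2)[OF D1] sigma_props(2)[OF D2] by (auto simp: contact_vertices_def)
  then show ?case
    using contact_edge.edge_a[of \<mu> j C D\<^sub>1 D\<^sub>2 l i e E] edge_b by (simp add: label_inv)
qed

lemma walk_closed: "walk s x t \<Longrightarrow> s \<in> V \<and> t \<in> V \<and> x \<in> carrier W"
  by (induction rule: contact_walk.induct) (auto dest: edge_closed)

lemma walk_trans:
  assumes "walk s x t" "walk t y r" shows "walk s (x \<otimes>\<^bsub>W\<^esub> y) r"
  using assms(2,1)
proof (induction rule: contact_walk.induct)
  case (empty s')
  then show ?case using walk_closed by fastforce
next
  case (forward t y r e z q)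
  then show ?case
    using contact_walk.forward[of E C D\<^sub>1 D\<^sub>2 s "x \<otimes>\<^bsub>W\<^esub> y" r e z q] walk_closed edge_closed
    by (metis W.m_assoc)
next
  case (backward t y r q e z)
  then show ?case
    using contact_walk.backward[of E C D\<^sub>1 D\<^sub>2 s "x \<otimes>\<^bsub>W\<^esub> y" r q e z] walk_closed edge_closed
    by (metis W.m_assoc W.inv_closed)
qed

lemma walk_edge: "edge s e x t \<Longrightarrow> walk s x t"
  using contact_walk.forward[OF contact_walk.empty, of s C D\<^sub>1 D\<^sub>2 E e x t] edge_closed by fastforce

lemma walk_inv: "walk s x t \<Longrightarrow> walk t (inv\<^bsub>W\<^esub> x) s"
proof (induction rule: contact_walk.induct)
  case (empty s)
  then show ?case using contact_walk.empty by fastforce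
next
  case (forward s x t e y r)
  have "walk r (inv\<^bsub>W\<^esub> y \<otimes>\<^bsub>W\<^esub> inv\<^bsub>W\<^esub> x) s"
    by (rule walk_trans[OF walk_edge[OF edge_reverse[OF forward(2)]] forward(3)])
  then show ?case using walk_closed[OF forward(1)] edge_closed[OF forward(2)] by (simp add: W.inv_mult_group)
next
  case (backward s x t r e y)
  have "walk r (y \<otimes>\<^bsub>W\<^esub> inv\<^bsub>W\<^esub> x) s"
    by (rule walk_trans[OF walk_edge[OF backward(2)] backward(3)])
  then show ?case using walk_closed[OF backward(1)] edge_closed[OF backward(2)] by (simp add: W.inv_mult_group)
qed

text \<open>A closed walk followed by the fixed walk leads to \<open>t\<close>, and a walk to
  \<open>t\<close> followed by the reverse of the fixed one is closed. Hence \<open>B_set\<close>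
  does not depend on which walks are fixed by \<open>walk_labels\<close>.\<close>

lemma vertex_group_coset:
  assumes "walk s h t"
  shows "x \<in> vertex_group E C D\<^sub>1 D\<^sub>2 s #>\<^bsub>W\<^esub> h \<longleftrightarrow> walk s x t"
proof
  assume "x \<in> vertex_group E C D\<^sub>1 D\<^sub>2 s #>\<^bsub>W\<^esub> h"
  then obtain y where "walk s y s" "x = y \<otimes>\<^bsub>W\<^esub> h"
    by (auto simp: r_coset_def vertex_group_def)
  then show "walk s x t" using walk_trans[OF _ assms] by simp
next
  assume x: "walk s x t"
  have "walk s (x \<otimes>\<^bsub>W\<^esub> inv\<^bsub>W\<^esub> h) s" using walk_trans[OF x walk_inv[OF assms]] .
  moreover have "x = x \<otimes>\<^bsub>W\<^esub> inv\<^bsub>W\<^esub> h \<otimes>\<^bsub>W\<^esub> h"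
    using walk_closed[OF x] walk_closed[OF assms] by (simp add: W.m_assoc)
  ultimately show "x \<in> vertex_group E C D\<^sub>1 D\<^sub>2 s #>\<^bsub>W\<^esub> h"
    unfolding r_coset_def vertex_group_def by blast
qed

text \<open>Both sides are \<open>(k, a, l) e (i, b, \<nu>)\<close>, bracketed in the two
  ways.\<close>

lemma letter_between:
  assumes e: "e \<in> carrier E" and "(l, i) \<in> V" "tau E C D\<^sub>1 l e = Some \<mu>" "sigma E C D\<^sub>2 e i = Some j"
    and k: "k \<in> rows (C D\<^sub>1)" "a \<in> carrier G1" "b \<in> carrier G2" "\<nu> \<in> cols (C D\<^sub>2)"
  shows "triple (C D\<^sub>1) (k, a \<otimes>\<^bsub>G1\<^esub> beta E C D\<^sub>1 l e, \<mu>) \<star>\<^bsub>IG E\<^esub> triple (C D\<^sub>2) (i, b, \<nu>) =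
    triple (C D\<^sub>1) (k, a, l) \<star>\<^bsub>IG E\<^esub> triple (C D\<^sub>2) (j, alpha E C D\<^sub>2 e i \<otimes>\<^bsub>G2\<^esub> b, \<nu>)"
proof -
  have v: "l \<in> cols (C D\<^sub>1)" "i \<in> rows (C D\<^sub>2)" using assms(2) by (auto simp: contact_vertices_def)
  have e': "bar E [e] \<in> carrier (IG E)" using e by (intro bar_in) (simp add: words_def)
  show ?thesis
    using tau_props(3)[OF D1 e v(1) assms(3) k(1,2)] sigma_props(3)[OF D2 e v(2) assms(4) k(3,4)]
      c1.sg_assoc[OF c1.triple_carrier[OF k(1,2) v(1)] e' c2.triple_carrier[OF v(2) k(3,4)]] by simp
qed

lemma edge_product:
  assumes "edge s e x t"
    and k: "k \<in> rows (C D\<^sub>1)" "a \<in> carrier G1" "b \<in> carrier G2" "\<nu> \<in> cols (C D\<^sub>2)"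
  shows "triple (C D\<^sub>1) (k, a, fst s) \<star>\<^bsub>IG E\<^esub> triple (C D\<^sub>2) (snd s, b, \<nu>) =
    triple (C D\<^sub>1) (k, a \<otimes>\<^bsub>G1\<^esub> fst x, fst t) \<star>\<^bsub>IG E\<^esub> triple (C D\<^sub>2) (snd t, snd x \<otimes>\<^bsub>G2\<^esub> b, \<nu>)"
  using assms(1)
proof cases
  case (edge_a l i \<mu> j)
  have c: "beta E C D\<^sub>1 \<mu> e \<in> carrier G1" "alpha E C D\<^sub>2 e i \<in> carrier G2" "(\<mu>, i) \<in> V"
    using edge_a tau_props(2)[OF D1] sigma_props(2)[OF D2] by (auto simp: contact_vertices_def)
  \<comment> \<open>In case (a) the letter stands at the end of the left triple,
    \<open>(k, a, l) = (k, a\<beta>^{-1}, \<mu>)e\<close>, whence the entry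
    \<open>a\<beta>^{-1}\<close>.\<close>
  show ?thesis
    using letter_between[OF edge_a(6) c(3) edge_a(7,8) k(1) _ k(3,4), of "a \<otimes>\<^bsub>G1\<^esub> inv\<^bsub>G1\<^esub> beta E C D\<^sub>1 \<mu> e"]
      edge_a c k by (simp add: c1.m_assoc)
next
  case (edge_b l i \<mu> j)
  have c: "beta E C D\<^sub>1 l e \<in> carrier G1" "alpha E C D\<^sub>2 e j \<in> carrier G2" "(l, j) \<in> V"
    using edge_b tau_props(2)[OF D1] sigma_props(2)[OF D2] by (auto simp: contact_vertices_def)
  show ?thesis
    using letter_between[OF edge_b(6) c(3) edge_b(7,8) k(1,2) _ k(4), of "inv\<^bsub>G2\<^esub> alpha E C D\<^sub>2 e j \<otimes>\<^bsub>G2\<^esub> b"]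
      edge_b c k by (simp add: c2.inv_cancel_left)
qed

lemma walk_product:
  "walk s x t \<Longrightarrow> k \<in> rows (C D\<^sub>1) \<Longrightarrow> \<nu> \<in> cols (C D\<^sub>2) \<Longrightarrow>
   a \<in> carrier G1 \<Longrightarrow> b \<in> carrier G2 \<Longrightarrow>
   triple (C D\<^sub>1) (k, a, fst s) \<star>\<^bsub>IG E\<^esub> triple (C D\<^sub>2) (snd s, b, \<nu>) =
   triple (C D\<^sub>1) (k, a \<otimes>\<^bsub>G1\<^esub> fst x, fst t) \<star>\<^bsub>IG E\<^esub> triple (C D\<^sub>2) (snd t, snd x \<otimes>\<^bsub>G2\<^esub> b, \<nu>)"
proof (induction rule: contact_walk.induct)
  case (empty s)
  then show ?case by (simp add: label_one)
next
  case (forward s x t e y r)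
  have "fst x \<in> carrier G1" "snd x \<in> carrier G2" "fst y \<in> carrier G1" "snd y \<in> carrier G2"
    using walk_closed[OF forward(1)] edge_closed[OF forward(2)] by (auto simp: label_carrier)
  then show ?case
    using forward edge_product[OF forward(2) forward.prems(1) _ _ forward.prems(2), of "a \<otimes>\<^bsub>G1\<^esub> fst x" "snd x \<otimes>\<^bsub>G2\<^esub> b"]
    by (simp add: label_mult c1.m_assoc c2.m_assoc)
next
  case (backward s x t r e y)
  define z where "z = inv\<^bsub>W\<^esub> y"
  have z: "edge t e z r" unfolding z_def by (rule edge_reverse[OF backward(2)])
  have "fst x \<in> carrier G1" "snd x \<in> carrier G2" "fst z \<in> carrier G1" "snd z \<in> carrier G2"
    using walk_closed[OF backward(1)] edge_closed[OF z] by (auto simp: label_carrier)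
  then show ?case
    using backward edge_product[OF z backward.prems(1) _ _ backward.prems(2), of "a \<otimes>\<^bsub>G1\<^esub> fst x" "snd x \<otimes>\<^bsub>G2\<^esub> b"]
    unfolding z_def[symmetric] by (simp add: label_mult c1.m_assoc c2.m_assoc)
qed

end

section \<open>Equality of products of triples\<close>

text \<open>For \<open>m = 1\<close> the criterion would read \<open>ba^{-1} = a^{-1}b\<close>,
  which says that \<open>a\<close> and \<open>b\<close> commute and not that the triples are equal.
  With \<open>m \<ge> 2\<close> the first and the last triple are distinct factors, each with a
  contact on one side only.\<close>

locale fingerprinted = coordinatized E C
  for E :: "'e palgebra" and C :: "'e list set set \<Rightarrow> ('i, 'g, 'l, 'e list set) rees_coords" +
  fixes m :: nat and D :: "nat \<Rightarrow> 'e list set set"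
  assumes m2: "m \<ge> 2"
    and regular_D: "k \<in> {1..m} \<Longrightarrow> regular_D_class (IG E) (D k)"
begin

abbreviation "R k \<equiv> C (D k)"
abbreviation "G k \<equiv> grp (R k)"

lemma coordinates_D: "k \<in> {1..m} \<Longrightarrow> coordinates (IG E) (D k) (R k)"
  using coordinates regular_D by blast

lemma group_D: "k \<in> {1..m} \<Longrightarrow> group (G k)"
  using group_C regular_D by blast

lemma contact_D: "k \<in> {1..<m} \<Longrightarrow> contact E C (D k) (D (Suc k))"
  by unfold_locales (auto intro: regular_D)

text \<open>The bound \<open>n\<close> is a parameter because \<open>A_seq_iff\<close> builds a
  solution one contact at a time; the contacts covered are \<open>1\<close> to
  \<open>n - 1\<close>.\<close>

definition walks :: "(nat \<Rightarrow> 'i) \<Rightarrow> (nat \<Rightarrow> 'l) \<Rightarrow> (nat \<Rightarrow> 'i) \<Rightarrow> (nat \<Rightarrow> 'l) \<Rightarrow>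
    (nat \<Rightarrow> 'g) \<Rightarrow> (nat \<Rightarrow> 'g) \<Rightarrow> nat \<Rightarrow> bool" where
  "walks i l j \<mu> X Y n \<longleftrightarrow> (\<forall>k\<in>{1..<n}.
     contact_walk E C (D k) (D (Suc k)) (l k, i (Suc k)) (X k, Y k) (\<mu> k, j (Suc k)))"

text \<open>Multiplying the \<open>k\<close>th triple by the second components of the labels at its left contact and
  by the first components of the labels at its right contact; the outer ends have no contact.\<close>

definition linked :: "(nat \<Rightarrow> 'i) \<Rightarrow> (nat \<Rightarrow> 'g) \<Rightarrow> (nat \<Rightarrow> 'l) \<Rightarrow>
    (nat \<Rightarrow> 'i) \<Rightarrow> (nat \<Rightarrow> 'g) \<Rightarrow> (nat \<Rightarrow> 'l) \<Rightarrow> bool" where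
  "linked i a l j b \<mu> \<longleftrightarrow> i 1 = j 1 \<and> l m = \<mu> m \<and>
     (\<exists>X Y. walks i l j \<mu> X Y m \<and> Y 0 = \<one>\<^bsub>G 1\<^esub> \<and> X m = \<one>\<^bsub>G m\<^esub> \<and>
        (\<forall>k\<in>{1..m}. b k = Y (k - 1) \<otimes>\<^bsub>G k\<^esub> a k \<otimes>\<^bsub>G k\<^esub> X k))"

definition coords_in :: "(nat \<Rightarrow> 'i) \<Rightarrow> (nat \<Rightarrow> 'g) \<Rightarrow> (nat \<Rightarrow> 'l) \<Rightarrow> bool" where
  "coords_in i a l \<longleftrightarrow> (\<forall>k\<in>{1..m}. i k \<in> rows (R k) \<and> a k \<in> carrier (G k) \<and> l k \<in> cols (R k))"

definition has_coords :: "'e list list \<Rightarrow> (nat \<Rightarrow> 'i) \<Rightarrow> (nat \<Rightarrow> 'g) \<Rightarrow> (nat \<Rightarrow> 'l) \<Rightarrow> bool" where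
  "has_coords P i a l \<longleftrightarrow> length P = m \<and> coords_in i a l \<and>
     (\<forall>k\<in>{1..m}. bar E (P ! (k - 1)) = triple (R k) (i k, a k, l k))"

lemma linked_refl:
  assumes "coords_in i a l" shows "linked i a l i a l"
proof -
  have "contact_walk E C (D k) (D (Suc k)) (l k, i (Suc k)) (\<one>\<^bsub>G k\<^esub>, \<one>\<^bsub>G (Suc k)\<^esub>) (l k, i (Suc k))"
    if k: "k \<in> {1..<m}" for k
  proof -
    interpret contact E C "D k" "D (Suc k)" by (rule contact_D[OF k])
    show ?thesis
      using contact_walk.empty[of "(l k, i (Suc k))" C "D k" "D (Suc k)" E] assms k
      by (simp add: label_one contact_vertices_def coords_in_def)
  qed
  moreover have "a k = \<one>\<^bsub>G k\<^esub> \<otimes>\<^bsub>G k\<^esub> a k \<otimes>\<^bsub>G k\<^esub> \<one>\<^bsub>G k\<^esub>" if k: "k \<in> {1..m}" for k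
  proof -
    interpret group "G k" by (rule group_D[OF k])
    show ?thesis using assms k by (simp add: coords_in_def)
  qed
  ultimately show ?thesis
    unfolding linked_def walks_def
    by (intro conjI exI[of _ "\<lambda>k. \<one>\<^bsub>G k\<^esub>"] exI[of _ "\<lambda>k. \<one>\<^bsub>G (Suc k)\<^esub>"]) auto
qed

text \<open>The edge is appended to the \<open>k\<close>th walk, which turns \<open>X k\<close> into
  \<open>X k \<otimes> x\<close> and \<open>Y k\<close> into \<open>y \<otimes> Y k\<close>. Only
  the entries at \<open>k\<close> and \<open>Suc k\<close> see this, at their right and left ends
  respectively.\<close>

lemma linked_edge:
  assumes L: "linked i a l j b \<mu>" and ab: "coords_in i a l" "coords_in j b \<mu>" and k: "k \<in> {1..<m}"
    and e: "contact_edge E C (D k) (D (Suc k)) (\<mu> k, j (Suc k)) e (x, y) (\<nu>, h)"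
  shows "linked i a l (j(Suc k := h)) (b(k := b k \<otimes>\<^bsub>G k\<^esub> x, Suc k := y \<otimes>\<^bsub>G (Suc k)\<^esub> b (Suc k)))
    (\<mu>(k := \<nu>))"
proof -
  interpret contact E C "D k" "D (Suc k)" by (rule contact_D[OF k])
  obtain X Y where XY: "walks i l j \<mu> X Y m" "Y 0 = \<one>\<^bsub>G 1\<^esub>" "X m = \<one>\<^bsub>G m\<^esub>"
      "\<And>k. k \<in> {1..m} \<Longrightarrow> b k = Y (k - 1) \<otimes>\<^bsub>G k\<^esub> a k \<otimes>\<^bsub>G k\<^esub> X k"
    and ends: "i 1 = j 1" "l m = \<mu> m"
    using L unfolding linked_def by blast
  have walk_k: "walk (l k, i (Suc k)) (X k, Y k) (\<mu> k, j (Suc k))"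
    using XY(1) k unfolding walks_def by blast
  have xy: "x \<in> carrier G1" "y \<in> carrier G2" "X k \<in> carrier G1" "Y k \<in> carrier G2"
    using edge_closed[OF e] walk_closed[OF walk_k] by (auto simp: label_carrier)
  have ak: "a k \<in> carrier G1" "a (Suc k) \<in> carrier G2"
    using ab(1) k by (auto simp: coords_in_def)
  \<comment> \<open>\<open>X (Suc k)\<close> belongs to the next walk, or is the identity at the
    right end; \<open>Y (k - 1)\<close> is treated symmetrically.\<close>
  have X': "X (Suc k) \<in> carrier G2"
  proof (cases "Suc k = m")
    case False
    then have k': "Suc k \<in> {1..<m}" using k by simp
    interpret right: contact E C "D (Suc k)" "D (Suc (Suc k))" by (rule contact_D[OF k'])
    have "right.walk (l (Suc k), i (Suc (Suc k))) (X (Suc k), Y (Suc k)) (\<mu> (Suc k), j (Suc (Suc k)))"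
      using XY(1) k' unfolding walks_def by blast
    from right.walk_closed[OF this] show ?thesis by (simp add: right.label_carrier)
  next
    case True
    then have "X (Suc k) = \<one>\<^bsub>G2\<^esub>" using XY(3) by simp
    then show ?thesis by simp
  qed
  have Y': "Y (k - 1) \<in> carrier G1"
  proof (cases "k = 1")
    case False
    then have k': "k - 1 \<in> {1..<m}" "Suc (k - 1) = k" using k by auto
    interpret left: contact E C "D (k - 1)" "D k" using contact_D[OF k'(1)] k'(2) by simp
    have "left.walk (l (k - 1), i k) (X (k - 1), Y (k - 1)) (\<mu> (k - 1), j k)"
      using XY(1) k' unfolding walks_def by metis
    from left.walk_closed[OF this] show ?thesis unfolding left.label_carrier by simp
  next
    case True
    then have "Y (k - 1) = \<one>\<^bsub>G1\<^esub>" using XY(2) by simp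
    then show ?thesis by simp
  qed
  let ?X = "X(k := X k \<otimes>\<^bsub>G1\<^esub> x)" and ?Y = "Y(k := y \<otimes>\<^bsub>G2\<^esub> Y k)"
  let ?b = "b(k := b k \<otimes>\<^bsub>G k\<^esub> x, Suc k := y \<otimes>\<^bsub>G (Suc k)\<^esub> b (Suc k))"
  have "walks i l (j(Suc k := h)) (\<mu>(k := \<nu>)) ?X ?Y m"
    using XY(1) walk_trans[OF walk_k walk_edge[OF e]] unfolding walks_def by (auto simp: label_mult)
  moreover have "?b n = ?Y (n - 1) \<otimes>\<^bsub>G n\<^esub> a n \<otimes>\<^bsub>G n\<^esub> ?X n" if n: "n \<in> {1..m}" for n
  proof -
    consider "n = k" | "n = Suc k" | "n \<noteq> k" "n \<noteq> Suc k" by blast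
    then show ?thesis
    proof cases
      case 1
      then have "b k = Y (k - 1) \<otimes>\<^bsub>G k\<^esub> a k \<otimes>\<^bsub>G k\<^esub> X k" "k - 1 \<noteq> k" using XY(4) n by auto
      then show ?thesis using 1 xy ak Y' by (simp add: c1.m_assoc)
    next
      case 2
      then have "b (Suc k) = Y k \<otimes>\<^bsub>G (Suc k)\<^esub> a (Suc k) \<otimes>\<^bsub>G (Suc k)\<^esub> X (Suc k)" using XY(4)[OF n] by simp
      then show ?thesis using 2 xy ak X' by (simp add: c2.m_assoc)
    next
      case 3
      then show ?thesis using XY(4)[OF n] n by auto
    qed
  qed
  ultimately show ?thesis
    unfolding linked_def using XY(2,3) ends k by (intro conjI exI[of _ ?X] exI[of _ ?Y]) auto
qed

lemma linked_cong:
  assumes "linked i a l j b \<mu>" "\<And>k. k \<in> {1..m} \<Longrightarrow> j k = j' k \<and> b k = b' k \<and> \<mu> k = \<mu>' k"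
  shows "linked i a l j' b' \<mu>'"
proof -
  obtain X Y where XY: "walks i l j \<mu> X Y m" "Y 0 = \<one>\<^bsub>G 1\<^esub>" "X m = \<one>\<^bsub>G m\<^esub>"
      "\<And>k. k \<in> {1..m} \<Longrightarrow> b k = Y (k - 1) \<otimes>\<^bsub>G k\<^esub> a k \<otimes>\<^bsub>G k\<^esub> X k"
    and ends: "i 1 = j 1" "l m = \<mu> m"
    using assms(1) unfolding linked_def by blast
  have "walks i l j' \<mu>' X Y m" using XY(1) assms(2) unfolding walks_def by simp
  moreover have "i 1 = j' 1" "l m = \<mu>' m" using ends assms(2) m2 by auto
  moreover have "\<forall>k\<in>{1..m}. b' k = Y (k - 1) \<otimes>\<^bsub>G k\<^esub> a k \<otimes>\<^bsub>G k\<^esub> X k"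
    using XY(4) assms(2) by simp
  ultimately show ?thesis using XY(2,3) unfolding linked_def by blast
qed

section \<open>Coordinates along the moves\<close>

lemma has_coords_unique:
  assumes "has_coords P i a l" "has_coords P j b \<mu>" "k \<in> {1..m}"
  shows "i k = j k \<and> a k = b k \<and> l k = \<mu> k"
proof -
  interpret coordinates "IG E" "D k" "R k" by (rule coordinates_D[OF assms(3)])
  show ?thesis
    using triple_inject[of "i k" "a k" "l k" "j k" "b k" "\<mu> k"] assms
    unfolding has_coords_def coords_in_def by metis
qed

text \<open>A letter passing from the \<open>k\<close>th factor to the next one moves along an edge of the \<open>k\<close>th contact
  automaton; moving it back is the reversed edge.\<close>

lemma push_coords:
  assumes P: "has_coords (A @ [p @ [e], q] @ B) i a l" and k: "k = Suc (length A)"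
    and e: "e \<in> carrier E" and w: "p \<in> words E" "q \<in> words E"
    and D: "Dcl (p @ [e]) = D k" "Dcl p = D k" "Dcl ([e] @ q) = D (Suc k)"
  obtains x y \<nu> h where "contact_edge E C (D k) (D (Suc k)) (l k, i (Suc k)) e (x, y) (\<nu>, h)"
    "has_coords (A @ [p, [e] @ q] @ B) (i(Suc k := h))
      (a(k := a k \<otimes>\<^bsub>G k\<^esub> x, Suc k := y \<otimes>\<^bsub>G (Suc k)\<^esub> a (Suc k))) (l(k := \<nu>))"
proof -
  have km: "k \<in> {1..<m}" using P k unfolding has_coords_def by auto
  interpret contact E C "D k" "D (Suc k)" by (rule contact_D[OF km])
  have ew: "[e] \<in> words E" using e by (simp add: words_def)
  have ik: "i k \<in> rows (R k)" "a k \<in> carrier G1" "l k \<in> cols (R k)"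
    and iSk: "i (Suc k) \<in> rows (R (Suc k))" "a (Suc k) \<in> carrier G2" "l (Suc k) \<in> cols (R (Suc k))"
    using P km unfolding has_coords_def coords_in_def by auto
  have barP: "bar E ((A @ [p @ [e], q] @ B) ! (n - 1)) = triple (R n) (i n, a n, l n)" if "n \<in> {1..m}" for n
    using P that unfolding has_coords_def by blast
  have t1: "bar E (p @ [e]) = triple (R k) (i k, a k, l k)"
    using barP[of k] km k by simp
  have t2: "bar E q = triple (R (Suc k)) (i (Suc k), a (Suc k), l (Suc k))"
    using barP[of "Suc k"] km k by (simp add: nth_append)
  have "bar E p \<in> D k" using D_class_self[OF bar_in[OF w(1)]] D(2) by simp
  then obtain i' a' \<nu> where t3: "i' \<in> rows (R k)" "a' \<in> carrier G1" "\<nu> \<in> cols (R k)" "bar E p = triple (R k) (i', a', \<nu>)"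
    using c1.triple_surj by blast
  have pe: "triple (R k) (i', a', \<nu>) \<star>\<^bsub>IG E\<^esub> bar E [e] = triple (R k) (i k, a k, l k)"
    using bar_mult[OF w(1) ew] t1 t3 by simp
  have "triple (R k) (i', a', \<nu>) \<star>\<^bsub>IG E\<^esub> bar E [e] \<in> D k"
    unfolding pe using c1.triple_in ik by blast
  from tau_defined[OF D1 e t3(1-3) this] obtain \<mu> where tau: "tau E C (D k) \<nu> e = Some \<mu>" "\<mu> \<in> cols (R k)"
      "beta E C (D k) \<nu> e \<in> carrier G1"
      "triple (R k) (i', a', \<nu>) \<star>\<^bsub>IG E\<^esub> bar E [e] = triple (R k) (i', a' \<otimes>\<^bsub>G1\<^esub> beta E C (D k) \<nu> e, \<mu>)"
    using t3 by blast
  have eq1: "i' = i k" "a' \<otimes>\<^bsub>G1\<^esub> beta E C (D k) \<nu> e = a k" "\<mu> = l k"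
    using c1.triple_inject[of i' "a' \<otimes>\<^bsub>G1\<^esub> beta E C (D k) \<nu> e" \<mu> "i k" "a k" "l k"] tau pe t3 ik by auto
  have eq: "bar E [e] \<star>\<^bsub>IG E\<^esub> triple (R (Suc k)) (i (Suc k), a (Suc k), l (Suc k)) = bar E ([e] @ q)"
    using bar_mult[OF ew w(2)] t2 by simp
  have "bar E ([e] @ q) \<in> D (Suc k)"
    using D_class_self[OF bar_in[OF words_append(1)[OF words_wds[OF ew] w(2)]]] D(3) by simp
  then obtain h where h: "sigma E C (D (Suc k)) e (i (Suc k)) = Some h" "h \<in> rows (R (Suc k))"
      "alpha E C (D (Suc k)) e (i (Suc k)) \<in> carrier G2"
      "bar E ([e] @ q) = triple (R (Suc k)) (h, alpha E C (D (Suc k)) e (i (Suc k)) \<otimes>\<^bsub>G2\<^esub> a (Suc k), l (Suc k))"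
    using sigma_defined[OF D2 e iSk] iSk eq by metis
  let ?x = "inv\<^bsub>G1\<^esub> (beta E C (D k) \<nu> e)" and ?y = "alpha E C (D (Suc k)) e (i (Suc k))"
  \<comment> \<open>Type (a): taking \<open>e\<close> away from the end of the left factor leads
    from column \<open>l k\<close> back to a column \<open>\<nu>\<close> that \<open>e\<close> sends
    to \<open>l k\<close>, so the first label is an inverse.\<close>
  have edge: "edge (l k, i (Suc k)) e (?x, ?y) (\<nu>, h)"
    by (rule contact_edge.edge_a) (use ik iSk t3 h tau eq1 e in \<open>auto simp: contact_vertices_def\<close>)
  have a': "a k \<otimes>\<^bsub>G1\<^esub> ?x = a'" unfolding eq1(2)[symmetric] using t3 tau by (simp add: c1.m_assoc)
  let ?a = "a(k := a k \<otimes>\<^bsub>G k\<^esub> ?x, Suc k := ?y \<otimes>\<^bsub>G (Suc k)\<^esub> a (Suc k))"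
  have "has_coords (A @ [p, [e] @ q] @ B) (i(Suc k := h)) ?a (l(k := \<nu>))"
    unfolding has_coords_def
  proof (intro conjI ballI)
    show "length (A @ [p, [e] @ q] @ B) = m" using P unfolding has_coords_def by simp
    show "coords_in (i(Suc k := h)) ?a (l(k := \<nu>))"
      using P t3 tau h ik iSk unfolding has_coords_def coords_in_def by auto
    fix n assume n: "n \<in> {1..m}"
    consider "n = k" | "n = Suc k" | "n \<noteq> k" "n \<noteq> Suc k" by blast
    then show "bar E ((A @ [p, [e] @ q] @ B) ! (n - 1)) =
        triple (R n) ((i(Suc k := h)) n, ?a n, (l(k := \<nu>)) n)"
    proof cases
      case 1
      then show ?thesis using t3(4) eq1 a' k by simp
    next
      case 2
      then show ?thesis using h(4) k by (simp add: nth_append)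
    next
      case 3
      then have "(A @ [p, [e] @ q] @ B) ! (n - 1) = (A @ [p @ [e], q] @ B) ! (n - 1)"
        using k n by (auto simp: nth_append nth_Cons split: nat.splits)
      then show ?thesis using barP[OF n] 3 by simp
    qed
  qed
  with edge show ?thesis using that by blast
qed

lemma pull_coords:
  assumes P: "has_coords (A @ [p, [e] @ q] @ B) i a l" and k: "k = Suc (length A)"
    and e: "e \<in> carrier E" and w: "p \<in> words E" "q \<in> words E"
    and D: "Dcl (p @ [e]) = D k" "Dcl q = D (Suc k)"
  obtains x y \<nu> h where "contact_edge E C (D k) (D (Suc k)) (l k, i (Suc k)) e (x, y) (\<nu>, h)"
    "has_coords (A @ [p @ [e], q] @ B) (i(Suc k := h))
      (a(k := a k \<otimes>\<^bsub>G k\<^esub> x, Suc k := y \<otimes>\<^bsub>G (Suc k)\<^esub> a (Suc k))) (l(k := \<nu>))"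
proof -
  have km: "k \<in> {1..<m}" using P k unfolding has_coords_def by auto
  interpret contact E C "D k" "D (Suc k)" by (rule contact_D[OF km])
  have ew: "[e] \<in> words E" using e by (simp add: words_def)
  have ik: "i k \<in> rows (R k)" "a k \<in> carrier G1" "l k \<in> cols (R k)"
    and iSk: "i (Suc k) \<in> rows (R (Suc k))" "a (Suc k) \<in> carrier G2" "l (Suc k) \<in> cols (R (Suc k))"
    using P km unfolding has_coords_def coords_in_def by auto
  have barP: "bar E ((A @ [p, [e] @ q] @ B) ! (n - 1)) = triple (R n) (i n, a n, l n)" if "n \<in> {1..m}" for n
    using P that unfolding has_coords_def by blast
  have t1: "bar E p = triple (R k) (i k, a k, l k)"
    using barP[of k] km k by simp
  have t2: "bar E ([e] @ q) = triple (R (Suc k)) (i (Suc k), a (Suc k), l (Suc k))"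
    using barP[of "Suc k"] km k by (simp add: nth_append)
  have "bar E q \<in> D (Suc k)" using D_class_self[OF bar_in[OF w(2)]] D(2) by simp
  then obtain h a' l' where t3: "h \<in> rows (R (Suc k))" "a' \<in> carrier G2" "l' \<in> cols (R (Suc k))"
      "bar E q = triple (R (Suc k)) (h, a', l')"
    using c2.triple_surj by blast
  have eq: "bar E [e] \<star>\<^bsub>IG E\<^esub> triple (R (Suc k)) (h, a', l') = triple (R (Suc k)) (i (Suc k), a (Suc k), l (Suc k))"
    using bar_mult[OF ew w(2)] t2 t3 by simp
  have "bar E [e] \<star>\<^bsub>IG E\<^esub> triple (R (Suc k)) (h, a', l') \<in> D (Suc k)"
    unfolding eq using c2.triple_in iSk by blast
  from sigma_defined[OF D2 e t3(1-3) this] obtain j where sigma: "sigma E C (D (Suc k)) e h = Some j" "j \<in> rows (R (Suc k))"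
      "alpha E C (D (Suc k)) e h \<in> carrier G2"
      "bar E [e] \<star>\<^bsub>IG E\<^esub> triple (R (Suc k)) (h, a', l') = triple (R (Suc k)) (j, alpha E C (D (Suc k)) e h \<otimes>\<^bsub>G2\<^esub> a', l')"
    using t3 by blast
  have eq2: "j = i (Suc k)" "alpha E C (D (Suc k)) e h \<otimes>\<^bsub>G2\<^esub> a' = a (Suc k)" "l' = l (Suc k)"
    using c2.triple_inject[of j "alpha E C (D (Suc k)) e h \<otimes>\<^bsub>G2\<^esub> a'" l' "i (Suc k)" "a (Suc k)" "l (Suc k)"]
      sigma eq t3 iSk by auto
  have pe: "triple (R k) (i k, a k, l k) \<star>\<^bsub>IG E\<^esub> bar E [e] = bar E (p @ [e])"
    using bar_mult[OF w(1) ew] t1 by simp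
  have "bar E (p @ [e]) \<in> D k"
    using D_class_self[OF bar_in[OF words_append(2)[OF w(1) words_wds[OF ew]]]] D(1) by simp
  then obtain \<nu> where tau: "tau E C (D k) (l k) e = Some \<nu>" "\<nu> \<in> cols (R k)"
      "beta E C (D k) (l k) e \<in> carrier G1"
      "bar E (p @ [e]) = triple (R k) (i k, a k \<otimes>\<^bsub>G1\<^esub> beta E C (D k) (l k) e, \<nu>)"
    using tau_defined[OF D1 e ik] ik pe by metis
  let ?x = "beta E C (D k) (l k) e" and ?y = "inv\<^bsub>G2\<^esub> (alpha E C (D (Suc k)) e h)"
  \<comment> \<open>Type (b): here \<open>e\<close> is taken away from the front of the right
    factor, so the second label is the inverse.\<close>
  have edge: "edge (l k, i (Suc k)) e (?x, ?y) (\<nu>, h)"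
    by (rule contact_edge.edge_b) (use ik iSk t3 sigma tau eq2 e in \<open>auto simp: contact_vertices_def\<close>)
  have a': "?y \<otimes>\<^bsub>G2\<^esub> a (Suc k) = a'" unfolding eq2(2)[symmetric] using t3 sigma by (simp add: c2.inv_cancel_left)
  let ?a = "a(k := a k \<otimes>\<^bsub>G k\<^esub> ?x, Suc k := ?y \<otimes>\<^bsub>G (Suc k)\<^esub> a (Suc k))"
  have "has_coords (A @ [p @ [e], q] @ B) (i(Suc k := h)) ?a (l(k := \<nu>))"
    unfolding has_coords_def
  proof (intro conjI ballI)
    show "length (A @ [p @ [e], q] @ B) = m" using P unfolding has_coords_def by simp
    show "coords_in (i(Suc k := h)) ?a (l(k := \<nu>))"
      using P t3 tau sigma ik iSk unfolding has_coords_def coords_in_def by auto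
    fix n assume n: "n \<in> {1..m}"
    consider "n = k" | "n = Suc k" | "n \<noteq> k" "n \<noteq> Suc k" by blast
    then show "bar E ((A @ [p @ [e], q] @ B) ! (n - 1)) =
        triple (R n) ((i(Suc k := h)) n, ?a n, (l(k := \<nu>)) n)"
    proof cases
      case 1
      then show ?thesis using tau(4) k by simp
    next
      case 2
      then show ?thesis using t3(4) eq2 a' k by (simp add: nth_append)
    next
      case 3
      then have "(A @ [p @ [e], q] @ B) ! (n - 1) = (A @ [p, [e] @ q] @ B) ! (n - 1)"
        using k n by (auto simp: nth_append nth_Cons split: nat.splits)
      then show ?thesis using barP[OF n] 3 by simp
    qed
  qed
  with edge show ?thesis using that by blast
qed

text \<open>The coordinates of \<open>Q\<close> arise from the move. That both factorisations run
  through the same classes \<open>D k\<close> guarantees that the shifted factors have coordinates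
  there.\<close>

lemma transfer_linked:
  assumes t: "transfer P Q" and P: "minfact P" "map Dcl P = map D [1..<Suc m]"
    and c: "has_coords P j b \<mu>" and L: "linked i a l j b \<mu>" "coords_in i a l"
  shows "\<exists>j b \<mu>. has_coords Q j b \<mu> \<and> linked i a l j b \<mu>"
proof -
  have Q: "minfact Q" "map Dcl Q = map D [1..<Suc m]"
    using minfact_transfer[OF t P(1)] transfer_Dcl[OF t P(1)] P(2) by simp_all
  have wP: "\<And>p. p \<in> set P \<Longrightarrow> p \<in> words E" and wQ: "\<And>p. p \<in> set Q \<Longrightarrow> p \<in> words E"
    using P(1) Q(1) seeded_words unfolding minfact_def by blast+
  have len: "length P = m" "length Q = m"
    using arg_cong[OF P(2), of length] arg_cong[OF Q(2), of length] by simp_all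
  have DP: "Dcl (P ! n) = D (Suc n)" and DQ: "Dcl (Q ! n) = D (Suc n)" if "n < m" for n
    using arg_cong[OF P(2), of "\<lambda>xs. xs ! n"] arg_cong[OF Q(2), of "\<lambda>xs. xs ! n"] that len
    by (simp_all add: nth_map del: upt_Suc)
  have b: "coords_in j b \<mu>" using c unfolding has_coords_def by blast
  from t show ?thesis
  proof cases
    case (equal p q A B)
    have "bar E (P ! n) = bar E (Q ! n)" for n
      using bar_eqv[OF equal(3)] unfolding equal by (simp add: nth_append nth_Cons split: nat.splits)
    then have "has_coords Q j b \<mu>" using c len unfolding has_coords_def by simp
    then show ?thesis using L by blast
  next
    case (push e p q A B)
    define k where "k = Suc (length A)"
    have n: "length A < m" "Suc (length A) < m" using len push by auto
    have D: "Dcl (p @ [e]) = D k" "Dcl p = D k" "Dcl ([e] @ q) = D (Suc k)"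
      using DP[OF n(1)] DQ[OF n(1)] DQ[OF n(2)] unfolding push(1,2) k_def by (simp_all add: nth_append)
    have w: "p \<in> words E" "q \<in> words E" using wP[of q] wQ[of p] push by auto
    obtain x y \<nu> h where "contact_edge E C (D k) (D (Suc k)) (\<mu> k, j (Suc k)) e (x, y) (\<nu>, h)"
      "has_coords Q (j(Suc k := h))
        (b(k := b k \<otimes>\<^bsub>G k\<^esub> x, Suc k := y \<otimes>\<^bsub>G (Suc k)\<^esub> b (Suc k))) (\<mu>(k := \<nu>))"
      using push_coords[OF c[unfolded push(1)] k_def push(3) w D] unfolding push(2) by blast
    moreover have "k \<in> {1..<m}" using n by (simp add: k_def)
    ultimately show ?thesis using linked_edge[OF L(1,2) b] by blast
  next
    case (pull e p q A B)
    define k where "k = Suc (length A)"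
    have n: "length A < m" "Suc (length A) < m" using len pull by auto
    have D: "Dcl (p @ [e]) = D k" "Dcl q = D (Suc k)"
      using DQ[OF n(1)] DQ[OF n(2)] unfolding pull(1,2) k_def by (simp_all add: nth_append)
    have w: "p \<in> words E" "q \<in> words E" using wP[of p] wQ[of q] pull by auto
    obtain x y \<nu> h where "contact_edge E C (D k) (D (Suc k)) (\<mu> k, j (Suc k)) e (x, y) (\<nu>, h)"
      "has_coords Q (j(Suc k := h))
        (b(k := b k \<otimes>\<^bsub>G k\<^esub> x, Suc k := y \<otimes>\<^bsub>G (Suc k)\<^esub> b (Suc k))) (\<mu>(k := \<nu>))"
      using pull_coords[OF c[unfolded pull(1)] k_def pull(3) w D] unfolding pull(2) by blast
    moreover have "k \<in> {1..<m}" using n by (simp add: k_def)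
    ultimately show ?thesis using linked_edge[OF L(1,2) b] by blast
  qed
qed

lemma conn_linked:
  assumes "conn P Q" "minfact P" "map Dcl P = map D [1..<Suc m]"
    and P: "has_coords P i a l" and Q: "has_coords Q j b \<mu>"
  shows "linked i a l j b \<mu>"
proof -
  have c: "coords_in i a l" using P unfolding has_coords_def by blast
  have "\<exists>j b \<mu>. has_coords Q j b \<mu> \<and> linked i a l j b \<mu>"
    using assms(1)
  proof (induction rule: rtranclp_induct)
    case base
    show ?case using P linked_refl[OF c] by blast
  next
    case (step Q R)
    have "minfact Q" "map Dcl Q = map D [1..<Suc m]"
      using minfact_conn[OF step(1) assms(2)] conn_Dcl[OF step(1) assms(2)] assms(3) by simp_all
    then show ?case using transfer_linked[OF step(2)] step(3) c by blast
  qed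
  then obtain j' b' \<mu>' where "has_coords Q j' b' \<mu>'" "linked i a l j' b' \<mu>'" by blast
  \<comment> \<open>The coordinates reached along the moves agree with the given ones on
    \<open>1..m\<close>, since a factor determines its triple.\<close>
  then show ?thesis using linked_cong has_coords_unique[OF _ Q] by blast
qed

section \<open>Linked triples have equal products\<close>

abbreviation "factors p \<equiv> map p [1..<Suc m]"

lemma bar_concat_Suc:
  assumes "\<And>k. k \<in> {1..m} \<Longrightarrow> p k \<in> words E" "k \<in> {1..<m}"
  shows "bar E (concat (map p [1..<Suc (Suc k)])) =
    bar E (concat (map p [1..<Suc k])) \<star>\<^bsub>IG E\<^esub> bar E (p (Suc k))"
    "concat (map p [1..<Suc k]) \<in> words E"
proof -
  show w: "concat (map p [1..<Suc k]) \<in> words E"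
  proof -
    have "set (p n) \<subseteq> carrier E" if "n \<in> {1..m}" for n
      using assms(1)[OF that] by (auto simp: words_def)
    then have "set (concat (map p [1..<Suc k])) \<subseteq> carrier E"
      using assms(2) by (fastforce simp del: upt_Suc)
    moreover have "concat (map p [1..<Suc k]) \<noteq> []"
      using assms(1)[of k] assms(2) by (auto simp: words_def)
    ultimately show ?thesis unfolding words_def lists_eq_set by blast
  qed
  have "concat (map p [1..<Suc (Suc k)]) = concat (map p [1..<Suc k]) @ p (Suc k)"
    by simp
  then show "bar E (concat (map p [1..<Suc (Suc k)])) =
    bar E (concat (map p [1..<Suc k])) \<star>\<^bsub>IG E\<^esub> bar E (p (Suc k))"
    using bar_mult[OF w assms(1)[of "Suc k"]] assms(2) by simp
qed

lemma has_coords_nth: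
  assumes "has_coords (factors p) i a l" "k \<in> {1..m}"
  shows "bar E (p k) = triple (R k) (i k, a k, l k)"
proof -
  have "k - 1 < length [1..<Suc m]" "[1..<Suc m] ! (k - 1) = k"
    using assms(2) nth_upt[of 1 "k - 1" "Suc m"] by auto
  then have "factors p ! (k - 1) = p k" using nth_map[of "k - 1" "[1..<Suc m]" p] by presburger
  then show ?thesis using assms unfolding has_coords_def by metis
qed

lemma linked_product:
  assumes L: "linked i a l j b \<mu>"
    and p: "\<And>k. k \<in> {1..m} \<Longrightarrow> p k \<in> words E" "has_coords (factors p) i a l"
    and q: "\<And>k. k \<in> {1..m} \<Longrightarrow> q k \<in> words E" "has_coords (factors q) j b \<mu>"
  shows "bar E (concat (factors p)) = bar E (concat (factors q))"
proof -
  obtain X Y where XY: "walks i l j \<mu> X Y m" "Y 0 = \<one>\<^bsub>G 1\<^esub>" "X m = \<one>\<^bsub>G m\<^esub>"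
      "\<And>k. k \<in> {1..m} \<Longrightarrow> b k = Y (k - 1) \<otimes>\<^bsub>G k\<^esub> a k \<otimes>\<^bsub>G k\<^esub> X k"
    and ends: "i 1 = j 1" "l m = \<mu> m"
    using L unfolding linked_def by blast
  let ?U = "\<lambda>k. bar E (concat (map p [1..<Suc k]))" and ?V = "\<lambda>k. bar E (concat (map q [1..<Suc k]))"
  have ia: "i k \<in> rows (R k)" "a k \<in> carrier (G k)" "l k \<in> cols (R k)"
    and jb: "j k \<in> rows (R k)" "b k \<in> carrier (G k)" "\<mu> k \<in> cols (R k)" if "k \<in> {1..m}" for k
    using p(2) q(2) that unfolding has_coords_def coords_in_def by auto
  have UV: "?U k \<in> carrier (IG E)" "?V k \<in> carrier (IG E)"
    "?U (Suc k) = ?U k \<star>\<^bsub>IG E\<^esub> triple (R (Suc k)) (i (Suc k), a (Suc k), l (Suc k))"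
    "?V (Suc k) = ?V k \<star>\<^bsub>IG E\<^esub> triple (R (Suc k)) (j (Suc k), b (Suc k), \<mu> (Suc k))"
    if k: "k \<in> {1..<m}" for k
    using bar_in[OF bar_concat_Suc(2)[of p, OF p(1) k]] bar_in[OF bar_concat_Suc(2)[of q, OF q(1) k]]
      bar_concat_Suc(1)[of p, OF p(1) k] bar_concat_Suc(1)[of q, OF q(1) k]
      has_coords_nth[OF p(2), of "Suc k"] has_coords_nth[OF q(2), of "Suc k"] k
    by (simp_all del: upt_Suc)
  \<comment> \<open>The invariant: the prefixes of length \<open>k\<close> differ only by what the
    \<open>k\<close>th walk hands on, the factor \<open>Y k\<close> in front of the next entry.
    Entry and column are arbitrary because the induction step uses
    \<open>a (Suc k) \<otimes> X (Suc k)\<close> and \<open>\<mu> (Suc k)\<close>.\<close>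
  have main: "\<forall>c\<in>carrier (G (Suc k)). \<forall>\<nu>\<in>cols (R (Suc k)).
      ?U k \<star>\<^bsub>IG E\<^esub> triple (R (Suc k)) (i (Suc k), c, \<nu>) =
      ?V k \<star>\<^bsub>IG E\<^esub> triple (R (Suc k)) (j (Suc k), Y k \<otimes>\<^bsub>G (Suc k)\<^esub> c, \<nu>)"
    if "1 \<le> k" "k < m" for k
    using that
  proof (induction k rule: dec_induct)
    case base
    then have k: "1 \<in> {1..<m}" by simp
    interpret contact E C "D 1" "D (Suc 1)" by (rule contact_D[OF k])
    have w: "walk (l 1, i (Suc 1)) (X 1, Y 1) (\<mu> 1, j (Suc 1))"
      using XY(1) k unfolding walks_def by blast
    have k1: "1 \<in> {1..m}" using k by simp
    have "b 1 = a 1 \<otimes>\<^bsub>G1\<^esub> X 1" using XY(4)[OF k1] XY(2) ia[OF k1] by (simp del: One_nat_def)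
    moreover have "?U 1 = triple (R 1) (i 1, a 1, l 1)" "?V 1 = triple (R 1) (j 1, b 1, \<mu> 1)"
      using has_coords_nth[OF p(2) k1] has_coords_nth[OF q(2) k1] by simp_all
    ultimately show ?case
      using walk_product[OF w, of "i 1" _ "a 1"] ia[OF k1] ends by simp
  next
    case (step k)
    then have k: "k \<in> {1..<m}" "Suc k \<in> {1..<m}" "Suc k \<in> {1..m}" by auto
    interpret prev: contact E C "D k" "D (Suc k)" by (rule contact_D[OF k(1)])
    interpret contact E C "D (Suc k)" "D (Suc (Suc k))" by (rule contact_D[OF k(2)])
    have wp: "prev.walk (l k, i (Suc k)) (X k, Y k) (\<mu> k, j (Suc k))"
      and w: "walk (l (Suc k), i (Suc (Suc k))) (X (Suc k), Y (Suc k)) (\<mu> (Suc k), j (Suc (Suc k)))"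
      using XY(1) k unfolding walks_def by blast+
    have c: "X (Suc k) \<in> carrier G1" "Y (Suc k) \<in> carrier G2" "Y k \<in> carrier G1"
      using walk_closed[OF w] prev.walk_closed[OF wp] by (auto simp: label_carrier prev.label_carrier)
    have b: "b (Suc k) = Y k \<otimes>\<^bsub>G1\<^esub> (a (Suc k) \<otimes>\<^bsub>G1\<^esub> X (Suc k))"
      using XY(4)[OF k(3)] c ia[OF k(3)] by (simp add: prev.c2.m_assoc)
    show ?case
    proof (intro ballI)
      fix d \<nu> assume d: "d \<in> carrier G2" "\<nu> \<in> cols (R (Suc (Suc k)))"
      have rows: "i (Suc (Suc k)) \<in> rows (R (Suc (Suc k)))" "j (Suc (Suc k)) \<in> rows (R (Suc (Suc k)))"
        using walk_closed[OF w] by (auto simp: contact_vertices_def)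
      let ?T = "triple (R (Suc (Suc k))) (j (Suc (Suc k)), Y (Suc k) \<otimes>\<^bsub>G2\<^esub> d, \<nu>)"
      have T: "?T \<in> carrier (IG E)"
        using c2.triple_carrier rows c d by simp
      have "?V (Suc k) \<star>\<^bsub>IG E\<^esub> ?T = ?V k \<star>\<^bsub>IG E\<^esub> triple (R (Suc k)) (j (Suc k), b (Suc k), \<mu> (Suc k)) \<star>\<^bsub>IG E\<^esub> ?T"
        using UV(4)[OF k(1)] by simp
      also have "\<dots> = ?U k \<star>\<^bsub>IG E\<^esub> triple (R (Suc k)) (i (Suc k), a (Suc k) \<otimes>\<^bsub>G1\<^esub> X (Suc k), \<mu> (Suc k)) \<star>\<^bsub>IG E\<^esub> ?T"
        using step.IH k c ia[OF k(3)] jb[OF k(3)] unfolding b by simp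
      also have "\<dots> = ?U k \<star>\<^bsub>IG E\<^esub> (triple (R (Suc k)) (i (Suc k), a (Suc k) \<otimes>\<^bsub>G1\<^esub> X (Suc k), \<mu> (Suc k)) \<star>\<^bsub>IG E\<^esub> ?T)"
        using prev.c2.sg_assoc[OF UV(1)[OF k(1)] _ T] prev.c2.triple_carrier ia[OF k(3)] jb[OF k(3)] c by simp
      also have "\<dots> = ?U k \<star>\<^bsub>IG E\<^esub> (triple (R (Suc k)) (i (Suc k), a (Suc k), l (Suc k)) \<star>\<^bsub>IG E\<^esub>
          triple (R (Suc (Suc k))) (i (Suc (Suc k)), d, \<nu>))"
        using walk_product[OF w ia(1)[OF k(3)] d(2) ia(2)[OF k(3)] d(1)] by simp
      also have "\<dots> = ?U (Suc k) \<star>\<^bsub>IG E\<^esub> triple (R (Suc (Suc k))) (i (Suc (Suc k)), d, \<nu>)"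
        using UV(3)[OF k(1)] prev.c2.sg_assoc[OF UV(1)[OF k(1)]] prev.c2.triple_carrier[OF ia[OF k(3)]]
          c2.triple_carrier[OF rows(1) d] by simp
      finally show "?U (Suc k) \<star>\<^bsub>IG E\<^esub> triple (R (Suc (Suc k))) (i (Suc (Suc k)), d, \<nu>) = ?V (Suc k) \<star>\<^bsub>IG E\<^esub> ?T"
        by simp
    qed
  qed
  obtain n where n: "m = Suc n" "n \<in> {1..<m}" using m2 by (cases m) auto
  interpret contact E C "D n" "D (Suc n)" by (rule contact_D[OF n(2)])
  have mm: "m \<in> {1..m}" using m2 by simp
  have w: "walk (l n, i (Suc n)) (X n, Y n) (\<mu> n, j (Suc n))"
    using XY(1) n(2) unfolding walks_def by blast
  \<comment> \<open>At the right end \<open>X m\<close> is the identity, so the invariant at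
    \<open>n = m - 1\<close> applies with \<open>c = a m\<close> itself.\<close>
  have "b (Suc n) = Y n \<otimes>\<^bsub>G2\<^esub> a (Suc n)"
    using XY(3) XY(4)[OF mm] walk_closed[OF w] ia(2)[OF mm] unfolding n(1) by (simp add: label_carrier)
  then have "?U (Suc n) = ?V (Suc n)"
    using UV(3,4)[OF n(2)] main[of n] n ia[OF mm] ends by simp
  then show ?thesis using n(1) by simp
qed

section \<open>The sets \<open>A_k\<close> as projections of solution sets\<close>

lemma B_set_iff:
  assumes g: "walk_labels E C m D i l j \<mu> g" and k: "k \<in> {1..<m}"
  shows "(x, y) \<in> B_set E C D i a l j b \<mu> g k A \<longleftrightarrow>
    contact_walk E C (D k) (D (Suc k)) (l k, i (Suc k)) (x, y) (\<mu> k, j (Suc k)) \<and>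
    (if k = 1 then x \<in> A else \<exists>z\<in>A. x = inv\<^bsub>G k\<^esub> (a k) \<otimes>\<^bsub>G k\<^esub> inv\<^bsub>G k\<^esub> z \<otimes>\<^bsub>G k\<^esub> b k)"
proof -
  interpret contact E C "D k" "D (Suc k)" by (rule contact_D[OF k])
  show ?thesis
  proof (cases "\<exists>x. walk (l k, i (Suc k)) x (\<mu> k, j (Suc k))")
    case True
    then have "walk (l k, i (Suc k)) (g k) (\<mu> k, j (Suc k))"
      using g k unfolding walk_labels_def by auto
    from vertex_group_coset[OF this, of "(x, y)"] walk_closed[of _ "(x, y)"] True
    show ?thesis unfolding B_set_def by (auto simp: label_carrier)
  next
    case False
    then show ?thesis unfolding B_set_def by auto
  qed
qed

text \<open>\<open>A_seq\<close> remembers only the last \<open>Y\<close>. Unfolded, a member of the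
  set with index \<open>Suc n\<close> is the last component of a choice of walks at the contacts
  \<open>1\<close> to \<open>n\<close> in which \<open>X 1\<close> is fixed by the initial singleton
  and each later \<open>X k\<close> is forced by \<open>Y (k - 1)\<close>.\<close>

lemma A_seq_iff:
  assumes g: "walk_labels E C m D i l j \<mu> g" and "1 \<le> n" "n < m"
  shows "y \<in> A_seq E C D i a l j b \<mu> g {c} (Suc n) \<longleftrightarrow>
    (\<exists>X Y. walks i l j \<mu> X Y (Suc n) \<and> X 1 = c \<and> Y n = y \<and>
      (\<forall>k\<in>{2..n}. X k = inv\<^bsub>G k\<^esub> (a k) \<otimes>\<^bsub>G k\<^esub> inv\<^bsub>G k\<^esub> (Y (k - 1)) \<otimes>\<^bsub>G k\<^esub> b k))"
  using assms(2,3)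
proof (induction n arbitrary: y rule: dec_induct)
  case base
  then have k: "1 \<in> {1..<m}" by simp
  have "y \<in> A_seq E C D i a l j b \<mu> g {c} (Suc 1) \<longleftrightarrow> (\<exists>x. (x, y) \<in> B_set E C D i a l j b \<mu> g 1 {c})"
    by (auto simp: image_iff Bex_def)
  also have "\<dots> \<longleftrightarrow> contact_walk E C (D 1) (D (Suc 1)) (l 1, i (Suc 1)) (c, y) (\<mu> 1, j (Suc 1))"
    using B_set_iff[OF g k] by auto
  also have "\<dots> \<longleftrightarrow> (\<exists>X Y. walks i l j \<mu> X Y (Suc 1) \<and> X 1 = c \<and> Y 1 = y)"
    unfolding walks_def by (auto intro: exI[of _ "\<lambda>_. c"] exI[of _ "\<lambda>_. y"])
  finally show ?case by simp
next
  case (step n)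
  then have k: "Suc n \<in> {1..<m}" "Suc n \<noteq> 1" by auto
  let ?A = "A_seq E C D i a l j b \<mu> g {c} (Suc n)"
  let ?walk = "\<lambda>x. contact_walk E C (D (Suc n)) (D (Suc (Suc n))) (l (Suc n), i (Suc (Suc n))) x (\<mu> (Suc n), j (Suc (Suc n)))"
  let ?f = "\<lambda>z. inv\<^bsub>G (Suc n)\<^esub> (a (Suc n)) \<otimes>\<^bsub>G (Suc n)\<^esub> inv\<^bsub>G (Suc n)\<^esub> z \<otimes>\<^bsub>G (Suc n)\<^esub> b (Suc n)"
  have "y \<in> A_seq E C D i a l j b \<mu> g {c} (Suc (Suc n)) \<longleftrightarrow> (\<exists>x. (x, y) \<in> B_set E C D i a l j b \<mu> g (Suc n) ?A)"
    by (auto simp: image_iff Bex_def)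
  also have "\<dots> \<longleftrightarrow> (\<exists>z\<in>?A. ?walk (?f z, y))"
    using B_set_iff[OF g k(1)] k(2) by auto
  also have "\<dots> \<longleftrightarrow> (\<exists>X Y. walks i l j \<mu> X Y (Suc (Suc n)) \<and> X 1 = c \<and> Y (Suc n) = y \<and>
      (\<forall>k\<in>{2..Suc n}. X k = inv\<^bsub>G k\<^esub> (a k) \<otimes>\<^bsub>G k\<^esub> inv\<^bsub>G k\<^esub> (Y (k - 1)) \<otimes>\<^bsub>G k\<^esub> b k))" (is "?L \<longleftrightarrow> ?R")
  proof
    assume ?L
    then obtain z where z: "z \<in> ?A" "?walk (?f z, y)" by blast
    obtain X Y where XY: "walks i l j \<mu> X Y (Suc n)" "X 1 = c" "Y n = z"
      "\<forall>k\<in>{2..n}. X k = inv\<^bsub>G k\<^esub> (a k) \<otimes>\<^bsub>G k\<^esub> inv\<^bsub>G k\<^esub> (Y (k - 1)) \<otimes>\<^bsub>G k\<^esub> b k"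
      using z(1) step.IH[of z] step by auto
    show ?R
      using XY z(2) step(1) unfolding walks_def
      by (intro exI[of _ "X(Suc n := ?f z)"] exI[of _ "Y(Suc n := y)"]) (auto simp: less_Suc_eq le_Suc_eq)
  next
    assume ?R
    then obtain X Y where XY: "walks i l j \<mu> X Y (Suc (Suc n))" "X 1 = c" "Y (Suc n) = y"
      "\<forall>k\<in>{2..Suc n}. X k = inv\<^bsub>G k\<^esub> (a k) \<otimes>\<^bsub>G k\<^esub> inv\<^bsub>G k\<^esub> (Y (k - 1)) \<otimes>\<^bsub>G k\<^esub> b k"
      by blast
    then have "Y n \<in> ?A" "X (Suc n) = ?f (Y n)"
      using step.IH[of "Y n"] step unfolding walks_def by force+
    moreover have "?walk (X (Suc n), Y (Suc n))" using XY(1) step unfolding walks_def by simp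
    ultimately show ?L using XY(3) by auto
  qed
  finally show ?case .
qed

text \<open>The equations for \<open>b k\<close> give \<open>X 1 = a_1^{-1}b_1\<close> at the left
  end, where \<open>Y 0 = 1\<close>, the recursion of \<open>A_seq_iff\<close> in between, and
  \<open>Y (m - 1) = b_m a_m^{-1}\<close> at the right end, where \<open>X m = 1\<close>. The first
  is the start of the sequence, the last the element tested for membership.\<close>

lemma linked_iff_theta:
  assumes g: "walk_labels E C m D i l j \<mu> g"
    and ab: "coords_in i a l" "coords_in j b \<mu>"
  shows "linked i a l j b \<mu> \<longleftrightarrow> i 1 = j 1 \<and> l m = \<mu> m \<and>
    b m \<otimes>\<^bsub>G m\<^esub> inv\<^bsub>G m\<^esub> (a m) \<in> theta E C m D i a l j b \<mu> g {inv\<^bsub>G 1\<^esub> (a 1) \<otimes>\<^bsub>G 1\<^esub> b 1}"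
proof -
  obtain n where n: "m = Suc n" "1 \<le> n" "n < m" using m2 by (cases m) auto
  let ?c = "inv\<^bsub>G 1\<^esub> (a 1) \<otimes>\<^bsub>G 1\<^esub> b 1" and ?d = "b m \<otimes>\<^bsub>G m\<^esub> inv\<^bsub>G m\<^esub> (a m)"
  have carr: "a k \<in> carrier (G k)" "b k \<in> carrier (G k)" if "k \<in> {1..m}" for k
    using ab that by (auto simp: coords_in_def)
  have XYc: "X k \<in> carrier (G k)" "Y k \<in> carrier (G (Suc k))"
    if XY: "walks i l j \<mu> X Y m" and k: "k \<in> {1..<m}" for X Y k
  proof -
    interpret contact E C "D k" "D (Suc k)" by (rule contact_D[OF k])
    have "walk (l k, i (Suc k)) (X k, Y k) (\<mu> k, j (Suc k))"
      using XY k unfolding walks_def by blast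
    from walk_closed[OF this] show "X k \<in> carrier (G k)" "Y k \<in> carrier (G (Suc k))"
      by (simp_all add: label_carrier)
  qed
  have solve: "u = y \<otimes>\<^bsub>H\<^esub> v \<otimes>\<^bsub>H\<^esub> x \<longleftrightarrow> x = inv\<^bsub>H\<^esub> v \<otimes>\<^bsub>H\<^esub> inv\<^bsub>H\<^esub> y \<otimes>\<^bsub>H\<^esub> u"
    if "group H" "u \<in> carrier H" "v \<in> carrier H" "x \<in> carrier H" "y \<in> carrier H" for H :: "'g monoid" and u v x y
  proof -
    interpret group H by (rule that(1))
    show ?thesis using that by (auto simp: m_assoc inv_cancel_left)
  qed
  interpret first: group "G 1" by (rule group_D) (use m2 in simp)
  interpret final: group "G m" by (rule group_D) (use m2 in simp)
  have m1: "1 \<in> {1..m}" "m \<in> {1..m}" using m2 by auto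
  have "?d \<in> theta E C m D i a l j b \<mu> g {?c} \<longleftrightarrow>
    (\<exists>X Y. walks i l j \<mu> X Y m \<and> X 1 = ?c \<and> Y n = ?d \<and>
      (\<forall>k\<in>{2..n}. X k = inv\<^bsub>G k\<^esub> (a k) \<otimes>\<^bsub>G k\<^esub> inv\<^bsub>G k\<^esub> (Y (k - 1)) \<otimes>\<^bsub>G k\<^esub> b k))"
    using A_seq_iff[OF g n(2,3)] unfolding theta_def n(1) .
  also have "\<dots> \<longleftrightarrow> (\<exists>X Y. walks i l j \<mu> X Y m \<and> Y 0 = \<one>\<^bsub>G 1\<^esub> \<and> X m = \<one>\<^bsub>G m\<^esub> \<and>
        (\<forall>k\<in>{1..m}. b k = Y (k - 1) \<otimes>\<^bsub>G k\<^esub> a k \<otimes>\<^bsub>G k\<^esub> X k))" (is "?L \<longleftrightarrow> ?R")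
  proof
    assume ?L
    then obtain X Y where XY: "walks i l j \<mu> X Y m" "X 1 = ?c" "Y n = ?d"
      "\<And>k. k \<in> {2..n} \<Longrightarrow> X k = inv\<^bsub>G k\<^esub> (a k) \<otimes>\<^bsub>G k\<^esub> inv\<^bsub>G k\<^esub> (Y (k - 1)) \<otimes>\<^bsub>G k\<^esub> b k"
      by blast
    \<comment> \<open>\<open>walks\<close> looks only at the indices \<open>1\<close> to
      \<open>m - 1\<close>, so \<open>X m\<close> and \<open>Y 0\<close> can be set to the
      identities that \<open>linked\<close> demands.\<close>
    let ?X = "X(m := \<one>\<^bsub>G m\<^esub>)" and ?Y = "Y(0 := \<one>\<^bsub>G 1\<^esub>)"
    have W: "walks i l j \<mu> ?X ?Y m" using XY(1) unfolding walks_def by auto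
    have "b k = ?Y (k - 1) \<otimes>\<^bsub>G k\<^esub> a k \<otimes>\<^bsub>G k\<^esub> ?X k" if k: "k \<in> {1..m}" for k
    proof -
      consider "k = 1" | "k = m" "k \<noteq> 1" | "k \<in> {2..n}" using k n by force
      then show ?thesis
      proof cases
        case 1
        then show ?thesis using XY(2) carr[OF m1(1)] m2 by (simp add: first.inv_cancel_left del: One_nat_def)
      next
        case 2
        have Yd: "?Y (m - 1) = ?d" using XY(3) n by simp
        show ?thesis using carr[OF m1(2)] unfolding 2(1) Yd by (simp add: final.m_assoc)
      next
        case 3
        then have k': "k \<in> {1..<m}" "k - 1 \<in> {1..<m}" "Suc (k - 1) = k" using n by auto
        have "X k \<in> carrier (G k)" "Y (k - 1) \<in> carrier (G k)"
          using XYc(1)[OF XY(1) k'(1)] XYc(2)[OF XY(1) k'(2)] k'(3) by simp_all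
        then show ?thesis
          using solve[OF group_D[OF k] carr(2)[OF k] carr(1)[OF k], of "X k" "Y (k - 1)"] XY(4)[OF 3] k' by auto
      qed
    qed
    then show ?R using W by (intro exI[of _ ?X] exI[of _ ?Y]) (use m2 in auto)
  next
    assume ?R
    then obtain X Y where XY: "walks i l j \<mu> X Y m" "Y 0 = \<one>\<^bsub>G 1\<^esub>" "X m = \<one>\<^bsub>G m\<^esub>"
      "\<And>k. k \<in> {1..m} \<Longrightarrow> b k = Y (k - 1) \<otimes>\<^bsub>G k\<^esub> a k \<otimes>\<^bsub>G k\<^esub> X k"
      by blast
    have k1: "1 \<in> {1..<m}" "n \<in> {1..<m}" using n by auto
    have "X 1 = ?c"
      using XY(4)[OF m1(1)] XY(2) carr[OF m1(1)] XYc(1)[OF XY(1) k1(1)] by (simp add: first.inv_cancel_left del: One_nat_def)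
    moreover have "Y n = ?d"
    proof -
      have nm: "m - 1 = n" using n by simp
      have "Y n \<in> carrier (G m)" using XYc(2)[OF XY(1) k1(2)] n(1) by simp
      then show ?thesis
        using XY(4)[OF m1(2)] XY(3) carr[OF m1(2)] unfolding nm by (simp add: final.m_assoc)
    qed
    moreover have "X k = inv\<^bsub>G k\<^esub> (a k) \<otimes>\<^bsub>G k\<^esub> inv\<^bsub>G k\<^esub> (Y (k - 1)) \<otimes>\<^bsub>G k\<^esub> b k" if k2: "k \<in> {2..n}" for k
    proof -
      have k: "k \<in> {1..m}" "k \<in> {1..<m}" "k - 1 \<in> {1..<m}" "Suc (k - 1) = k" using n k2 by auto
      have "X k \<in> carrier (G k)" "Y (k - 1) \<in> carrier (G k)"
        using XYc(1)[OF XY(1) k(2)] XYc(2)[OF XY(1) k(3)] k(4) by simp_all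
      then show ?thesis
        using solve[OF group_D[OF k(1)] carr(2)[OF k(1)] carr(1)[OF k(1)], of "X k" "Y (k - 1)"] XY(4)[OF k(1)] by blast
    qed
    ultimately show ?L using XY(1) by blast
  qed
  finally show ?thesis unfolding linked_def by blast
qed

text \<open>Both halves of \<open>regular_iff_seeded\<close> enter: regular factors are seeded, and
  a product of neighbours that is not regular is not seeded.\<close>

lemma minfact_factors:
  assumes "minimal_r_factorisation E w m p"
  shows "minfact (factors p)" "concat (factors p) = w" "k \<in> {1..m} \<Longrightarrow> p k \<in> words E"
proof -
  have w: "w = concat (factors p)" "\<And>k. k \<in> {1..m} \<Longrightarrow> p k \<in> words E \<and> regular_element (IG E) (bar E (p k))"
    and min: "\<And>i j. 1 \<le> i \<Longrightarrow> i < j \<Longrightarrow> j \<le> m \<Longrightarrow> \<not> regular_element (IG E) (bar E (concat (map p [i..<Suc j])))"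
    using assms unfolding minimal_r_factorisation_def r_factorisation_def by auto
  show "concat (factors p) = w" "k \<in> {1..m} \<Longrightarrow> p k \<in> words E" using w by auto
  have "\<not> seeded (p k @ p (Suc k))" if "1 \<le> k" "Suc k \<le> m" for k
    using min[of k "Suc k"] that seeded_regular by fastforce
  then have "successively (\<lambda>p q. \<not> seeded (p @ q)) (factors p)"
    unfolding successively_conv_nth by (simp del: upt_Suc)
  moreover have "\<forall>x\<in>set (factors p). seeded x"
  proof
    fix x assume "x \<in> set (factors p)"
    then obtain k where "k \<in> set [1..<Suc m]" "x = p k" by (auto simp del: upt_Suc)
    then have "k \<in> {1..m}" "x = p k" by auto
    then show "seeded x" using w(2) regular_iff_seeded by blast
  qed
  ultimately show "minfact (factors p)" unfolding minfact_def by blast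
qed

end

text \<open>The basic-pair condition holds for the images in \<open>S\<close>. A product there that
  equals one of its two factors pulls back to \<open>E\<close> along the injective
  \<open>\<phi>\<close>; this is \<open>val\<close> below, and it is applied to the reversed product
  \<open>fe\<close>.\<close>

lemma biordered_basic_pair_algebra:
  assumes "biordered_set TYPE('s) E" shows "basic_pair_algebra E"
proof -
  obtain S :: "'s sgrp" and \<phi> where S: "is_palgebra E" "is_semigroup S" "palgebra_iso E (idempotent_palgebra S) \<phi>"
    using assms unfolding biordered_set_def by blast
  let ?I = "idempotents S"
  have \<phi>: "\<And>e. e \<in> carrier E \<Longrightarrow> \<phi> e \<in> ?I" "inj_on \<phi> (carrier E)"
    using S(3) by (auto simp: palgebra_iso_def idempotent_palgebra_def bij_betw_def)
  have prod: "map_option \<phi> (pmult E e f) =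
      (if {\<phi> e \<star>\<^bsub>S\<^esub> \<phi> f, \<phi> f \<star>\<^bsub>S\<^esub> \<phi> e} \<inter> {\<phi> e, \<phi> f} \<noteq> {} then Some (\<phi> e \<star>\<^bsub>S\<^esub> \<phi> f) else None)"
    if "e \<in> carrier E" "f \<in> carrier E" for e f
    using S(3) that \<phi>(1) unfolding palgebra_iso_def by (simp add: idempotent_palgebra_def)
  have closed: "g \<in> carrier E" if "e \<in> carrier E" "f \<in> carrier E" "pmult E e f = Some g" for e f g
    using S(1) that unfolding is_palgebra_def by blast
  have val: "pmult E e f = Some h"
    if "e \<in> carrier E" "f \<in> carrier E" "h \<in> carrier E" "\<phi> e \<star>\<^bsub>S\<^esub> \<phi> f = \<phi> h" "h = e \<or> h = f" for e f h
  proof -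
    have "map_option \<phi> (pmult E e f) = Some (\<phi> h)" using prod[OF that(1,2)] that(4,5) by auto
    then obtain g where "pmult E e f = Some g" "\<phi> g = \<phi> h" by auto
    then show ?thesis using closed[OF that(1,2)] \<phi>(2) that(3) by (auto simp: inj_on_def)
  qed
  show ?thesis
  proof
    fix e f g assume ef: "e \<in> carrier E" "f \<in> carrier E" "pmult E e f = Some g"
    then show g: "g \<in> carrier E" by (rule closed)
    have "{\<phi> e \<star>\<^bsub>S\<^esub> \<phi> f, \<phi> f \<star>\<^bsub>S\<^esub> \<phi> e} \<inter> {\<phi> e, \<phi> f} \<noteq> {}" "\<phi> g = \<phi> e \<star>\<^bsub>S\<^esub> \<phi> f"
      using prod[OF ef(1,2)] ef(3) by (auto split: if_splits)
    then consider "\<phi> g = \<phi> e" | "\<phi> g = \<phi> f" | "\<phi> f \<star>\<^bsub>S\<^esub> \<phi> e = \<phi> e" | "\<phi> f \<star>\<^bsub>S\<^esub> \<phi> e = \<phi> f" by auto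
    then show "g = e \<or> g = f \<or> pmult E f e = Some e \<or> pmult E f e = Some f"
      using \<phi>(2) g ef val[of f e e] val[of f e f] by cases (auto simp: inj_on_def)
  next
    fix e assume "e \<in> carrier E"
    then show "pmult E e e = Some e" using val[of e e e] \<phi>(1)[of e] by (simp add: idempotents_def)
  qed
qed

theorem theorem3p9:
  fixes E :: "'e palgebra"
    and C :: "'e list set set \<Rightarrow> ('i, 'g, 'l, 'e list set) rees_coords"
    and D :: "nat \<Rightarrow> 'e list set set"
    and i j :: "nat \<Rightarrow> 'i" and a b :: "nat \<Rightarrow> 'g" and l \<mu> :: "nat \<Rightarrow> 'l"
    and g :: "nat \<Rightarrow> 'g \<times> 'g"
    and m :: nat and u v :: "'e list set"
  assumes biordered: "biordered_set TYPE('s) E"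
    and fin: "finite (carrier E)"
    and coords: "\<And>D'. regular_D_class (IG E) D' \<Longrightarrow> identifies (IG E) D' (C D')"
    and m: "m \<ge> 2"
    and u_fingerprint: "has_fingerprint E m D u"
    and v_fingerprint: "has_fingerprint E m D v"
    and u: "written_as E C m D i a l u"
    and v: "written_as E C m D j b \<mu> v"
    and g: "walk_labels E C m D i l j \<mu> g"
  shows "u = v \<longleftrightarrow>
    i 1 = j 1 \<and> l m = \<mu> m \<and>
    b m \<otimes>\<^bsub>grp (C (D m))\<^esub> inv\<^bsub>grp (C (D m))\<^esub> (a m)
      \<in> theta E C m D i a l j b \<mu> g {inv\<^bsub>grp (C (D 1))\<^esub> (a 1) \<otimes>\<^bsub>grp (C (D 1))\<^esub> b 1}"
proof -
  interpret basic_pair_algebra E by (rule biordered_basic_pair_algebra[OF biordered])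
  interpret coordinatized E C by unfold_locales (rule coords)
  \<comment> \<open>The fingerprint presents the \<open>D k\<close> as classes of regular factors;
    this is what gives them coordinates.\<close>
  have D: "regular_D_class (IG E) (D k)" if "k \<in> {1..m}" for k
    using u_fingerprint that
    unfolding has_fingerprint_def minimal_r_factorisation_def r_factorisation_def regular_D_class_def by metis
  interpret fingerprinted E C m D by unfold_locales (use m D in auto)
  have factored: "\<exists>p. minfact (factors p) \<and> x = bar E (concat (factors p)) \<and> (\<forall>k\<in>{1..m}. p k \<in> words E) \<and>
      has_coords (factors p) i a l \<and> map Dcl (factors p) = map D [1..<Suc m]"
    if x: "written_as E C m D i a l x" for x i a l
  proof -
    obtain w p where p: "minimal_r_factorisation E w m p" "x = bar E w"
      "\<And>k. k \<in> {1..m} \<Longrightarrow> i k \<in> rows (C (D k)) \<and> a k \<in> carrier (grp (C (D k))) \<and> l k \<in> cols (C (D k)) \<and>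
           bar E (p k) = triple (C (D k)) (i k, a k, l k) \<and> bar E (p k) \<in> D k"
      using x unfolding written_as_def by blast
    \<comment> \<open>\<open>written_as\<close> only places the factor in \<open>D k\<close>; as
      \<open>D k\<close> is a \<D>-class, it is the class of that factor.\<close>
    have "Dcl (p k) = D k" if k: "k \<in> {1..m}" for k
      using D[OF k] D_class_eq[OF IG_semigroup] p(3)[OF k] unfolding regular_D_class_def by metis
    then have "map Dcl (factors p) = map D [1..<Suc m]" by auto
    moreover have "has_coords (factors p) i a l"
      unfolding has_coords_def coords_in_def using p(3) by (auto simp del: upt_Suc)
    ultimately show ?thesis using minfact_factors[OF p(1)] p(2) by auto
  qed
  obtain p where p: "minfact (factors p)" "u = bar E (concat (factors p))" "\<And>k. k \<in> {1..m} \<Longrightarrow> p k \<in> words E"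
      "has_coords (factors p) i a l" "map Dcl (factors p) = map D [1..<Suc m]"
    using factored[OF u] by blast
  obtain q where q: "minfact (factors q)" "v = bar E (concat (factors q))" "\<And>k. k \<in> {1..m} \<Longrightarrow> q k \<in> words E"
      "has_coords (factors q) j b \<mu>"
    using factored[OF v] by blast
  have "u = v \<longleftrightarrow> linked i a l j b \<mu>"
  proof
    assume "u = v"
    moreover have "concat (factors p) \<in> words E"
    proof -
      have "p 1 \<noteq> []" "1 \<in> {1..m}" using p(3)[of 1] m by (auto simp: words_def)
      then show ?thesis using p(3) unfolding words_def by (fastforce simp: in_lists_conv_set simp del: upt_Suc)
    qed
    ultimately have "ig_eq E (concat (factors p)) (concat (factors q))"
      using bar_eq_iff p(2) q(2) by blast
    then have "conn (factors p) (factors q)"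
      using minfact_ig_eq[OF _ p(1) _ q(1)] by blast
    then show "linked i a l j b \<mu>"
      using conn_linked[OF _ p(1) p(5) p(4) q(4)] by blast
  next
    assume "linked i a l j b \<mu>"
    then show "u = v" using linked_product[OF _ p(3,4) q(3,4)] p(2) q(2) by simp
  qed
  also have "\<dots> \<longleftrightarrow> i 1 = j 1 \<and> l m = \<mu> m \<and>
    b m \<otimes>\<^bsub>grp (C (D m))\<^esub> inv\<^bsub>grp (C (D m))\<^esub> (a m)
      \<in> theta E C m D i a l j b \<mu> g {inv\<^bsub>grp (C (D 1))\<^esub> (a 1) \<otimes>\<^bsub>grp (C (D 1))\<^esub> b 1}"
    by (rule linked_iff_theta[OF g]) (use p(4) q(4) in \<open>auto simp: has_coords_def\<close>)
  finally show ?thesis .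
qed

end
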